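(* Let $\mathbf{v}_1,\ldots,\mathbf{v}_k$ be orthogonal unit vectors in $\mathbb{R}^k$ and consider the optimization problem \[ \min_{\mathbf{w}_1,\ldots,\mathbf{w}_n\in\mathbb{R}^k} F(\mathbf{w}_1,\ldots,\mathbf{w}_n),\qquad F(\mathbf{w}_1,\ldots,\mathbf{w}_n)=\mathbb{E}_{\mathbf{x}\sim\mathcal{N}(\mathbf{0},I_k)}\left[\frac{1}{2}\left(\sum_{i=1}^{n}[\mathbf{w}_i^\top\mathbf{x}]_+-\sum_{i=1}^{k}[\mathbf{v}_i^\top\mathbf{x}]_+\right)^2\right]. \] Then for $n=k\in\{6,7,\ldots,20\}$, as well as for $(k,n)\in\{(8,9),(10,11),(11,12),(12,13),\ldots,(19,20)\}$ (i.e. $(8,9)$ and all pairs $(k,k+1)$ with $10\le k\le 19$), the function $F$ has spurious local minima.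
   Context: $[z]_+=\max\{0,z\}$ denotes the ReLU function. A spurious local minimum of a function $F$ on Euclidean space is a point $\mathbf{w}$ such that $\inf_{\mathbf{w}'}F(\mathbf{w}')<F(\mathbf{w})\le F(\mathbf{w}')$ for all $\mathbf{w}'$ in some open neighborhood of $\mathbf{w}$. *)

theory Defs
  imports "HOL-Probability.Probability"
begin

definition relu :: "real \<Rightarrow> real" where
  "relu z = max 0 z"

text \<open>Standard Gaussian N(0, I_k) on R^k, with R^k represented as functions
  nat \<Rightarrow> real, coordinates 0..k-1 (extensional outside).\<close>
definition gauss :: "nat \<Rightarrow> (nat \<Rightarrow> real) measure" where
  "gauss k = PiM {..<k} (\<lambda>_. density lborel std_normal_density)"

text \<open>Weights: W i j is the j-th coordinate of w_(i+1) (i < n, j < k);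
  targets: V i j is the j-th coordinate of v_(i+1) (i < k, j < k).\<close>
definition relu_loss :: "nat \<Rightarrow> nat \<Rightarrow> (nat \<Rightarrow> nat \<Rightarrow> real) \<Rightarrow> (nat \<Rightarrow> nat \<Rightarrow> real) \<Rightarrow> real" where
  "relu_loss k n V W = integral\<^sup>L (gauss k)
     (\<lambda>x. (1/2) * ((\<Sum>i<n. relu (\<Sum>j<k. W i j * x j)) - (\<Sum>i<k. relu (\<Sum>j<k. V i j * x j)))\<^sup>2)"

definition orthonormal_rows :: "nat \<Rightarrow> (nat \<Rightarrow> nat \<Rightarrow> real) \<Rightarrow> bool" where
  "orthonormal_rows k V \<longleftrightarrow>
     (\<forall>i<k. \<forall>i'<k. (\<Sum>j<k. V i j * V i' j) = (if i = i' then 1 else 0))"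

text \<open>Spurious local minimum of a function on R^(n*k), the point being an n-tuple
  of vectors in R^k (only entries i < n, j < k are relevant); the open neighbourhood
  is a Euclidean ball.\<close>
definition spurious_local_min :: "nat \<Rightarrow> nat \<Rightarrow> ((nat \<Rightarrow> nat \<Rightarrow> real) \<Rightarrow> real) \<Rightarrow> (nat \<Rightarrow> nat \<Rightarrow> real) \<Rightarrow> bool" where
  "spurious_local_min n k F W \<longleftrightarrow>
     (\<exists>W'. F W' < F W) \<and>
     (\<exists>e>0. \<forall>W'. (\<Sum>i<n. \<Sum>j<k. (W' i j - W i j)\<^sup>2) < e\<^sup>2 \<longrightarrow> F W \<le> F W')"

definition pairs_claimed :: "(nat \<times> nat) set" where
  "pairs_claimed = {(k, k) | k. 6 \<le> k \<and> k \<le> 20} \<union> {(8, 9)} \<union> {(k, k + 1) | k. 10 \<le> k \<and> k \<le> 19}"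

end

theory Submission
  imports Defs "HOL-Real_Asymp.Real_Asymp" "Jordan_Normal_Form.Determinant" "HOL-Library.Type_Length"
begin

text \<open>A product of two rectified Gaussian linear forms has an explicit expectation in terms of norms and inner
  products, so \<open>2 \<pi> F\<close> becomes an elementary function of the Gram data of the rows, and orthonormality of the
  targets lets one work in the target basis. In each case there is a critical point invariant under permuting
  all but one of the targets. At a dyadic approximation \<open>C\<close> of it the gradient has entries at most
  \<open>1 / 2 ^ 41\<close> and the Hessian is at least \<open>1 / 128\<close>. An explicit Lipschitz bound on the Hessian shows that
  the loss on the sphere of radius \<open>1 / 2 ^ 27\<close> around \<open>C\<close> exceeds its value at \<open>C\<close>, so the minimum over the
  closed ball is attained inside and is a local minimum; the loss there is positive, whereas the target
  network itself has loss zero.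

  By symmetry the Hessian splits into a form in the off-diagonal entries, bounded by two scalars, and two
  quadratic forms in few variables. Their positivity, the gradient bound and the size of the loss are finite
  computations with \<open>\<pi>\<close>, square roots and arctangents, carried out in integer interval arithmetic by
  rewriting.\<close>

section \<open>Joint laws of two Gaussian linear forms\<close>

abbreviation std_gauss :: "real measure" where
  "std_gauss \<equiv> density lborel std_normal_density"

lemma nn_integral_lborel_swap:
  fixes f :: "real \<times> real \<Rightarrow> ennreal"
  assumes [measurable]: "f \<in> borel_measurable (borel \<Otimes>\<^sub>M borel)"
  shows "(\<integral>\<^sup>+x. \<integral>\<^sup>+y. f (x, y) \<partial>lborel \<partial>lborel) = (\<integral>\<^sup>+y. \<integral>\<^sup>+x. f (x, y) \<partial>lborel \<partial>lborel)"
  by (rule lborel_pair.Fubini'[symmetric]) measurable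

lemma nn_integral_lborel_shear_snd:
  fixes f :: "real \<times> real \<Rightarrow> ennreal"
  assumes [measurable]: "f \<in> borel_measurable (borel \<Otimes>\<^sub>M borel)"
  shows "(\<integral>\<^sup>+x. \<integral>\<^sup>+y. f (x, y + u * x) \<partial>lborel \<partial>lborel) = (\<integral>\<^sup>+x. \<integral>\<^sup>+y. f (x, y) \<partial>lborel \<partial>lborel)"
proof (rule nn_integral_cong)
  fix x :: real
  have "(\<lambda>y. f (x, y)) \<in> borel_measurable borel" by measurable
  from nn_integral_real_affine[OF this, of 1 "u * x"]
  show "(\<integral>\<^sup>+y. f (x, y + u * x) \<partial>lborel) = (\<integral>\<^sup>+y. f (x, y) \<partial>lborel)"
    by (simp add: add.commute)
qed

lemma nn_integral_lborel_shear_fst: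
  fixes f :: "real \<times> real \<Rightarrow> ennreal"
  assumes [measurable]: "f \<in> borel_measurable (borel \<Otimes>\<^sub>M borel)"
  shows "(\<integral>\<^sup>+x. \<integral>\<^sup>+y. f (x + u * y, y) \<partial>lborel \<partial>lborel) = (\<integral>\<^sup>+x. \<integral>\<^sup>+y. f (x, y) \<partial>lborel \<partial>lborel)"
  using nn_integral_lborel_swap[of "\<lambda>(x, y). f (x + u * y, y)"] nn_integral_lborel_swap[of f]
    nn_integral_lborel_shear_snd[of "\<lambda>(y, x). f (x, y)" u]
  by simp

lemma nn_integral_lborel_rotate:
  fixes f :: "real \<times> real \<Rightarrow> ennreal"
  assumes [measurable]: "f \<in> borel_measurable (borel \<Otimes>\<^sub>M borel)"
    and unit: "c\<^sup>2 + s\<^sup>2 = 1" and "s \<noteq> 0"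
  shows "(\<integral>\<^sup>+x. \<integral>\<^sup>+y. f (c * x - s * y, s * x + c * y) \<partial>lborel \<partial>lborel) = (\<integral>\<^sup>+x. \<integral>\<^sup>+y. f (x, y) \<partial>lborel \<partial>lborel)"
proof -
  define u where "u = (c - 1) / s"
  have shear_scale: "1 + s * u = c" using \<open>s \<noteq> 0\<close> by (simp add: u_def)
  have "s * (u + u * c) = (s * u) * (1 + c)" by (simp add: algebra_simps)
  also have "s * u = c - 1" using \<open>s \<noteq> 0\<close> by (simp add: u_def)
  also have "(c - 1) * (1 + c) = c\<^sup>2 - 1" by (simp add: power2_eq_square algebra_simps)
  also have "c\<^sup>2 - 1 = s * (- s)" using unit by (simp add: power2_eq_square)
  finally have shear_offset: "u + u * c = - s" using \<open>s \<noteq> 0\<close> by (metis mult_left_cancel)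
  define f1 where "f1 = (\<lambda>(x, y). f (x + u * y, y))"
  define f2 where "f2 = (\<lambda>(x, y). f1 (x, y + s * x))"
  have [measurable]: "f1 \<in> borel_measurable (borel \<Otimes>\<^sub>M borel)" "f2 \<in> borel_measurable (borel \<Otimes>\<^sub>M borel)"
    unfolding f1_def f2_def by measurable
  have three_shears: "f (c * x - s * y, s * x + c * y) = f2 (x + u * y, y)" for x y
  proof -
    have "y + s * (x + u * y) = s * x + (1 + s * u) * y" by (simp add: algebra_simps)
    moreover have "x + u * y + u * (s * x + c * y) = (1 + s * u) * x + (u + u * c) * y" by (simp add: algebra_simps)
    ultimately show ?thesis by (simp add: f2_def f1_def shear_scale shear_offset)
  qed
  show ?thesis
    using nn_integral_lborel_shear_fst[of f2 u] nn_integral_lborel_shear_snd[of f1 s]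
      nn_integral_lborel_shear_fst[of f u]
    by (simp add: three_shears f1_def f2_def)
qed

lemma nn_integral_std_gauss_pair:
  fixes f :: "real \<times> real \<Rightarrow> ennreal"
  assumes [measurable]: "f \<in> borel_measurable (borel \<Otimes>\<^sub>M borel)"
  shows "(\<integral>\<^sup>+x. \<integral>\<^sup>+y. f (x, y) \<partial>std_gauss \<partial>std_gauss)
    = (\<integral>\<^sup>+x. \<integral>\<^sup>+y. ennreal (exp (- (x\<^sup>2 + y\<^sup>2) / 2) / (2 * pi)) * f (x, y) \<partial>lborel \<partial>lborel)"
proof -
  have "std_normal_density x * std_normal_density y = exp (- (x\<^sup>2 + y\<^sup>2) / 2) / (2 * pi)" for x y
    by (simp add: std_normal_density_def exp_add[symmetric] add_divide_distrib diff_divide_distrib)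
  hence density: "ennreal (std_normal_density x) * (ennreal (std_normal_density y) * z)
      = ennreal (exp (- (x\<^sup>2 + y\<^sup>2) / 2) / (2 * pi)) * z" for x y z
    by (simp add: ennreal_mult[symmetric] mult.assoc[symmetric])
  have "(\<integral>\<^sup>+x. \<integral>\<^sup>+y. f (x, y) \<partial>std_gauss \<partial>std_gauss)
    = (\<integral>\<^sup>+x. ennreal (std_normal_density x) * (\<integral>\<^sup>+y. ennreal (std_normal_density y) * f (x, y) \<partial>lborel) \<partial>lborel)"
    by (subst nn_integral_density; simp add: nn_integral_density)
  thus ?thesis by (simp add: nn_integral_cmult[symmetric] density)
qed

lemma nn_integral_std_gauss_rotate:
  fixes f :: "real \<times> real \<Rightarrow> ennreal"
  assumes [measurable]: "f \<in> borel_measurable (borel \<Otimes>\<^sub>M borel)"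
    and unit: "c\<^sup>2 + s\<^sup>2 = 1" and "c \<ge> 0"
  shows "(\<integral>\<^sup>+x. \<integral>\<^sup>+y. f (c * x - s * y, s * x + c * y) \<partial>std_gauss \<partial>std_gauss)
       = (\<integral>\<^sup>+x. \<integral>\<^sup>+y. f (x, y) \<partial>std_gauss \<partial>std_gauss)"
proof (cases "s = 0")
  case True
  with unit \<open>c \<ge> 0\<close> show ?thesis by (simp add: power2_eq_1_iff)
next
  case False
  define g where "g = (\<lambda>(x, y). ennreal (exp (- (x\<^sup>2 + y\<^sup>2) / 2) / (2 * pi)) * f (x, y))"
  have [measurable]: "g \<in> borel_measurable (borel \<Otimes>\<^sub>M borel)" unfolding g_def by measurable
  have "(c * x - s * y)\<^sup>2 + (s * x + c * y)\<^sup>2 = (c\<^sup>2 + s\<^sup>2) * (x\<^sup>2 + y\<^sup>2)" for x y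
    by (simp add: algebra_simps power2_eq_square)
  hence norm: "(c * x - s * y)\<^sup>2 + (s * x + c * y)\<^sup>2 = x\<^sup>2 + y\<^sup>2" for x y
    by (simp add: unit)
  have "(\<integral>\<^sup>+x. \<integral>\<^sup>+y. f (c * x - s * y, s * x + c * y) \<partial>std_gauss \<partial>std_gauss)
      = (\<integral>\<^sup>+x. \<integral>\<^sup>+y. g (c * x - s * y, s * x + c * y) \<partial>lborel \<partial>lborel)"
    unfolding g_def prod.case norm
    by (rule nn_integral_std_gauss_pair[of "\<lambda>(x, y). f (c * x - s * y, s * x + c * y)", unfolded prod.case]) measurable
  also have "\<dots> = (\<integral>\<^sup>+x. \<integral>\<^sup>+y. g (x, y) \<partial>lborel \<partial>lborel)"
    by (intro nn_integral_lborel_rotate unit False) measurable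
  also have "\<dots> = (\<integral>\<^sup>+x. \<integral>\<^sup>+y. f (x, y) \<partial>std_gauss \<partial>std_gauss)"
    by (simp add: nn_integral_std_gauss_pair g_def)
  finally show ?thesis .
qed

lemma nn_integral_std_gauss_rotate_forms:
  fixes f :: "real \<times> real \<Rightarrow> ennreal"
  assumes [measurable]: "f \<in> borel_measurable (borel \<Otimes>\<^sub>M borel)"
    and unit: "c\<^sup>2 + s\<^sup>2 = 1" and "c \<ge> 0"
  shows "(\<integral>\<^sup>+x. \<integral>\<^sup>+y. f (r * c * x + r * s * y, b * x + d * y) \<partial>std_gauss \<partial>std_gauss)
       = (\<integral>\<^sup>+x. \<integral>\<^sup>+y. f (r * x, (b * c + d * s) * x + (d * c - b * s) * y) \<partial>std_gauss \<partial>std_gauss)"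
proof -
  define g where "g = (\<lambda>(x, y). f (r * c * x + r * s * y, b * x + d * y))"
  have [measurable]: "g \<in> borel_measurable (borel \<Otimes>\<^sub>M borel)" unfolding g_def by measurable
  have "r * c * (c * x - s * y) + r * s * (s * x + c * y) = r * (c\<^sup>2 + s\<^sup>2) * x" for x y
    by (simp add: algebra_simps power2_eq_square)
  moreover have "b * (c * x - s * y) + d * (s * x + c * y) = (b * c + d * s) * x + (d * c - b * s) * y" for x y
    by (simp add: algebra_simps)
  ultimately show ?thesis
    using nn_integral_std_gauss_rotate[of g c s] unit \<open>c \<ge> 0\<close> by (simp add: g_def)
qed

lemma prob_space_std_gauss: "prob_space std_gauss"
  using prob_space_normal_density[of 1 0] by simp

interpretation std_gauss: prob_space std_gauss
  by (rule prob_space_std_gauss)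

interpretation std_gauss_pair: pair_sigma_finite std_gauss std_gauss ..

interpretation std_gauss_product: product_sigma_finite "\<lambda>_ :: nat. std_gauss" ..

lemma nn_integral_std_gauss_add:
  fixes g :: "real \<Rightarrow> ennreal"
  assumes [measurable]: "g \<in> borel_measurable borel" and unit: "c\<^sup>2 + s\<^sup>2 = 1" "c \<ge> 0"
  shows "(\<integral>\<^sup>+x. \<integral>\<^sup>+y. g (r * c * x + r * s * y) \<partial>std_gauss \<partial>std_gauss) = (\<integral>\<^sup>+x. g (r * x) \<partial>std_gauss)"
  using nn_integral_std_gauss_rotate_forms[where f = "\<lambda>(u, v). g u", OF _ unit, of r 0 0] std_gauss.emeasure_space_1
  by simp

lemma polar_coordinates:
  fixes u v :: real
  assumes "u \<ge> 0"
  obtains c s r where "c \<ge> 0" "r \<ge> 0" "c\<^sup>2 + s\<^sup>2 = 1" "r\<^sup>2 = u\<^sup>2 + v\<^sup>2" "u = r * c" "v = r * s"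
proof (cases "u\<^sup>2 + v\<^sup>2 = 0")
  case True
  hence "u = 0" "v = 0" by (simp_all add: sum_power2_eq_zero_iff)
  thus ?thesis using that[of 1 0 0] by simp
next
  case False
  define r where "r = sqrt (u\<^sup>2 + v\<^sup>2)"
  have "u\<^sup>2 + v\<^sup>2 > 0" using False by (metis sum_power2_ge_zero order_le_less)
  hence r: "r > 0" "r\<^sup>2 = u\<^sup>2 + v\<^sup>2" by (simp_all add: r_def)
  have "(u / r)\<^sup>2 + (v / r)\<^sup>2 = 1"
    using r(1) unfolding power_divide add_divide_distrib[symmetric] r(2)[symmetric] by simp
  thus ?thesis using that[of "u / r" r "v / r"] r assms by simp
qed

lemma nn_integral_std_gauss_swap:
  fixes f :: "real \<Rightarrow> real \<Rightarrow> ennreal"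
  assumes "case_prod f \<in> borel_measurable (borel \<Otimes>\<^sub>M borel)"
  shows "(\<integral>\<^sup>+x. \<integral>\<^sup>+y. f x y \<partial>std_gauss \<partial>std_gauss) = (\<integral>\<^sup>+y. \<integral>\<^sup>+x. f x y \<partial>std_gauss \<partial>std_gauss)"
  by (rule std_gauss_pair.Fubini'[symmetric]) (use assms in simp)

lemma nn_integral_gauss_Suc:
  assumes "f \<in> borel_measurable (gauss (Suc k))"
  shows "(\<integral>\<^sup>+x. f x \<partial>gauss (Suc k)) = (\<integral>\<^sup>+y. \<integral>\<^sup>+x. f (x(k := y)) \<partial>gauss k \<partial>std_gauss)"
  using assms unfolding gauss_def lessThan_Suc by (intro std_gauss_product.product_nn_integral_insert_rev) auto

text \<open>Two rotations, one after the other: the first absorbs \<open>a y\<close> into \<open>\<alpha> x\<close>, the second the rest of \<open>b y\<close>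
  into \<open>\<gamma> z\<close>.\<close>

lemma nn_integral_std_gauss_absorb:
  fixes a b \<alpha> \<beta> \<gamma> :: real
  assumes "\<alpha> \<ge> 0" "\<gamma> \<ge> 0"
  obtains \<alpha>' \<gamma>' \<beta>' where "\<alpha>' \<ge> 0" "\<gamma>' \<ge> 0" "\<alpha>'\<^sup>2 = \<alpha>\<^sup>2 + a\<^sup>2" "\<alpha>' * \<beta>' = \<alpha> * \<beta> + a * b"
    "\<beta>'\<^sup>2 + \<gamma>'\<^sup>2 = \<beta>\<^sup>2 + \<gamma>\<^sup>2 + b\<^sup>2"
    "\<And>f :: real \<times> real \<Rightarrow> ennreal. f \<in> borel_measurable (borel \<Otimes>\<^sub>M borel) \<Longrightarrow>
       (\<integral>\<^sup>+y. \<integral>\<^sup>+x. \<integral>\<^sup>+z. f (\<alpha> * x + a * y, \<beta> * x + \<gamma> * z + b * y) \<partial>std_gauss \<partial>std_gauss \<partial>std_gauss)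
       = (\<integral>\<^sup>+x. \<integral>\<^sup>+z. f (\<alpha>' * x, \<beta>' * x + \<gamma>' * z) \<partial>std_gauss \<partial>std_gauss)"
proof -
  obtain c s r where polar: "c \<ge> 0" "r \<ge> 0" "c\<^sup>2 + s\<^sup>2 = 1" "r\<^sup>2 = \<alpha>\<^sup>2 + a\<^sup>2" "\<alpha> = r * c" "a = r * s"
    using polar_coordinates[OF \<open>\<alpha> \<ge> 0\<close>] .
  define \<beta>' where "\<beta>' = \<beta> * c + b * s"
  define \<delta> where "\<delta> = b * c - \<beta> * s"
  obtain c' s' r' where polar': "c' \<ge> 0" "r' \<ge> 0" "c'\<^sup>2 + s'\<^sup>2 = 1" "r'\<^sup>2 = \<gamma>\<^sup>2 + \<delta>\<^sup>2" "\<gamma> = r' * c'" "\<delta> = r' * s'"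
    using polar_coordinates[OF \<open>\<gamma> \<ge> 0\<close>] .
  have "r * \<beta>' = \<alpha> * \<beta> + a * b"
    unfolding \<beta>'_def polar(5,6) by (simp add: algebra_simps)
  moreover have "\<beta>'\<^sup>2 + r'\<^sup>2 = \<beta>\<^sup>2 + \<gamma>\<^sup>2 + b\<^sup>2"
  proof -
    have "\<beta>'\<^sup>2 + \<delta>\<^sup>2 = (c\<^sup>2 + s\<^sup>2) * (\<beta>\<^sup>2 + b\<^sup>2)"
      unfolding \<beta>'_def \<delta>_def by (simp add: algebra_simps power2_eq_square)
    thus ?thesis using polar(3) polar'(4) by simp
  qed
  moreover have "(\<integral>\<^sup>+y. \<integral>\<^sup>+x. \<integral>\<^sup>+z. f (\<alpha> * x + a * y, \<beta> * x + \<gamma> * z + b * y) \<partial>std_gauss \<partial>std_gauss \<partial>std_gauss)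
       = (\<integral>\<^sup>+x. \<integral>\<^sup>+z. f (r * x, \<beta>' * x + r' * z) \<partial>std_gauss \<partial>std_gauss)" (is "?lhs = _")
    if [measurable]: "f \<in> borel_measurable (borel \<Otimes>\<^sub>M borel)" for f :: "real \<times> real \<Rightarrow> ennreal"
  proof -
    have "?lhs = (\<integral>\<^sup>+x. \<integral>\<^sup>+y. \<integral>\<^sup>+z. f (\<alpha> * x + a * y, \<beta> * x + \<gamma> * z + b * y) \<partial>std_gauss \<partial>std_gauss \<partial>std_gauss)"
      by (rule nn_integral_std_gauss_swap) measurable
    also have "\<dots> = (\<integral>\<^sup>+x. \<integral>\<^sup>+y. \<integral>\<^sup>+z. f (r * x, \<beta>' * x + (\<gamma> * z + \<delta> * y)) \<partial>std_gauss \<partial>std_gauss \<partial>std_gauss)"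
      using nn_integral_std_gauss_rotate_forms[where f = "\<lambda>(u, v). \<integral>\<^sup>+z. f (u, v + \<gamma> * z) \<partial>std_gauss", OF _ polar(3,1),
        of r \<beta> b]
      by (simp add: polar(5,6) \<beta>'_def \<delta>_def ac_simps)
    also have "\<dots> = (\<integral>\<^sup>+x. \<integral>\<^sup>+z. \<integral>\<^sup>+y. f (r * x, \<beta>' * x + (\<gamma> * z + \<delta> * y)) \<partial>std_gauss \<partial>std_gauss \<partial>std_gauss)"
      by (intro nn_integral_cong nn_integral_std_gauss_swap) measurable
    also have "\<dots> = (\<integral>\<^sup>+x. \<integral>\<^sup>+z. f (r * x, \<beta>' * x + r' * z) \<partial>std_gauss \<partial>std_gauss)"
      unfolding polar'(5,6) by (intro nn_integral_cong nn_integral_std_gauss_add polar'(3,1)) measurable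
    finally show ?thesis .
  qed
  ultimately show ?thesis using that[of r r' \<beta>'] polar(2,4) polar'(2) by blast
qed

definition dot :: "nat \<Rightarrow> (nat \<Rightarrow> real) \<Rightarrow> (nat \<Rightarrow> real) \<Rightarrow> real" where
  "dot k x y = (\<Sum>j<k. x j * y j)"

lemma measurable_dot [measurable]: "dot k a \<in> borel_measurable (gauss k)"
  unfolding dot_def[abs_def] gauss_def by measurable

lemma dot_fun_upd: "dot (Suc k) a (x(k := y)) = dot k a x + a k * y"
  by (simp add: dot_def)

text \<open>The law is that of \<open>(\<alpha> X, \<beta> X + \<gamma> Y)\<close> for independent standard normal \<open>X\<close> and \<open>Y\<close>: a Cholesky factor of
  the Gram matrix.\<close>

lemma gauss_dot_pair_law:
  obtains \<alpha> \<gamma> \<beta> where "\<alpha> \<ge> 0" "\<gamma> \<ge> 0" "\<alpha>\<^sup>2 = dot k a a" "\<alpha> * \<beta> = dot k a b" "\<beta>\<^sup>2 + \<gamma>\<^sup>2 = dot k b b"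
    "\<And>f :: real \<times> real \<Rightarrow> ennreal. f \<in> borel_measurable (borel \<Otimes>\<^sub>M borel) \<Longrightarrow>
       (\<integral>\<^sup>+x. f (dot k a x, dot k b x) \<partial>gauss k) = (\<integral>\<^sup>+x. \<integral>\<^sup>+y. f (\<alpha> * x, \<beta> * x + \<gamma> * y) \<partial>std_gauss \<partial>std_gauss)"
proof (induction k arbitrary: thesis)
  case 0
  have "emeasure std_gauss UNIV = 1" using std_gauss.emeasure_space_1 by simp
  thus ?case
    by (intro 0[of 0 0 0]) (simp_all add: gauss_def dot_def PiM_empty nn_integral_count_space_finite)
next
  case (Suc k)
  obtain \<alpha> \<gamma> \<beta> where gram: "\<alpha> \<ge> 0" "\<gamma> \<ge> 0" "\<alpha>\<^sup>2 = dot k a a" "\<alpha> * \<beta> = dot k a b" "\<beta>\<^sup>2 + \<gamma>\<^sup>2 = dot k b b"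
    and law: "\<And>f :: real \<times> real \<Rightarrow> ennreal. f \<in> borel_measurable (borel \<Otimes>\<^sub>M borel) \<Longrightarrow>
       (\<integral>\<^sup>+x. f (dot k a x, dot k b x) \<partial>gauss k) = (\<integral>\<^sup>+x. \<integral>\<^sup>+y. f (\<alpha> * x, \<beta> * x + \<gamma> * y) \<partial>std_gauss \<partial>std_gauss)"
    by (rule Suc.IH) blast
  obtain \<alpha>' \<gamma>' \<beta>' where gram': "\<alpha>' \<ge> 0" "\<gamma>' \<ge> 0" "\<alpha>'\<^sup>2 = \<alpha>\<^sup>2 + (a k)\<^sup>2" "\<alpha>' * \<beta>' = \<alpha> * \<beta> + a k * b k"
      "\<beta>'\<^sup>2 + \<gamma>'\<^sup>2 = \<beta>\<^sup>2 + \<gamma>\<^sup>2 + (b k)\<^sup>2"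
    and absorb: "\<And>f :: real \<times> real \<Rightarrow> ennreal. f \<in> borel_measurable (borel \<Otimes>\<^sub>M borel) \<Longrightarrow>
       (\<integral>\<^sup>+y. \<integral>\<^sup>+x. \<integral>\<^sup>+z. f (\<alpha> * x + a k * y, \<beta> * x + \<gamma> * z + b k * y) \<partial>std_gauss \<partial>std_gauss \<partial>std_gauss)
       = (\<integral>\<^sup>+x. \<integral>\<^sup>+z. f (\<alpha>' * x, \<beta>' * x + \<gamma>' * z) \<partial>std_gauss \<partial>std_gauss)"
    using nn_integral_std_gauss_absorb[OF gram(1,2), where a = "a k" and b = "b k" and \<beta> = \<beta>] by blast
  show ?case
  proof (rule Suc.prems[OF gram'(1,2)])
    show "\<alpha>'\<^sup>2 = dot (Suc k) a a" "\<alpha>' * \<beta>' = dot (Suc k) a b" "\<beta>'\<^sup>2 + \<gamma>'\<^sup>2 = dot (Suc k) b b"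
      unfolding gram'(3-5) gram(3-5) by (simp_all add: dot_def power2_eq_square)
    fix f :: "real \<times> real \<Rightarrow> ennreal" assume [measurable]: "f \<in> borel_measurable (borel \<Otimes>\<^sub>M borel)"
    have "(\<integral>\<^sup>+x. f (dot (Suc k) a x, dot (Suc k) b x) \<partial>gauss (Suc k))
      = (\<integral>\<^sup>+y. \<integral>\<^sup>+x. f (dot k a x + a k * y, dot k b x + b k * y) \<partial>gauss k \<partial>std_gauss)"
      by (subst nn_integral_gauss_Suc) (measurable, simp only: dot_fun_upd)
    also have "\<dots> = (\<integral>\<^sup>+y. \<integral>\<^sup>+x. \<integral>\<^sup>+z. f (\<alpha> * x + a k * y, \<beta> * x + \<gamma> * z + b k * y) \<partial>std_gauss \<partial>std_gauss \<partial>std_gauss)"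
    proof (rule nn_integral_cong)
      fix y
      show "(\<integral>\<^sup>+x. f (dot k a x + a k * y, dot k b x + b k * y) \<partial>gauss k)
        = (\<integral>\<^sup>+x. \<integral>\<^sup>+z. f (\<alpha> * x + a k * y, \<beta> * x + \<gamma> * z + b k * y) \<partial>std_gauss \<partial>std_gauss)"
        using law[of "\<lambda>(u, v). f (u + a k * y, v + b k * y)"] by simp
    qed
    also have "\<dots> = (\<integral>\<^sup>+x. \<integral>\<^sup>+y. f (\<alpha>' * x, \<beta>' * x + \<gamma>' * y) \<partial>std_gauss \<partial>std_gauss)"
      by (rule absorb) measurable
    finally show "(\<integral>\<^sup>+x. f (dot (Suc k) a x, dot (Suc k) b x) \<partial>gauss (Suc k))
      = (\<integral>\<^sup>+x. \<integral>\<^sup>+y. f (\<alpha>' * x, \<beta>' * x + \<gamma>' * y) \<partial>std_gauss \<partial>std_gauss)" .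
  qed
qed

section \<open>Expectations of products of rectified linear forms\<close>

lemma relu_measurable [measurable]: "relu \<in> borel_measurable borel"
  unfolding relu_def by measurable

lemma relu_nonneg: "0 \<le> relu z"
  by (simp add: relu_def)

lemma relu_mult_nonneg: "0 \<le> c \<Longrightarrow> relu (c * z) = c * relu z"
  by (simp add: relu_def max_mult_distrib_left)

lemma nn_integral_cubic_gaussian:
  fixes c :: real
  assumes "c > 0"
  shows "(\<integral>\<^sup>+x. ennreal (x ^ 3 * exp (- (c * x\<^sup>2) / 2)) * indicator {0..} x \<partial>lborel) = ennreal (2 / c\<^sup>2)"
proof -
  let ?F = "\<lambda>x. - (x\<^sup>2 / c + 2 / c\<^sup>2) * exp (- (c * x\<^sup>2) / 2)"
  have "(\<integral>\<^sup>+x. ennreal (x ^ 3 * exp (- (c * x\<^sup>2) / 2)) * indicator {0..} x \<partial>lborel) = ennreal (0 - ?F 0)"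
  proof (rule nn_integral_FTC_atLeast)
    fix x :: real
    show "DERIV ?F x :> x ^ 3 * exp (- (c * x\<^sup>2) / 2)"
      using assms by (auto intro!: derivative_eq_intros simp: field_simps power2_eq_square power3_eq_cube)
    show "(?F \<longlongrightarrow> 0) at_top" using assms by real_asymp
  qed auto
  thus ?thesis by simp
qed

lemma nn_integral_gaussian_slope:
  fixes \<phi> :: "real \<Rightarrow> ennreal"
  assumes [measurable]: "\<phi> \<in> borel_measurable borel"
  shows "(\<integral>\<^sup>+y. ennreal (exp (- (x\<^sup>2 + y\<^sup>2) / 2) / (2 * pi)) * (indicator {0<..} x * (ennreal (x\<^sup>2) * \<phi> (y / x)))
    \<partial>lborel)
    = (\<integral>\<^sup>+t. ennreal (1 / (2 * pi)) * \<phi> t * (ennreal (x ^ 3 * exp (- ((1 + t\<^sup>2) * x\<^sup>2) / 2)) * indicator {0..} x)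
      \<partial>lborel)"
    (is "_ = (\<integral>\<^sup>+t. _ * ?h t \<partial>lborel)")
proof (cases "x > 0")
  case False
  thus ?thesis by (cases "x = 0") (simp_all add: indicator_def)
next
  case True
  define \<rho> where "\<rho> y = exp (- (x\<^sup>2 + y\<^sup>2) / 2) / (2 * pi)" for y
  define f where "f y = ennreal (\<rho> y) * (indicator {0<..} x * (ennreal (x\<^sup>2) * \<phi> (y / x)))" for y
  have [measurable]: "f \<in> borel_measurable borel" unfolding f_def \<rho>_def by measurable
  have "(\<integral>\<^sup>+y. f y \<partial>lborel) = (\<integral>\<^sup>+t. ennreal \<bar>x\<bar> * f (0 + x * t) \<partial>lborel)"
    using True by (subst nn_integral_real_affine[where c = x and t = 0]) (auto simp: nn_integral_cmult)
  also have "\<dots> = (\<integral>\<^sup>+t. ennreal (1 / (2 * pi)) * \<phi> t * ?h t \<partial>lborel)"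
  proof (rule nn_integral_cong)
    fix t :: real
    have "x * (\<rho> (0 + x * t) * x\<^sup>2) = 1 / (2 * pi) * (x ^ 3 * exp (- ((1 + t\<^sup>2) * x\<^sup>2) / 2))"
      by (simp add: \<rho>_def power2_eq_square power3_eq_cube algebra_simps)
    hence "ennreal x * (ennreal (\<rho> (0 + x * t)) * ennreal (x\<^sup>2)) = ennreal (1 / (2 * pi)) * ?h t"
      using True by (simp add: \<rho>_def ennreal_mult[symmetric])
    thus "ennreal \<bar>x\<bar> * f (0 + x * t) = ennreal (1 / (2 * pi)) * \<phi> t * ?h t"
      using True by (simp add: f_def mult.assoc[symmetric]) (simp add: mult_ac)
  qed
  finally show ?thesis by (simp only: f_def \<rho>_def)
qed

text \<open>Substitute \<open>y = t x\<close> and integrate over \<open>x\<close> first.\<close>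

lemma nn_integral_half_plane_homogeneous:
  fixes \<phi> :: "real \<Rightarrow> ennreal"
  assumes [measurable]: "\<phi> \<in> borel_measurable borel"
  shows "(\<integral>\<^sup>+x. \<integral>\<^sup>+y. indicator {0<..} x * (ennreal (x\<^sup>2) * \<phi> (y / x)) \<partial>std_gauss \<partial>std_gauss)
    = (\<integral>\<^sup>+t. ennreal (1 / (pi * (1 + t\<^sup>2)\<^sup>2)) * \<phi> t \<partial>lborel)" (is "?lhs = _")
proof -
  define h where "h t x = ennreal (x ^ 3 * exp (- ((1 + t\<^sup>2) * x\<^sup>2) / 2)) * indicator {0..} x" for t x :: real
  have "?lhs = (\<integral>\<^sup>+x. \<integral>\<^sup>+t. ennreal (1 / (2 * pi)) * \<phi> t * h t x \<partial>lborel \<partial>lborel)"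
    using nn_integral_std_gauss_pair[of "\<lambda>(x, y). indicator {0<..} x * (ennreal (x\<^sup>2) * \<phi> (y / x))"]
    unfolding prod.case nn_integral_gaussian_slope[OF assms] h_def[symmetric] by measurable
  also have "\<dots> = (\<integral>\<^sup>+t. \<integral>\<^sup>+x. ennreal (1 / (2 * pi)) * \<phi> t * h t x \<partial>lborel \<partial>lborel)"
    unfolding h_def by (rule lborel_pair.Fubini'[symmetric]) measurable
  also have "\<dots> = (\<integral>\<^sup>+t. ennreal (1 / (pi * (1 + t\<^sup>2)\<^sup>2)) * \<phi> t \<partial>lborel)"
  proof (rule nn_integral_cong)
    fix t :: real
    have "1 + t\<^sup>2 > 0" by (simp add: add_pos_nonneg)
    hence "(\<integral>\<^sup>+x. ennreal (1 / (2 * pi)) * \<phi> t * h t x \<partial>lborel)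
      = ennreal (1 / (2 * pi)) * \<phi> t * ennreal (2 / (1 + t\<^sup>2)\<^sup>2)"
      unfolding h_def by (subst nn_integral_cmult) (simp_all only: nn_integral_cubic_gaussian, measurable)
    also have "\<dots> = ennreal (1 / (2 * pi) * (2 / (1 + t\<^sup>2)\<^sup>2)) * \<phi> t"
      by (subst ennreal_mult') (simp_all only: mult_ac, simp)
    finally show "(\<integral>\<^sup>+x. ennreal (1 / (2 * pi)) * \<phi> t * h t x \<partial>lborel) = ennreal (1 / (pi * (1 + t\<^sup>2)\<^sup>2)) * \<phi> t"
      by simp
  qed
  finally show ?thesis .
qed

lemma has_real_derivative_ramp_cauchy:
  fixes \<beta> \<gamma> t :: real
  shows "((\<lambda>t. (\<beta> * (t / (1 + t\<^sup>2) + arctan t) - \<gamma> / (1 + t\<^sup>2)) / 2) has_real_derivative (\<beta> + \<gamma> * t) /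
    (1 + t\<^sup>2)\<^sup>2) (at t)"
proof -
  define D where "D = 1 + t\<^sup>2"
  have D: "D \<noteq> 0" "t * (2 * t) = 2 * (D - 1)"
    using sum_power2_gt_zero_iff[of 1 t] by (auto simp: D_def power2_eq_square)
  have "((\<lambda>t. (\<beta> * (t / (1 + t\<^sup>2) + arctan t) - \<gamma> / (1 + t\<^sup>2)) / 2) has_real_derivative
      (\<beta> * ((1 * D - t * (2 * t)) / (D * D) + inverse D) - (0 * D - \<gamma> * (2 * t)) / (D * D)) / 2) (at t)"
    using D(1) unfolding D_def by (auto intro!: derivative_eq_intros)
  moreover have "(\<beta> * ((1 * D - t * (2 * t)) / (D * D) + inverse D) - (0 * D - \<gamma> * (2 * t)) / (D * D)) / 2
    = (\<beta> + \<gamma> * t) / D\<^sup>2"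
    unfolding D(2) using D(1) by (simp add: field_simps power2_eq_square)
  ultimately show ?thesis by (simp only: D_def)
qed

lemma nn_integral_ramp_cauchy:
  fixes \<beta> \<gamma> :: real
  assumes "\<gamma> > 0"
  shows "(\<integral>\<^sup>+t. ennreal (relu (\<beta> + \<gamma> * t) / (1 + t\<^sup>2)\<^sup>2) \<partial>lborel)
    = ennreal ((\<gamma> + \<beta> * (pi / 2 + arctan (\<beta> / \<gamma>))) / 2)"
proof -
  let ?F = "\<lambda>t. (\<beta> * (t / (1 + t\<^sup>2) + arctan t) - \<gamma> / (1 + t\<^sup>2)) / 2"
  let ?a = "- \<beta> / \<gamma>"
  have support: "?a \<le> t \<longleftrightarrow> 0 \<le> \<beta> + \<gamma> * t" for t using assms by (auto simp: field_simps)
  hence "(\<integral>\<^sup>+t. ennreal (relu (\<beta> + \<gamma> * t) / (1 + t\<^sup>2)\<^sup>2) \<partial>lborel)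
    = (\<integral>\<^sup>+t. ennreal ((\<beta> + \<gamma> * t) / (1 + t\<^sup>2)\<^sup>2) * indicator {?a..} t \<partial>lborel)"
    by (intro nn_integral_cong) (auto simp: relu_def indicator_def max_def)
  also have "\<dots> = ennreal (\<beta> * (pi / 2) / 2 - ?F ?a)"
  proof (rule nn_integral_FTC_atLeast)
    have "((\<lambda>t::real. t / (1 + t\<^sup>2)) \<longlongrightarrow> 0) at_top" "((\<lambda>t::real. \<gamma> / (1 + t\<^sup>2)) \<longlongrightarrow> 0) at_top" by real_asymp+
    hence "(?F \<longlongrightarrow> (\<beta> * (0 + pi / 2) - 0) / 2) at_top"
      by (intro tendsto_intros tendsto_arctan_at_top) auto
    thus "(?F \<longlongrightarrow> \<beta> * (pi / 2) / 2) at_top" by simp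
  qed (use support in \<open>auto intro!: has_real_derivative_ramp_cauchy\<close>)
  also have "\<beta> * (pi / 2) / 2 - ?F ?a = (\<gamma> + \<beta> * (pi / 2 + arctan (\<beta> / \<gamma>))) / 2"
  proof -
    have "\<beta> * ?a - \<gamma> = - \<gamma> * (1 + ?a\<^sup>2)" using assms by (simp add: field_simps power2_eq_square)
    moreover have "1 + ?a\<^sup>2 \<noteq> 0" using sum_power2_gt_zero_iff[of 1 ?a] by simp
    ultimately have "\<beta> * (?a / (1 + ?a\<^sup>2)) - \<gamma> / (1 + ?a\<^sup>2) = - \<gamma>"
      by (metis diff_divide_distrib nonzero_mult_div_cancel_right times_divide_eq_right)
    hence "\<beta> * (?a / (1 + ?a\<^sup>2) + arctan ?a) - \<gamma> / (1 + ?a\<^sup>2) = \<beta> * arctan ?a - \<gamma>"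
      by (simp only: distrib_left)
    moreover have "arctan ?a = - arctan (\<beta> / \<gamma>)" using arctan_minus[of "\<beta> / \<gamma>"] by simp
    ultimately show ?thesis by (simp add: field_simps)
  qed
  finally show ?thesis .
qed

text \<open>For Gram data \<open>p = |x|\<^sup>2\<close>, \<open>q = |y|\<^sup>2\<close>, \<open>s = x \<bullet> y\<close> of two vectors at angle \<open>\<theta>\<close>, these are the area
  \<open>|x| |y| sin \<theta>\<close> of the parallelogram they span, the angle \<open>\<pi> - \<theta>\<close>, and \<open>|x| |y| (sin \<theta> + (\<pi> - \<theta>) cos \<theta>)\<close>.\<close>

definition area :: "real \<Rightarrow> real \<Rightarrow> real \<Rightarrow> real" where
  "area p q s = sqrt (p * q - s\<^sup>2)"

definition supp_angle :: "real \<Rightarrow> real \<Rightarrow> real \<Rightarrow> real" where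
  "supp_angle p q s = pi / 2 + arctan (s / area p q s)"

definition arc_kernel :: "real \<Rightarrow> real \<Rightarrow> real \<Rightarrow> real" where
  "arc_kernel p q s = area p q s + s * supp_angle p q s"

lemma area_commute: "area p q s = area q p s"
  by (simp add: area_def mult.commute)

lemma supp_angle_commute: "supp_angle p q s = supp_angle q p s"
  by (simp add: supp_angle_def area_commute)

lemma arc_kernel_nonneg:
  assumes "s\<^sup>2 < p * q"
  shows "0 \<le> arc_kernel p q s"
proof (cases "s \<ge> 0")
  case True
  thus ?thesis
    using assms arctan_lbound[of "s / area p q s"] by (simp add: arc_kernel_def supp_angle_def area_def)
next
  case False
  define r where "r = s / area p q s"
  have area: "area p q s > 0" using assms by (simp add: area_def)
  hence r: "r < 0" using False by (simp add: r_def divide_neg_pos)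
  have "arctan (1 / r) = - pi / 2 - arctan r" using Transcendental.arctan_inverse[of r] r by (simp add: sgn_neg)
  moreover have "arctan (- (1 / r)) \<le> - (1 / r)" using r by (intro arctan_le_self) (simp add: divide_nonneg_neg)
  ultimately have "supp_angle p q s \<le> area p q s / (- s)"
    by (simp add: supp_angle_def arctan_minus r_def)
  thus ?thesis using False by (simp add: arc_kernel_def field_simps)
qed

lemma arc_kernel_orthonormal: "arc_kernel 1 1 0 = 1"
  by (simp add: arc_kernel_def area_def)

lemma nn_integral_std_gauss_relu_relu:
  fixes \<alpha> \<beta> \<gamma> :: real
  assumes "\<alpha> > 0" "\<gamma> > 0"
  shows "(\<integral>\<^sup>+x. \<integral>\<^sup>+y. ennreal (relu (\<alpha> * x) * relu (\<beta> * x + \<gamma> * y)) \<partial>std_gauss \<partial>std_gauss)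
    = ennreal (arc_kernel (\<alpha>\<^sup>2) (\<beta>\<^sup>2 + \<gamma>\<^sup>2) (\<alpha> * \<beta>) / (2 * pi))" (is "?lhs = _")
proof -
  have cone: "ennreal (relu (\<alpha> * x) * relu (\<beta> * x + \<gamma> * y))
    = indicator {0<..} x * (ennreal (x\<^sup>2) * ennreal (\<alpha> * relu (\<beta> + \<gamma> * (y / x))))" for x y
  proof (cases "x > 0")
    case True
    hence "\<beta> * x + \<gamma> * y = x * (\<beta> + \<gamma> * (y / x))" by (simp add: distrib_left mult.commute)
    thus ?thesis using True assms(1)
      by (simp add: relu_mult_nonneg relu_nonneg relu_def[of x] ennreal_mult[symmetric] power2_eq_square mult_ac)
  next
    case False
    hence "relu (\<alpha> * x) = 0" using assms(1) by (simp add: relu_def mult_nonneg_nonpos)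
    thus ?thesis using False by simp
  qed
  have "?lhs = (\<integral>\<^sup>+t. ennreal (1 / (pi * (1 + t\<^sup>2)\<^sup>2)) * ennreal (\<alpha> * relu (\<beta> + \<gamma> * t)) \<partial>lborel)"
    unfolding cone by (rule nn_integral_half_plane_homogeneous) measurable
  also have "\<dots> = (\<integral>\<^sup>+t. ennreal (\<alpha> / pi) * ennreal (relu (\<beta> + \<gamma> * t) / (1 + t\<^sup>2)\<^sup>2) \<partial>lborel)"
    using assms by (intro nn_integral_cong) (simp add: ennreal_mult[symmetric] relu_nonneg)
  also have "\<dots> = ennreal (\<alpha> / pi) * ennreal ((\<gamma> + \<beta> * (pi / 2 + arctan (\<beta> / \<gamma>))) / 2)"
    by (subst nn_integral_cmult) (simp_all add: nn_integral_ramp_cauchy assms)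
  also have "\<dots> = ennreal (\<alpha> / pi * ((\<gamma> + \<beta> * (pi / 2 + arctan (\<beta> / \<gamma>))) / 2))"
    using assms(1) by (intro ennreal_mult'[symmetric]) simp
  also have "\<alpha> / pi * ((\<gamma> + \<beta> * (pi / 2 + arctan (\<beta> / \<gamma>))) / 2) = arc_kernel (\<alpha>\<^sup>2) (\<beta>\<^sup>2 + \<gamma>\<^sup>2) (\<alpha> * \<beta>) / (2 * pi)"
  proof -
    have "\<alpha>\<^sup>2 * (\<beta>\<^sup>2 + \<gamma>\<^sup>2) - (\<alpha> * \<beta>)\<^sup>2 = (\<alpha> * \<gamma>)\<^sup>2" by (simp add: power_mult_distrib algebra_simps)
    hence "area (\<alpha>\<^sup>2) (\<beta>\<^sup>2 + \<gamma>\<^sup>2) (\<alpha> * \<beta>) = \<alpha> * \<gamma>" using assms by (simp add: area_def)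
    thus ?thesis using assms by (simp add: arc_kernel_def supp_angle_def field_simps)
  qed
  finally show ?thesis .
qed

lemma nn_integral_std_gauss_relu_square: "(\<integral>\<^sup>+x. ennreal ((relu x)\<^sup>2) \<partial>std_gauss) = ennreal (1 / 2)"
proof -
  let ?I = "\<lambda>g :: real \<Rightarrow> real. \<integral>\<^sup>+x. ennreal (std_normal_density x * g x) \<partial>lborel"
  have density: "(\<integral>\<^sup>+x. ennreal (g x) \<partial>std_gauss) = ?I g" if [measurable]: "g \<in> borel_measurable borel"
    for g :: "real \<Rightarrow> real"
    by (subst nn_integral_density) (simp_all add: ennreal_mult')
  have "?I (\<lambda>x. (relu x)\<^sup>2) = ?I (\<lambda>x. (relu (- x))\<^sup>2)"
    using nn_integral_real_affine[of "\<lambda>x. ennreal (std_normal_density x * (relu x)\<^sup>2)" "- 1" 0]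
    by (simp add: std_normal_density_def)
  moreover have "?I (\<lambda>x. (relu x)\<^sup>2) + ?I (\<lambda>x. (relu (- x))\<^sup>2) = ?I (\<lambda>x. x\<^sup>2)"
    by (subst nn_integral_add[symmetric])
      (auto intro!: nn_integral_cong simp: ennreal_plus[symmetric] relu_def max_def simp del: ennreal_plus)
  moreover have "has_bochner_integral lborel (\<lambda>x. std_normal_density x * x\<^sup>2) 1"
    using std_normal_moment_even[of 1] by (simp add: fact_numeral)
  hence "?I (\<lambda>x. x\<^sup>2) = 1"
    using nn_integral_eq_integral[of lborel "\<lambda>x. std_normal_density x * x\<^sup>2"]
    by (simp add: has_bochner_integral_iff)
  ultimately have twice: "2 * ?I (\<lambda>x. (relu x)\<^sup>2) = 1" by (simp add: mult_2)
  have "?I (\<lambda>x. (relu x)\<^sup>2) = ennreal (1 / 2) * (2 * ?I (\<lambda>x. (relu x)\<^sup>2))"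
    using ennreal_mult'[of "1 / 2" 2] by (simp only: mult.assoc[symmetric]) simp
  thus ?thesis by (subst density) (simp_all only: twice, simp_all)
qed

definition relu_kernel :: "nat \<Rightarrow> (nat \<Rightarrow> real) \<Rightarrow> (nat \<Rightarrow> real) \<Rightarrow> real" where
  "relu_kernel k x y = arc_kernel (dot k x x) (dot k y y) (dot k x y)"

definition nonparallel :: "nat \<Rightarrow> (nat \<Rightarrow> real) \<Rightarrow> (nat \<Rightarrow> real) \<Rightarrow> bool" where
  "nonparallel k x y \<longleftrightarrow> (dot k x y)\<^sup>2 < dot k x x * dot k y y"

lemma dot_commute: "dot k x y = dot k y x"
  unfolding dot_def by (simp add: mult.commute)

lemma dot_nonneg: "0 \<le> dot k x x"
  by (simp add: dot_def sum_nonneg)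

lemma has_bochner_integral_relu_relu:
  assumes "nonparallel k x y"
  shows "has_bochner_integral (gauss k) (\<lambda>\<xi>. relu (dot k x \<xi>) * relu (dot k y \<xi>)) (relu_kernel k x y / (2 * pi))"
proof -
  obtain \<alpha> \<gamma> \<beta> where gram: "\<alpha> \<ge> 0" "\<gamma> \<ge> 0" "\<alpha>\<^sup>2 = dot k x x" "\<alpha> * \<beta> = dot k x y" "\<beta>\<^sup>2 + \<gamma>\<^sup>2 = dot k y y"
    and law: "\<And>f :: real \<times> real \<Rightarrow> ennreal. f \<in> borel_measurable (borel \<Otimes>\<^sub>M borel) \<Longrightarrow>
       (\<integral>\<^sup>+\<xi>. f (dot k x \<xi>, dot k y \<xi>) \<partial>gauss k) = (\<integral>\<^sup>+x. \<integral>\<^sup>+y. f (\<alpha> * x, \<beta> * x + \<gamma> * y) \<partial>std_gauss \<partial>std_gauss)"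
    by (rule gauss_dot_pair_law[of k x y]) blast
  have "\<alpha> \<noteq> 0 \<and> \<gamma> \<noteq> 0"
    using assms unfolding nonparallel_def gram(3-5)[symmetric] by (auto simp: power_mult_distrib)
  hence pos: "\<alpha> > 0" "\<gamma> > 0" using gram(1,2) by auto
  have "(\<integral>\<^sup>+\<xi>. ennreal (relu (dot k x \<xi>) * relu (dot k y \<xi>)) \<partial>gauss k) = ennreal (relu_kernel k x y / (2 * pi))"
    using law[of "\<lambda>(u, v). ennreal (relu u * relu v)"] nn_integral_std_gauss_relu_relu[OF pos, of \<beta>]
    by (simp add: relu_kernel_def gram(3-5))
  thus ?thesis
    using assms by (intro has_bochner_integral_nn_integral)
      (auto simp: relu_nonneg relu_kernel_def nonparallel_def arc_kernel_nonneg)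
qed

lemma has_bochner_integral_relu_square:
  "has_bochner_integral (gauss k) (\<lambda>\<xi>. relu (dot k x \<xi>) * relu (dot k x \<xi>)) (dot k x x / 2)"
proof -
  obtain \<alpha> \<gamma> \<beta> where gram: "\<alpha> \<ge> 0" "\<alpha>\<^sup>2 = dot k x x"
    and law: "\<And>f :: real \<times> real \<Rightarrow> ennreal. f \<in> borel_measurable (borel \<Otimes>\<^sub>M borel) \<Longrightarrow>
       (\<integral>\<^sup>+\<xi>. f (dot k x \<xi>, dot k x \<xi>) \<partial>gauss k) = (\<integral>\<^sup>+x. \<integral>\<^sup>+y. f (\<alpha> * x, \<beta> * x + \<gamma> * y) \<partial>std_gauss \<partial>std_gauss)"
    by (rule gauss_dot_pair_law[of k x x]) blast
  have "(\<integral>\<^sup>+\<xi>. ennreal (relu (dot k x \<xi>) * relu (dot k x \<xi>)) \<partial>gauss k)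
    = (\<integral>\<^sup>+x. ennreal (\<alpha>\<^sup>2) * ennreal ((relu x)\<^sup>2) \<partial>std_gauss)"
  proof -
    have "relu (\<alpha> * x) * relu (\<alpha> * x) = \<alpha>\<^sup>2 * (relu x)\<^sup>2" for x
      using gram(1) by (simp add: relu_mult_nonneg power2_eq_square)
    thus ?thesis
      using law[of "\<lambda>(u, v). ennreal (relu u * relu u)"] std_gauss.emeasure_space_1 by (simp add: ennreal_mult)
  qed
  also have "\<dots> = ennreal (\<alpha>\<^sup>2) * ennreal (1 / 2)"
    by (subst nn_integral_cmult) (simp_all only: nn_integral_std_gauss_relu_square, measurable)
  also have "\<dots> = ennreal (dot k x x / 2)"
    unfolding gram(2) by (simp only: ennreal_mult'[symmetric] dot_nonneg) simp
  finally show ?thesis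
    by (intro has_bochner_integral_nn_integral) (auto simp: relu_nonneg dot_nonneg)
qed

definition relu_correlation :: "nat \<Rightarrow> (nat \<Rightarrow> real) \<Rightarrow> (nat \<Rightarrow> real) \<Rightarrow> real" where
  "relu_correlation k x y = (\<integral>\<xi>. relu (dot k x \<xi>) * relu (dot k y \<xi>) \<partial>gauss k)"

lemma integrable_relu_relu: "integrable (gauss k) (\<lambda>\<xi>. relu (dot k x \<xi>) * relu (dot k y \<xi>))"
proof (rule Bochner_Integration.integrable_bound)
  show "integrable (gauss k) (\<lambda>\<xi>. relu (dot k x \<xi>) * relu (dot k x \<xi>) + relu (dot k y \<xi>) * relu (dot k y \<xi>))"
    by (intro Bochner_Integration.integrable_add integrable.intros[OF has_bochner_integral_relu_square])
  have "a * b \<le> a * a + b * b" if "a \<ge> 0" "b \<ge> 0" for a b :: real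
    using sum_squares_bound[of a b] mult_nonneg_nonneg[OF that] by (simp add: power2_eq_square)
  thus "AE \<xi> in gauss k. norm (relu (dot k x \<xi>) * relu (dot k y \<xi>))
      \<le> norm (relu (dot k x \<xi>) * relu (dot k x \<xi>) + relu (dot k y \<xi>) * relu (dot k y \<xi>))"
    by (simp add: relu_nonneg)
qed measurable

lemma relu_loss_eq_correlations:
  "relu_loss k n V W = ((\<Sum>i<n. \<Sum>j<n. relu_correlation k (W i) (W j))
     - 2 * (\<Sum>i<n. \<Sum>j<k. relu_correlation k (W i) (V j)) + (\<Sum>i<k. \<Sum>j<k. relu_correlation k (V i) (V j))) / 2"
proof -
  define R where "R x \<xi> = relu (dot k x \<xi>)" for x \<xi>
  have correlation: "has_bochner_integral (gauss k) (\<lambda>\<xi>. R x \<xi> * R y \<xi>) (relu_correlation k x y)" for x y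
    unfolding R_def relu_correlation_def by (rule has_bochner_integral_integrable) (rule integrable_relu_relu)
  have "1 / 2 * ((\<Sum>i<n. R (W i) \<xi>) - (\<Sum>i<k. R (V i) \<xi>))\<^sup>2
     = 1 / 2 * ((\<Sum>i<n. \<Sum>j<n. R (W i) \<xi> * R (W j) \<xi>) - 2 * (\<Sum>i<n. \<Sum>j<k. R (W i) \<xi> * R (V j) \<xi>)
       + (\<Sum>i<k. \<Sum>j<k. R (V i) \<xi> * R (V j) \<xi>))" for \<xi>
    unfolding sum_product[symmetric] by (simp add: power2_eq_square algebra_simps)
  moreover have "has_bochner_integral (gauss k)
     (\<lambda>\<xi>. 1 / 2 * ((\<Sum>i<n. \<Sum>j<n. R (W i) \<xi> * R (W j) \<xi>) - 2 * (\<Sum>i<n. \<Sum>j<k. R (W i) \<xi> * R (V j) \<xi>)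
       + (\<Sum>i<k. \<Sum>j<k. R (V i) \<xi> * R (V j) \<xi>)))
     (1 / 2 * ((\<Sum>i<n. \<Sum>j<n. relu_correlation k (W i) (W j)) - 2 * (\<Sum>i<n. \<Sum>j<k. relu_correlation k (W i) (V j))
       + (\<Sum>i<k. \<Sum>j<k. relu_correlation k (V i) (V j))))"
    by (intro has_bochner_integral_mult_right has_bochner_integral_add has_bochner_integral_diff
      has_bochner_integral_sum correlation)
  moreover have "relu (\<Sum>j<k. x j * \<xi> j) = R x \<xi>" for x \<xi> by (simp add: R_def dot_def)
  ultimately show ?thesis
    unfolding relu_loss_def by (simp only: has_bochner_integral_integral_eq)
qed

lemma relu_correlation_nonparallel: "nonparallel k x y \<Longrightarrow> relu_correlation k x y = relu_kernel k x y / (2 * pi)"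
  unfolding relu_correlation_def by (intro has_bochner_integral_integral_eq has_bochner_integral_relu_relu)

lemma relu_correlation_self: "relu_correlation k x x = dot k x x / 2"
  unfolding relu_correlation_def by (intro has_bochner_integral_integral_eq has_bochner_integral_relu_square)

section \<open>The loss in the target basis\<close>

lemma dot_orthonormal_rows: "orthonormal_rows k V \<Longrightarrow> i < k \<Longrightarrow> j < k \<Longrightarrow> dot k (V i) (V j) = (if i = j then 1 else 0)"
  by (simp add: orthonormal_rows_def dot_def)

lemma sum_diag_off_diag:
  fixes d c :: real
  shows "(\<Sum>i<k. \<Sum>j<k. if i = j then d else c) = real k * d + real k * (real k - 1) * c"
proof -
  have "(\<Sum>j<k. if i = j then d else c) = d + (real k - 1) * c" if "i < k" for i
  proof -
    have "(\<Sum>j<k. if i = j then d else c) = (\<Sum>j<k. c + (if i = j then d - c else 0))"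
      by (intro sum.cong) auto
    thus ?thesis using that by (simp add: sum.distrib algebra_simps)
  qed
  hence "(\<Sum>i<k. \<Sum>j<k. if i = j then d else c) = (\<Sum>i<k. d + (real k - 1) * c)" by (intro sum.cong) auto
  thus ?thesis by (simp add: algebra_simps)
qed

lemma sum_symmetric_pairs:
  fixes f :: "nat \<Rightarrow> nat \<Rightarrow> real"
  assumes "\<And>i j. i < n \<Longrightarrow> j < n \<Longrightarrow> f i j = f j i"
  shows "(\<Sum>i<n. \<Sum>j<n. f i j) = (\<Sum>i<n. f i i) + 2 * (\<Sum>i<n. \<Sum>j<i. f i j)"
  using assms
proof (induction n)
  case (Suc n)
  have "(\<Sum>i<Suc n. \<Sum>j<Suc n. f i j) = (\<Sum>i<n. \<Sum>j<n. f i j) + (\<Sum>i<n. f i n) + (\<Sum>j<n. f n j) + f n n"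
    by (simp add: sum.distrib)
  moreover have "(\<Sum>i<n. f i n) = (\<Sum>j<n. f n j)" using Suc.prems by (intro sum.cong) auto
  moreover have "(\<Sum>i<n. \<Sum>j<n. f i j) = (\<Sum>i<n. f i i) + 2 * (\<Sum>i<n. \<Sum>j<i. f i j)"
    using Suc.prems by (intro Suc.IH) auto
  ultimately show ?case by simp
qed simp

lemma sum_correlations_orthonormal:
  assumes "orthonormal_rows k V"
  shows "(\<Sum>i<k. \<Sum>j<k. relu_correlation k (V i) (V j)) = (real k * pi + real k * (real k - 1)) / (2 * pi)"
proof -
  have "relu_correlation k (V i) (V j) = (if i = j then 1 / 2 else 1 / (2 * pi))" if "i < k" "j < k" for i j
    using dot_orthonormal_rows[OF assms] that
    by (auto simp: relu_correlation_self relu_correlation_nonparallel nonparallel_def relu_kernel_def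
      arc_kernel_orthonormal)
  thus ?thesis by (simp add: sum_diag_off_diag add_divide_distrib)
qed

lemma sum_correlations_nonparallel:
  fixes W :: "nat \<Rightarrow> nat \<Rightarrow> real"
  assumes "\<And>i j. i < n \<Longrightarrow> j < i \<Longrightarrow> nonparallel k (W i) (W j)"
  shows "(\<Sum>i<n. \<Sum>j<n. relu_correlation k (W i) (W j))
    = (\<Sum>i<n. dot k (W i) (W i)) / 2 + (\<Sum>i<n. \<Sum>j<i. relu_kernel k (W i) (W j)) / pi"
proof -
  have "(\<Sum>i<n. \<Sum>j<n. relu_correlation k (W i) (W j))
    = (\<Sum>i<n. dot k (W i) (W i) / 2) + 2 * (\<Sum>i<n. \<Sum>j<i. relu_correlation k (W i) (W j))"
    using sum_symmetric_pairs[of n "\<lambda>i j. relu_correlation k (W i) (W j)"]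
    by (simp add: relu_correlation_self) (simp add: relu_correlation_def mult.commute)
  also have "(\<Sum>i<n. \<Sum>j<i. relu_correlation k (W i) (W j)) = (\<Sum>i<n. \<Sum>j<i. relu_kernel k (W i) (W j) / (2 * pi))"
    using assms by (intro sum.cong refl) (auto simp: relu_correlation_nonparallel)
  finally show ?thesis by (simp add: sum_divide_distrib[symmetric])
qed

lemma orthonormal_rows_transpose:
  assumes "orthonormal_rows k V" "i < k" "j < k"
  shows "(\<Sum>l<k. V l i * V l j) = (if i = j then 1 else 0)"
proof -
  define A where "A = mat k k (\<lambda>(i, j). V i j)"
  have carrier: "A \<in> carrier_mat k k" by (simp add: A_def)
  have "A * transpose_mat A = 1\<^sub>m k"
    using assms(1) by (intro eq_matI) (auto simp: A_def scalar_prod_def orthonormal_rows_def atLeast0LessThan)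
  hence "transpose_mat A * A = 1\<^sub>m k"
    using carrier by (intro mat_mult_left_right_inverse[OF carrier]) auto
  hence "(transpose_mat A * A) $$ (i, j) = 1\<^sub>m k $$ (i, j)" by simp
  thus ?thesis using assms(2,3) by (simp add: A_def scalar_prod_def atLeast0LessThan)
qed

definition coords :: "nat \<Rightarrow> (nat \<Rightarrow> nat \<Rightarrow> real) \<Rightarrow> (nat \<Rightarrow> real) \<Rightarrow> nat \<Rightarrow> real" where
  "coords k V x = (\<lambda>l. dot k x (V l))"

lemma parseval:
  assumes "orthonormal_rows k V"
  shows "dot k (coords k V x) (coords k V y) = dot k x y"
proof -
  have "dot k (coords k V x) (coords k V y) = (\<Sum>l<k. \<Sum>i<k. \<Sum>j<k. x i * y j * (V l i * V l j))"
    unfolding coords_def dot_def sum_product by (intro sum.cong refl) (simp add: algebra_simps)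
  also have "\<dots> = (\<Sum>i<k. \<Sum>j<k. \<Sum>l<k. x i * y j * (V l i * V l j))"
    by (subst sum.swap) (intro sum.cong refl sum.swap)
  also have "\<dots> = (\<Sum>i<k. \<Sum>j<k. x i * y j * (if i = j then 1 else 0))"
    using orthonormal_rows_transpose[OF assms] by (simp add: sum_distrib_left[symmetric])
  also have "\<dots> = dot k x y" by (simp add: dot_def if_distrib cong: if_cong)
  finally show ?thesis .
qed

definition axis_vec :: "nat \<Rightarrow> nat \<Rightarrow> real" where
  "axis_vec j = (\<lambda>l. if l = j then 1 else 0)"

lemma dot_axis_right: "j < k \<Longrightarrow> dot k x (axis_vec j) = x j"
  by (simp add: dot_def axis_vec_def if_distrib cong: if_cong)

lemma dot_axis_left: "j < k \<Longrightarrow> dot k (axis_vec j) x = x j"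
  by (simp add: dot_commute[of k _ x] dot_axis_right)

definition gram_loss :: "nat \<Rightarrow> nat \<Rightarrow> (nat \<Rightarrow> nat \<Rightarrow> real) \<Rightarrow> real" where
  "gram_loss k n C = (\<Sum>i<n. \<Sum>j<i. relu_kernel k (C i) (C j)) + pi / 2 * (\<Sum>i<n. dot k (C i) (C i))
     - (\<Sum>i<n. \<Sum>j<k. relu_kernel k (C i) (axis_vec j)) + (real k * pi + real k * (real k - 1)) / 2"

definition pairwise_nonparallel :: "nat \<Rightarrow> nat \<Rightarrow> (nat \<Rightarrow> nat \<Rightarrow> real) \<Rightarrow> bool" where
  "pairwise_nonparallel k n C \<longleftrightarrow> (\<forall>i<n. \<forall>j<i. nonparallel k (C i) (C j))
    \<and> (\<forall>i<n. \<forall>j<k. nonparallel k (C i) (axis_vec j))"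

lemma relu_loss_eq_gram_loss:
  assumes V: "orthonormal_rows k V" and C: "pairwise_nonparallel k n (\<lambda>i. coords k V (W i))"
  shows "relu_loss k n V W = gram_loss k n (\<lambda>i. coords k V (W i)) / (2 * pi)"
proof -
  let ?C = "\<lambda>i. coords k V (W i)"
  note dot_coords = parseval[OF V]
  have target: "dot k (coords k V x) (axis_vec j) = dot k x (V j)" "dot k (axis_vec j) (axis_vec j) = dot k (V j) (V j)"
    if "j < k" for j x
    using that dot_orthonormal_rows[OF V] by (simp_all add: dot_axis_right) (simp_all add: coords_def axis_vec_def)
  have "(\<Sum>i<n. \<Sum>j<k. relu_correlation k (W i) (V j)) = (\<Sum>i<n. \<Sum>j<k. relu_kernel k (?C i) (axis_vec j) / (2 * pi))"
    using C by (intro sum.cong refl) (simp add: pairwise_nonparallel_def relu_correlation_nonparallel relu_kernel_def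
      nonparallel_def dot_coords target)
  moreover have "(\<Sum>i<n. \<Sum>j<n. relu_correlation k (W i) (W j))
    = (\<Sum>i<n. dot k (?C i) (?C i)) / 2 + (\<Sum>i<n. \<Sum>j<i. relu_kernel k (?C i) (?C j)) / pi"
    using C by (subst sum_correlations_nonparallel)
      (simp_all add: pairwise_nonparallel_def nonparallel_def relu_kernel_def dot_coords)
  ultimately show ?thesis
    unfolding relu_loss_eq_correlations sum_correlations_orthonormal[OF V] gram_loss_def
    by (simp add: sum_divide_distrib[symmetric] field_simps)
qed

section \<open>Second-order expansion of the kernel\<close>

lemma dot_add_left: "dot k (\<lambda>j. x j + y j) z = dot k x z + dot k y z"
  by (simp add: dot_def distrib_right sum.distrib)

lemma dot_scale_left: "dot k (\<lambda>j. c * x j) z = c * dot k x z"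
  by (simp add: dot_def sum_distrib_left mult.assoc)

lemma dot_diff_left: "dot k (\<lambda>j. x j - y j) z = dot k x z - dot k y z"
  by (simp add: dot_def left_diff_distrib sum_subtractf)

lemma dot_add_right: "dot k z (\<lambda>j. x j + y j) = dot k z x + dot k z y"
  and dot_scale_right: "dot k z (\<lambda>j. c * x j) = c * dot k z x"
  and dot_diff_right: "dot k z (\<lambda>j. x j - y j) = dot k z x - dot k z y"
  by (simp_all add: dot_commute[of k z] dot_add_left dot_scale_left dot_diff_left)

lemmas dot_linear = dot_add_left dot_scale_left dot_diff_left dot_add_right dot_scale_right dot_diff_right

lemma dot_zero_right: "dot k x (\<lambda>_. 0) = 0"
  by (simp add: dot_def)

lemma dot_sum_left: "dot k (\<lambda>l. \<Sum>i\<in>I. f i l) y = (\<Sum>i\<in>I. dot k (f i) y)"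
  unfolding dot_def sum_distrib_right by (rule sum.swap)

lemma dot_Cauchy_Schwarz: "(dot k x y)\<^sup>2 \<le> dot k x x * dot k y y"
  using Cauchy_Schwarz_ineq_sum[of x y "{..<k}"] by (simp add: dot_def power2_eq_square)

lemma abs_dot_le:
  assumes "dot k x x \<le> a\<^sup>2" "dot k y y \<le> b\<^sup>2" "0 \<le> a" "0 \<le> b"
  shows "\<bar>dot k x y\<bar> \<le> a * b"
proof -
  have "(dot k x y)\<^sup>2 \<le> (a * b)\<^sup>2"
    using dot_Cauchy_Schwarz[of k x y] mult_mono[OF assms(1,2)] dot_nonneg[of k y] by (simp add: power_mult_distrib)
  thus ?thesis using assms(3,4) by (intro power2_le_iff_abs_le[THEN iffD1]) auto
qed

definition relu_kernel_gradient :: "nat \<Rightarrow> (nat \<Rightarrow> real) \<Rightarrow> (nat \<Rightarrow> real) \<Rightarrow> (nat \<Rightarrow> real) \<Rightarrow> (nat \<Rightarrow> real) \<Rightarrow> real" where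
  "relu_kernel_gradient k x y d e =
     area (dot k x x) (dot k y y) (dot k x y) * (dot k x d / dot k x x + dot k y e / dot k y y)
     + supp_angle (dot k x x) (dot k y y) (dot k x y) * (dot k x e + dot k y d)"

definition relu_kernel_hessian :: "nat \<Rightarrow> (nat \<Rightarrow> real) \<Rightarrow> (nat \<Rightarrow> real) \<Rightarrow> (nat \<Rightarrow> real) \<Rightarrow> (nat \<Rightarrow> real) \<Rightarrow> real" where
  "relu_kernel_hessian k x y d e =
     area (dot k x x) (dot k y y) (dot k x y)
       * (dot k d d / dot k x x + dot k e e / dot k y y - (dot k x d / dot k x x - dot k y e / dot k y y)\<^sup>2)
     + (dot k x e + dot k y d - dot k x y * (dot k x d / dot k x x + dot k y e / dot k y y))\<^sup>2
         / area (dot k x x) (dot k y y) (dot k x y)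
     + 2 * supp_angle (dot k x x) (dot k y y) (dot k x y) * dot k d e"

definition relu_kernel_remainder :: "nat \<Rightarrow> (nat \<Rightarrow> real) \<Rightarrow> (nat \<Rightarrow> real) \<Rightarrow> (nat \<Rightarrow> real) \<Rightarrow> (nat \<Rightarrow> real) \<Rightarrow> real" where
  "relu_kernel_remainder k x y d e = relu_kernel k (\<lambda>j. x j + d j) (\<lambda>j. y j + e j) - relu_kernel k x y
     - relu_kernel_gradient k x y d e - relu_kernel_hessian k x y d e / 2"

lemma abs_mult_le: "\<bar>x\<bar> \<le> a \<Longrightarrow> \<bar>y\<bar> \<le> b \<Longrightarrow> \<bar>x * y\<bar> \<le> a * b" for x y a b :: real
  unfolding abs_mult by (intro mult_mono) auto

text \<open>Along two straight paths, the complex number \<open>\<Delta> + \<i> s\<close> satisfies \<open>(\<Delta> + \<i> s)' = (\<sigma> + \<i> \<tau>) (\<Delta> + \<i> s)\<close>,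
  where \<open>\<sigma>\<close> and \<open>\<tau>\<close> are the rates of scaling and of turning, and \<open>\<tau> = T'\<close>. This keeps the derivatives of
  \<open>\<Delta> + s T\<close> short and bounds them without a lower bound on the area \<open>\<Delta>\<close>.\<close>

locale linear_paths =
  fixes k :: nat and x y d e :: "nat \<Rightarrow> real"
begin

definition "X t = (\<lambda>j. x j + t * d j)"
definition "Y t = (\<lambda>j. y j + t * e j)"
definition "p t = dot k (X t) (X t)"
definition "q t = dot k (Y t) (Y t)"
definition "s t = dot k (X t) (Y t)"
definition "s' t = dot k (X t) e + dot k (Y t) d"
definition "\<Delta> t = area (p t) (q t) (s t)"
definition "T t = supp_angle (p t) (q t) (s t)"
definition "l t = dot k (X t) d / p t"
definition "m t = dot k (Y t) e / q t"
definition "\<sigma> t = l t + m t"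
definition "\<tau> t = (s' t - s t * \<sigma> t) / \<Delta> t"
definition "l' t = dot k d d / p t - 2 * (l t)\<^sup>2"
definition "m' t = dot k e e / q t - 2 * (m t)\<^sup>2"
definition "E t = dot k d d / p t + dot k e e / q t - (l t - m t)\<^sup>2 + (\<tau> t)\<^sup>2"
definition "\<tau>' t = (2 * dot k d e - s t * (E t - 2 * (\<tau> t)\<^sup>2)) / \<Delta> t - 2 * \<sigma> t * \<tau> t"
definition "E' t = - 2 * (dot k d d / p t * l t + dot k e e / q t * m t + (l t - m t) * (l' t - m' t))
  + 2 * (\<tau> t * \<tau>' t)"
definition "third_derivative t = \<Delta> t * (\<sigma> t * E t - 4 * \<sigma> t * (\<tau> t)\<^sup>2
    - 2 * (dot k d d / p t * l t + dot k e e / q t * m t + (l t - m t) * (l' t - m' t)))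
  - s t * (\<tau> t * (3 * E t - 4 * (\<tau> t)\<^sup>2)) + 6 * (dot k d e * \<tau> t)"

lemma gram_along:
  "p t = dot k x x + 2 * t * dot k x d + t\<^sup>2 * dot k d d"
  "q t = dot k y y + 2 * t * dot k y e + t\<^sup>2 * dot k e e"
  "s t = dot k x y + t * (dot k x e + dot k y d) + t\<^sup>2 * dot k d e"
  "dot k (X t) d = dot k x d + t * dot k d d"
  "dot k (Y t) e = dot k y e + t * dot k e e"
  "s' t = dot k x e + dot k y d + 2 * t * dot k d e"
  by (simp_all add: p_def q_def s_def s'_def X_def Y_def dot_linear power2_eq_square algebra_simps
    dot_commute[of k d x] dot_commute[of k d y] dot_commute[of k e y] dot_commute[of k e d])

lemma relu_kernel_along: "relu_kernel k (X t) (Y t) = \<Delta> t + s t * T t"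
  by (simp add: relu_kernel_def arc_kernel_def \<Delta>_def T_def p_def q_def s_def)

lemma relu_kernel_gradient_along: "relu_kernel_gradient k (X t) (Y t) d e = \<Delta> t * \<sigma> t + T t * s' t"
  by (simp add: relu_kernel_gradient_def \<Delta>_def T_def p_def q_def s_def s'_def \<sigma>_def l_def m_def)

lemma relu_kernel_hessian_along: "relu_kernel_hessian k (X t) (Y t) d e = \<Delta> t * E t + 2 * (T t * dot k d e)"
proof -
  have "z\<^sup>2 / D = D * (z / D)\<^sup>2" for z D :: real by (simp add: power2_eq_square)
  thus ?thesis
    unfolding relu_kernel_hessian_def p_def[symmetric] q_def[symmetric] s_def[symmetric] s'_def[symmetric]
      l_def[symmetric] m_def[symmetric] \<sigma>_def[symmetric] \<Delta>_def[symmetric] T_def[symmetric] E_def \<tau>_def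
    by (simp add: distrib_left)
qed

context
  fixes t
  assumes nonparallel: "nonparallel k (X t) (Y t)"
begin

lemma squared_norms_pos: "0 < p t" "0 < q t"
proof -
  have "0 < p t * q t" using nonparallel zero_le_power2[of "s t"] unfolding nonparallel_def p_def q_def s_def
    by linarith
  thus "0 < p t" "0 < q t"
    using dot_nonneg[of k "X t"] dot_nonneg[of k "Y t"] by (auto simp: p_def q_def zero_less_mult_iff)
qed

lemma area_pos: "0 < \<Delta> t"
  using nonparallel by (simp add: \<Delta>_def area_def nonparallel_def p_def q_def s_def)

lemma area_square: "(\<Delta> t)\<^sup>2 = p t * q t - (s t)\<^sup>2"
  using nonparallel by (simp add: \<Delta>_def area_def nonparallel_def p_def q_def s_def)

lemma inner_rate: "s' t = s t * \<sigma> t + \<Delta> t * \<tau> t"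
  using area_pos by (simp add: \<tau>_def)

lemma gram_derivatives:
  "(p has_real_derivative 2 * (l t * p t)) (at t)"
  "(q has_real_derivative 2 * (m t * q t)) (at t)"
  "(s has_real_derivative s' t) (at t)"
  "(s' has_real_derivative 2 * dot k d e) (at t)"
proof -
  have "(p has_real_derivative 2 * dot k (X t) d) (at t)" "(q has_real_derivative 2 * dot k (Y t) e) (at t)"
    "(s has_real_derivative s' t) (at t)" "(s' has_real_derivative 2 * dot k d e) (at t)"
    unfolding gram_along(4-6) gram_along(1-3,6)[abs_def] by (auto intro!: derivative_eq_intros simp: algebra_simps)
  thus "(p has_real_derivative 2 * (l t * p t)) (at t)" "(q has_real_derivative 2 * (m t * q t)) (at t)"
    "(s has_real_derivative s' t) (at t)" "(s' has_real_derivative 2 * dot k d e) (at t)"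
    using squared_norms_pos by (simp_all add: l_def m_def)
qed

lemma norm_rate_derivatives: "(l has_real_derivative l' t) (at t)" "(m has_real_derivative m' t) (at t)"
proof -
  have rate: "((\<lambda>t. a t / c t) has_real_derivative b / c t - 2 * (a t / c t)\<^sup>2) (at t)"
    if a: "(a has_real_derivative b) (at t)" and c: "(c has_real_derivative 2 * (a t / c t * c t)) (at t)" and "0 < c t"
    for a c :: "real \<Rightarrow> real" and b
  proof -
    have "((\<lambda>t. a t / c t) has_real_derivative (b * c t - a t * (2 * (a t / c t * c t))) / (c t * c t)) (at t)"
      using \<open>0 < c t\<close> by (intro DERIV_divide a c) simp
    moreover have "(b * c t - a t * (2 * (a t / c t * c t))) / (c t * c t) = b / c t - 2 * (a t / c t)\<^sup>2"
      using \<open>0 < c t\<close> by (simp add: field_simps power2_eq_square)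
    ultimately show ?thesis by simp
  qed
  have num: "((\<lambda>t. dot k (X t) d) has_real_derivative dot k d d) (at t)"
    "((\<lambda>t. dot k (Y t) e) has_real_derivative dot k e e) (at t)"
    unfolding gram_along(4,5) by (auto intro!: derivative_eq_intros)
  show "(l has_real_derivative l' t) (at t)" "(m has_real_derivative m' t) (at t)"
    using rate[OF num(1), of p] rate[OF num(2), of q] gram_derivatives(1,2) squared_norms_pos
    by (simp_all add: l_def[abs_def] m_def[abs_def] l'_def m'_def)
qed

lemma scale_rate_derivative: "(\<sigma> has_real_derivative l' t + m' t) (at t)"
  unfolding \<sigma>_def[abs_def] by (intro DERIV_add norm_rate_derivatives)

lemma scale_rate_derivative_eq: "l' t + m' t = E t - (\<tau> t)\<^sup>2 - (\<sigma> t)\<^sup>2"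
  by (simp add: l'_def m'_def E_def \<sigma>_def power2_eq_square algebra_simps)

lemma area_derivative: "(\<Delta> has_real_derivative \<Delta> t * \<sigma> t - s t * \<tau> t) (at t)"
proof -
  let ?N = "2 * (l t * p t) * q t + 2 * (m t * q t) * p t - 2 * (s' t * s t)"
  have "((\<lambda>t. p t * q t - (s t)\<^sup>2) has_real_derivative ?N) (at t)"
    by (auto intro!: derivative_eq_intros gram_derivatives simp: algebra_simps)
  moreover have "(sqrt has_real_derivative inverse (\<Delta> t) / 2) (at (p t * q t - (s t)\<^sup>2))"
    unfolding \<Delta>_def area_def
    by (rule DERIV_real_sqrt) (use nonparallel in \<open>simp add: nonparallel_def p_def q_def s_def\<close>)
  ultimately have "(\<Delta> has_real_derivative inverse (\<Delta> t) / 2 * ?N) (at t)"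
    unfolding \<Delta>_def[abs_def] area_def by (rule DERIV_chain2[rotated])
  moreover have "?N = 2 * \<Delta> t * (\<Delta> t * \<sigma> t - s t * \<tau> t)"
  proof -
    have "?N = 2 * (p t * q t * \<sigma> t - s t * s' t)" by (simp add: \<sigma>_def algebra_simps)
    also have "\<dots> = 2 * (((\<Delta> t)\<^sup>2 + (s t)\<^sup>2) * \<sigma> t - s t * (s t * \<sigma> t + \<Delta> t * \<tau> t))"
      by (simp add: area_square inner_rate)
    finally show ?thesis by (simp add: power2_eq_square algebra_simps)
  qed
  ultimately show ?thesis using area_pos by (simp add: mult.assoc[symmetric])
qed

lemma supp_angle_derivative: "(T has_real_derivative \<tau> t) (at t)"
proof -
  have "((\<lambda>t. s t / \<Delta> t) has_real_derivative (s' t * \<Delta> t - s t * (\<Delta> t * \<sigma> t - s t * \<tau> t)) / (\<Delta> t * \<Delta> t)) (at t)"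
    using area_pos by (intro DERIV_divide gram_derivatives area_derivative) simp
  also have "s' t * \<Delta> t - s t * (\<Delta> t * \<sigma> t - s t * \<tau> t) = ((\<Delta> t)\<^sup>2 + (s t)\<^sup>2) * \<tau> t"
    by (simp add: inner_rate power2_eq_square algebra_simps)
  finally have "(T has_real_derivative 0 + inverse (1 + (s t / \<Delta> t)\<^sup>2) * (((\<Delta> t)\<^sup>2 + (s t)\<^sup>2) * \<tau> t / (\<Delta> t * \<Delta> t))) (at
    t)"
    unfolding T_def[abs_def] supp_angle_def \<Delta>_def[symmetric]
    by (intro DERIV_add DERIV_const DERIV_chain2[OF DERIV_arctan])
  moreover have "1 + (s t / \<Delta> t)\<^sup>2 = ((\<Delta> t)\<^sup>2 + (s t)\<^sup>2) / (\<Delta> t * \<Delta> t)"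
    using area_pos by (simp add: field_simps power2_eq_square)
  moreover have "(\<Delta> t)\<^sup>2 + (s t)\<^sup>2 > 0" using area_pos by (simp add: add_pos_nonneg)
  ultimately show ?thesis using area_pos by simp
qed

lemma turn_rate_derivative: "(\<tau> has_real_derivative \<tau>' t) (at t)"
proof -
  let ?N = "(2 * dot k d e - (s' t * \<sigma> t + (l' t + m' t) * s t)) * \<Delta> t - (s' t - s t * \<sigma> t) * (\<Delta> t * \<sigma> t - s t * \<tau> t)"
  have "(\<tau> has_real_derivative ?N / (\<Delta> t * \<Delta> t)) (at t)"
    unfolding \<tau>_def[abs_def] using area_pos
    by (intro DERIV_divide DERIV_diff DERIV_mult gram_derivatives scale_rate_derivative
      area_derivative[unfolded \<tau>_def]) auto
  moreover have "?N = \<Delta> t * (2 * dot k d e - s t * (E t - 2 * (\<tau> t)\<^sup>2) - 2 * \<sigma> t * \<tau> t * \<Delta> t)"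
    unfolding inner_rate scale_rate_derivative_eq by (simp add: power2_eq_square algebra_simps)
  ultimately show ?thesis using area_pos by (simp add: \<tau>'_def diff_divide_distrib)
qed

lemma curvature_derivative: "(E has_real_derivative E' t) (at t)"
proof -
  have ratio: "((\<lambda>t. c / f t) has_real_derivative - 2 * (c / f t * r)) (at t)"
    if "(f has_real_derivative 2 * (r * f t)) (at t)" "0 < f t" for f and c r :: real
    using DERIV_divide[OF DERIV_const that(1), of c] that(2) by (simp add: mult_ac)
  have square: "((\<lambda>t. (f t)\<^sup>2) has_real_derivative 2 * (f t * f')) (at t)"
    if "(f has_real_derivative f') (at t)" for f and f' :: real
    using DERIV_mult[OF that that] by (simp add: power2_eq_square mult.commute)
  have "(E has_real_derivative - 2 * (dot k d d / p t * l t) + - 2 * (dot k e e / q t * m t)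
      - 2 * ((l t - m t) * (l' t - m' t)) + 2 * (\<tau> t * \<tau>' t)) (at t)"
    unfolding E_def[abs_def]
    by (rule DERIV_add[OF DERIV_diff[OF DERIV_add[OF ratio[OF gram_derivatives(1)] ratio[OF gram_derivatives(2)]]
      square[OF DERIV_diff[OF norm_rate_derivatives]]] square[OF turn_rate_derivative]])
      (use squared_norms_pos in auto)
  thus ?thesis by (simp add: E'_def)
qed

lemma relu_kernel_derivative:
  "((\<lambda>t. relu_kernel k (X t) (Y t)) has_real_derivative relu_kernel_gradient k (X t) (Y t) d e) (at t)"
proof -
  have "((\<lambda>t. \<Delta> t + s t * T t) has_real_derivative \<Delta> t * \<sigma> t - s t * \<tau> t + (s' t * T t + \<tau> t * s t)) (at t)"
    by (intro DERIV_add DERIV_mult area_derivative gram_derivatives supp_angle_derivative)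
  moreover have "\<Delta> t * \<sigma> t - s t * \<tau> t + (s' t * T t + \<tau> t * s t) = \<Delta> t * \<sigma> t + T t * s' t"
    by (simp add: algebra_simps)
  ultimately show ?thesis unfolding relu_kernel_along relu_kernel_gradient_along by (simp only:)
qed

lemma relu_kernel_gradient_derivative:
  "((\<lambda>t. relu_kernel_gradient k (X t) (Y t) d e) has_real_derivative relu_kernel_hessian k (X t) (Y t) d e) (at t)"
proof -
  have "((\<lambda>t. \<Delta> t * \<sigma> t + T t * s' t) has_real_derivative
      (\<Delta> t * \<sigma> t - s t * \<tau> t) * \<sigma> t + (l' t + m' t) * \<Delta> t + (\<tau> t * s' t + 2 * dot k d e * T t)) (at t)"
    by (intro DERIV_add DERIV_mult area_derivative scale_rate_derivative gram_derivatives supp_angle_derivative)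
  moreover have "(\<Delta> t * \<sigma> t - s t * \<tau> t) * \<sigma> t + (l' t + m' t) * \<Delta> t + (\<tau> t * s' t + 2 * dot k d e * T t)
      = \<Delta> t * E t + 2 * (T t * dot k d e)"
    unfolding inner_rate scale_rate_derivative_eq by (simp add: power2_eq_square algebra_simps)
  ultimately show ?thesis unfolding relu_kernel_gradient_along relu_kernel_hessian_along by simp
qed

lemma relu_kernel_hessian_derivative:
  "((\<lambda>t. relu_kernel_hessian k (X t) (Y t) d e) has_real_derivative third_derivative t) (at t)"
proof -
  have "((\<lambda>t. \<Delta> t * E t + 2 * (T t * dot k d e)) has_real_derivative
      (\<Delta> t * \<sigma> t - s t * \<tau> t) * E t + E' t * \<Delta> t + 2 * (\<tau> t * dot k d e)) (at t)"
    by (rule DERIV_add[OF DERIV_mult[OF area_derivative curvature_derivative]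
      DERIV_cmult[OF DERIV_cmult_right[OF supp_angle_derivative]]])
  moreover have "(\<Delta> t * \<sigma> t - s t * \<tau> t) * E t + E' t * \<Delta> t + 2 * (\<tau> t * dot k d e) = third_derivative t"
  proof -
    have "E' t * \<Delta> t = 2 * \<tau> t * (\<Delta> t * \<tau>' t)
        - 2 * \<Delta> t * (dot k d d / p t * l t + dot k e e / q t * m t + (l t - m t) * (l' t - m' t))"
      by (simp add: E'_def algebra_simps)
    also have "\<Delta> t * \<tau>' t = 2 * dot k d e - s t * (E t - 2 * (\<tau> t)\<^sup>2) - 2 * \<Delta> t * \<sigma> t * \<tau> t"
      using area_pos by (simp add: \<tau>'_def right_diff_distrib[of _ "_ / _"])
    finally have "(\<Delta> t * \<sigma> t - s t * \<tau> t) * E t + E' t * \<Delta> t + 2 * (\<tau> t * dot k d e)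
      = (\<Delta> t * \<sigma> t - s t * \<tau> t) * E t
        + (2 * \<tau> t * (2 * dot k d e - s t * (E t - 2 * (\<tau> t)\<^sup>2) - 2 * \<Delta> t * \<sigma> t * \<tau> t)
          - 2 * \<Delta> t * (dot k d d / p t * l t + dot k e e / q t * m t + (l t - m t) * (l' t - m' t)))
        + 2 * (\<tau> t * dot k d e)" by (simp only:)
    also have "\<dots> = third_derivative t"
    proof -
      have "(a * b - c * u) * z + (2 * u * (2 * v - c * (z - 2 * u\<^sup>2) - 2 * a * b * u) - 2 * a * g) + 2 * (u * v)
        = a * (b * z - 4 * b * u\<^sup>2 - 2 * g) - c * (u * (3 * z - 4 * u\<^sup>2)) + 6 * (v * u)" for a b c u v z g :: real
        by (simp add: power2_eq_square algebra_simps)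
      thus ?thesis unfolding third_derivative_def .
    qed
    finally show ?thesis .
  qed
  ultimately show ?thesis unfolding relu_kernel_hessian_along by (simp only:)
qed

lemma norm_rate_square_le: "(l t)\<^sup>2 \<le> dot k d d / p t" "(m t)\<^sup>2 \<le> dot k e e / q t"
proof -
  have "(dot k z c / dot k z z)\<^sup>2 \<le> dot k c c / dot k z z" if "0 < dot k z z" for z c
  proof -
    have "(dot k z c / dot k z z)\<^sup>2 \<le> dot k z z * dot k c c / (dot k z z)\<^sup>2"
      using dot_Cauchy_Schwarz[of k z c] by (simp add: power_divide divide_right_mono)
    thus ?thesis using that by (simp add: power2_eq_square)
  qed
  thus "(l t)\<^sup>2 \<le> dot k d d / p t" "(m t)\<^sup>2 \<le> dot k e e / q t"
    using squared_norms_pos by (simp_all add: l_def m_def p_def q_def)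
qed

text \<open>\<open>\<Delta> \<tau>\<close> is a sum of inner products with the components of \<open>X\<close> and \<open>Y\<close> orthogonal to each other, whose
  lengths contain the factor \<open>\<Delta>\<close>.\<close>

lemma turn_rate_bound:
  assumes "dot k d d \<le> p t * u\<^sup>2" "dot k e e \<le> q t * u\<^sup>2" "0 \<le> u"
  shows "\<bar>\<tau> t\<bar> \<le> 2 * u"
proof -
  have component: "\<bar>dot k (\<lambda>j. z j - s t / dot k w w * w j) c\<bar> \<le> \<Delta> t * u"
    if "dot k w z = s t" "dot k w w * dot k z z = p t * q t" "0 < dot k w w" "dot k c c \<le> dot k w w * u\<^sup>2" for w z c
  proof -
    let ?r = "\<lambda>j. z j - s t / dot k w w * w j"
    have "dot k ?r ?r = dot k z z - s t / dot k w w * s t - s t / dot k w w * (s t - s t / dot k w w * dot k w w)"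
      by (simp only: dot_linear dot_commute[of k z w] that(1))
    also have "\<dots> = (\<Delta> t)\<^sup>2 / dot k w w"
    proof -
      have "(\<Delta> t)\<^sup>2 = dot k w w * dot k z z - (s t)\<^sup>2" by (simp only: area_square that(2))
      thus ?thesis using that(3) by (simp add: field_simps power2_eq_square)
    qed
    finally have "(dot k ?r c)\<^sup>2 \<le> (\<Delta> t)\<^sup>2 / dot k w w * dot k c c"
      using dot_Cauchy_Schwarz[of k ?r c] by simp
    also have "\<dots> \<le> (\<Delta> t)\<^sup>2 / dot k w w * (dot k w w * u\<^sup>2)"
      using that(3,4) by (intro mult_left_mono) auto
    also have "\<dots> = (\<Delta> t * u)\<^sup>2" using that(3) by (simp add: power_mult_distrib)
    finally show ?thesis using area_pos \<open>0 \<le> u\<close> by (intro power2_le_iff_abs_le[THEN iffD1]) auto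
  qed
  have "\<Delta> t * \<tau> t = s' t - s t * \<sigma> t" using area_pos by (simp add: \<tau>_def)
  also have "\<dots> = dot k (\<lambda>j. Y t j - s t / p t * X t j) d + dot k (\<lambda>j. X t j - s t / q t * Y t j) e"
    by (simp only: s'_def \<sigma>_def l_def m_def dot_linear) (simp add: algebra_simps)
  finally have "\<bar>\<Delta> t * \<tau> t\<bar> = \<bar>dot k (\<lambda>j. Y t j - s t / p t * X t j) d + dot k (\<lambda>j. X t j - s t / q t * Y t j) e\<bar>"
    by (rule arg_cong)
  moreover have "\<bar>dot k (\<lambda>j. Y t j - s t / p t * X t j) d\<bar> \<le> \<Delta> t * u" "\<bar>dot k (\<lambda>j. X t j - s t / q t * Y t j) e\<bar>
    \<le> \<Delta> t * u"
    using component[of "X t" "Y t" d] component[of "Y t" "X t" e] squared_norms_pos assms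
    by (simp_all add: p_def q_def s_def dot_commute[of k "Y t" "X t"] mult.commute)
  ultimately have "\<bar>\<Delta> t * \<tau> t\<bar> \<le> \<Delta> t * u + \<Delta> t * u" by linarith
  hence "\<Delta> t * \<bar>\<tau> t\<bar> \<le> \<Delta> t * (2 * u)" using area_pos by (simp add: abs_mult)
  thus ?thesis using area_pos by simp
qed

lemma gram_bounds:
  assumes d: "dot k d d \<le> p t * u\<^sup>2" and e: "dot k e e \<le> q t * u\<^sup>2" and R: "p t * q t \<le> R\<^sup>2" "0 \<le> R"
  shows "\<bar>\<Delta> t\<bar> \<le> R" "\<bar>s t\<bar> \<le> R" "\<bar>dot k d e\<bar> \<le> R * u\<^sup>2"
proof -
  have "(\<Delta> t)\<^sup>2 \<le> R\<^sup>2" "(s t)\<^sup>2 \<le> R\<^sup>2"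
    using area_square R(1) zero_le_power2[of "s t"] zero_le_power2[of "\<Delta> t"] by linarith+
  thus "\<bar>\<Delta> t\<bar> \<le> R" "\<bar>s t\<bar> \<le> R" using R(2) by (simp_all add: power2_le_iff_abs_le)
  have "(dot k d e)\<^sup>2 \<le> p t * u\<^sup>2 * (q t * u\<^sup>2)"
    using dot_Cauchy_Schwarz[of k d e] mult_mono[OF d e] squared_norms_pos by (simp add: dot_nonneg)
  also have "\<dots> = p t * q t * (u\<^sup>2)\<^sup>2" by (simp add: power2_eq_square)
  also have "\<dots> \<le> (R * u\<^sup>2)\<^sup>2" using R by (simp add: power_mult_distrib mult_right_mono)
  finally show "\<bar>dot k d e\<bar> \<le> R * u\<^sup>2" using \<open>0 \<le> R\<close> by (intro power2_le_iff_abs_le[THEN iffD1]) auto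
qed

lemma abs_third_derivative_le:
  assumes d: "dot k d d \<le> p t * u\<^sup>2" and e: "dot k e e \<le> q t * u\<^sup>2" and "0 \<le> u"
    and R: "p t * q t \<le> R\<^sup>2" "0 \<le> R"
  shows "\<bar>third_derivative t\<bar> \<le> 100 * R * u ^ 3"
proof -
  define a where "a = dot k d d / p t"
  define b where "b = dot k e e / q t"
  have ratios: "0 \<le> a" "a \<le> u\<^sup>2" "0 \<le> b" "b \<le> u\<^sup>2"
    using d e squared_norms_pos by (simp_all add: a_def b_def dot_nonneg pos_divide_le_eq mult.commute)
  have square: "(l t)\<^sup>2 \<le> a" "(m t)\<^sup>2 \<le> b" using norm_rate_square_le by (simp_all add: a_def b_def)
  hence rates: "\<bar>l t\<bar> \<le> u" "\<bar>m t\<bar> \<le> u"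
    using ratios \<open>0 \<le> u\<close> by (auto intro!: power2_le_iff_abs_le[THEN iffD1])
  note turn = turn_rate_bound[OF d e \<open>0 \<le> u\<close>] and gram = gram_bounds[OF d e R]
  have scale: "\<bar>\<sigma> t\<bar> \<le> 2 * u" "\<bar>l t - m t\<bar> \<le> 2 * u" using rates by (auto simp: \<sigma>_def)
  have squares: "0 \<le> (\<tau> t)\<^sup>2" "(\<tau> t)\<^sup>2 \<le> 4 * u\<^sup>2" "0 \<le> (l t - m t)\<^sup>2" "(l t - m t)\<^sup>2 \<le> 4 * u\<^sup>2"
    using power_mono[OF turn, of 2] power_mono[OF scale(2), of 2] by (simp_all add: power_mult_distrib)
  have norm_rates: "\<bar>l' t - m' t\<bar> \<le> 2 * u\<^sup>2"
    using ratios square zero_le_power2[of "l t"] zero_le_power2[of "m t"]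
    unfolding l'_def m'_def a_def[symmetric] b_def[symmetric] by linarith
  have "E t = a + b - (l t - m t)\<^sup>2 + (\<tau> t)\<^sup>2" by (simp add: E_def a_def b_def)
  hence hessian: "\<bar>E t\<bar> \<le> 6 * u\<^sup>2" "\<bar>3 * E t - 4 * (\<tau> t)\<^sup>2\<bar> \<le> 16 * u\<^sup>2"
    using ratios squares by linarith+
  have product: "\<bar>x * y\<bar> \<le> c * u ^ 3" if "\<bar>x\<bar> \<le> c1 * u" "\<bar>y\<bar> \<le> c2 * u\<^sup>2" "c = c1 * c2" for x y c c1 c2
    using abs_mult_le[OF that(1,2)] that(3) by (simp add: power2_eq_square power3_eq_cube mult_ac)
  define v where "v = \<sigma> t * E t - 4 * (\<sigma> t * (\<tau> t)\<^sup>2) - 2 * (l t * a + m t * b + (l t - m t) * (l' t - m' t))"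
  define w where "w = \<tau> t * (3 * E t - 4 * (\<tau> t)\<^sup>2)"
  have v: "\<bar>v\<bar> \<le> 56 * u ^ 3"
  proof -
    have "\<bar>\<sigma> t * E t\<bar> \<le> 12 * u ^ 3" "\<bar>\<sigma> t * (\<tau> t)\<^sup>2\<bar> \<le> 8 * u ^ 3" "\<bar>(l t - m t) * (l' t - m' t)\<bar> \<le> 4 * u ^ 3"
      "\<bar>l t * a\<bar> \<le> 1 * u ^ 3" "\<bar>m t * b\<bar> \<le> 1 * u ^ 3"
      by (rule product[OF scale(1) hessian(1)] product[OF scale(1), of _ 4] product[OF scale(2) norm_rates]
        product[of _ 1 _ 1]; use squares ratios rates in simp)+
    thus ?thesis unfolding v_def by argo
  qed
  have w: "\<bar>w\<bar> \<le> 32 * u ^ 3"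
    unfolding w_def by (rule product[OF turn hessian(2)]) simp
  have "third_derivative t = \<Delta> t * v - s t * w + 6 * (dot k d e * \<tau> t)"
    by (simp add: third_derivative_def v_def w_def a_def b_def mult_ac)
  hence "\<bar>third_derivative t\<bar> \<le> R * (56 * u ^ 3) + R * (32 * u ^ 3) + 6 * (R * u\<^sup>2 * (2 * u))"
    using abs_mult_le[OF gram(1) v] abs_mult_le[OF gram(2) w] abs_mult_le[OF gram(3) turn] by linarith
  also have "\<dots> = 100 * R * u ^ 3" by (simp add: power_numeral_reduce)
  finally show ?thesis .
qed

end

lemma relu_kernel_taylor:
  assumes path: "\<And>t. 0 \<le> t \<Longrightarrow> t \<le> 1 \<Longrightarrow> nonparallel k (X t) (Y t)
      \<and> dot k d d \<le> p t * u\<^sup>2 \<and> dot k e e \<le> q t * u\<^sup>2 \<and> p t * q t \<le> R\<^sup>2"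
    and "0 \<le> u" "0 \<le> R"
  shows "\<bar>relu_kernel_remainder k x y d e\<bar> \<le> 17 * R * u ^ 3"
proof -
  define D where "D i = (if i = 0 then \<lambda>t. relu_kernel k (X t) (Y t) else if i
    = 1 then \<lambda>t. relu_kernel_gradient k (X t) (Y t) d e
    else if i = 2 then \<lambda>t. relu_kernel_hessian k (X t) (Y t) d e else third_derivative)" for i :: nat
  have start: "X 0 = x" "Y 0 = y" by (simp_all add: X_def Y_def)
  have "\<exists>t>0. t < 1 \<and> D 0 1 = (\<Sum>i<3. D i 0 / fact i * 1 ^ i) + D 3 t / fact 3 * 1 ^ 3"
  proof (rule Maclaurin)
    show "\<forall>i t. i < 3 \<and> 0 \<le> t \<and> t \<le> 1 \<longrightarrow> (D i has_real_derivative D (Suc i) t) (at t)"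
    proof (intro allI impI)
      fix i :: nat and t :: real
      assume i: "i < 3 \<and> 0 \<le> t \<and> t \<le> 1"
      hence "i = 0 \<or> i = 1 \<or> i = 2" by auto
      with i path[of t] show "(D i has_real_derivative D (Suc i) t) (at t)"
        by (auto simp: D_def relu_kernel_derivative relu_kernel_gradient_derivative relu_kernel_hessian_derivative)
    qed
  qed (auto simp: D_def)
  then obtain t where t: "0 < t" "t < 1"
    and taylor: "D 0 1 = (\<Sum>i<3. D i 0 / fact i * 1 ^ i) + D 3 t / fact 3 * 1 ^ 3" by blast
  have "relu_kernel k (X 1) (Y 1)
    = relu_kernel k x y + relu_kernel_gradient k x y d e + relu_kernel_hessian k x y d e / 2 + third_derivative t / 6"
    using taylor by (simp add: D_def start eval_nat_numeral fact_numeral)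
  hence "relu_kernel_remainder k x y d e = third_derivative t / 6" by (simp add: relu_kernel_remainder_def X_def Y_def)
  moreover have "\<bar>third_derivative t\<bar> \<le> 100 * R * u ^ 3"
    using path[of t] t assms(2,3) by (intro abs_third_derivative_le) auto
  moreover have "0 \<le> R * u ^ 3" using assms(2,3) by simp
  ultimately show ?thesis by simp
qed

end

fun well_conditioned_gram :: "real \<times> real \<times> real \<Rightarrow> bool" where
  "well_conditioned_gram (p, q, s) \<longleftrightarrow> p \<in> {7 / 100..11 / 10} \<and> q \<in> {7 / 100..11 / 10} \<and> 1 / 100 \<le> p * q - s\<^sup>2"

definition well_conditioned :: "nat \<Rightarrow> (nat \<Rightarrow> real) \<Rightarrow> (nat \<Rightarrow> real) \<Rightarrow> bool" where
  "well_conditioned k x y \<longleftrightarrow> well_conditioned_gram (dot k x x, dot k y y, dot k x y)"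

lemma well_conditioned_path:
  assumes conditioned: "well_conditioned k x y" and d: "dot k d d \<le> \<epsilon>\<^sup>2" and e: "dot k e e \<le> \<epsilon>\<^sup>2"
    and eps: "0 \<le> \<epsilon>" "\<epsilon> \<le> 1 / 1000000" and t: "0 \<le> t" "t \<le> 1"
  shows "nonparallel k (linear_paths.X x d t) (linear_paths.Y y e t)"
    "linear_paths.p k x d t \<in> {1 / 16..6 / 5}" "linear_paths.q k y e t \<in> {1 / 16..6 / 5}"
proof -
  interpret linear_paths k x y d e .
  define P where "P = dot k x x"
  define Q where "Q = dot k y y"
  define S where "S = dot k x y"
  have initial: "7 / 100 \<le> P" "P \<le> 11 / 10" "7 / 100 \<le> Q" "Q \<le> 11 / 10" "1 / 100 \<le> P * Q - S\<^sup>2"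
    using conditioned by (auto simp: well_conditioned_def P_def Q_def S_def)
  have norms: "dot k x x \<le> (105 / 100)\<^sup>2" "dot k y y \<le> (105 / 100)\<^sup>2" using initial
    by (simp_all add: P_def Q_def power2_eq_square)
  have linear: "\<bar>t * dot k z c\<bar> \<le> 11 / 10 * \<epsilon>" if "dot k z z \<le> (105 / 100)\<^sup>2" "dot k c c \<le> \<epsilon>\<^sup>2" for z c
    using abs_mult_le[of t 1, OF _ abs_dot_le[OF that _ eps(1)]] t eps(1) by simp
  have quadratic: "\<bar>t\<^sup>2 * dot k z c\<bar> \<le> \<epsilon> / 1000000" if "dot k z z \<le> \<epsilon>\<^sup>2" "dot k c c \<le> \<epsilon>\<^sup>2" for z c
  proof -
    have "\<bar>t\<^sup>2 * dot k z c\<bar> \<le> 1 * (\<epsilon> * \<epsilon>)"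
      using t by (intro abs_mult_le abs_dot_le that eps) (simp add: power_le_one)
    thus ?thesis using mult_left_mono[OF eps(2,1)] by simp
  qed
  have close: "\<bar>p t - P\<bar> \<le> 3 * \<epsilon>" "\<bar>q t - Q\<bar> \<le> 3 * \<epsilon>" "\<bar>s t - S\<bar> \<le> 3 * \<epsilon>"
    using linear[OF norms(1) d] linear[OF norms(2) e] linear[OF norms(1) e] linear[OF norms(2) d]
      quadratic[OF d d] quadratic[OF e e] quadratic[OF d e] eps(1)
    unfolding gram_along P_def Q_def S_def distrib_left mult.assoc by argo+
  thus bounds: "p t \<in> {1 / 16..6 / 5}" "q t \<in> {1 / 16..6 / 5}" using initial eps by auto
  have "\<bar>(s t - S) * (s t + S)\<bar> \<le> 3 * \<epsilon> * 3"
  proof (rule abs_mult_le[OF close(3)])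
    have "\<bar>S\<bar> \<le> 105 / 100 * (105 / 100)" unfolding S_def by (rule abs_dot_le[OF norms]) auto
    thus "\<bar>s t + S\<bar> \<le> 3" using close(3) eps by simp
  qed
  moreover have "\<bar>(p t - P) * q t\<bar> \<le> 3 * \<epsilon> * (6 / 5)" "\<bar>P * (q t - Q)\<bar> \<le> 6 / 5 * (3 * \<epsilon>)"
    using close bounds initial by (intro abs_mult_le; auto)+
  moreover have "p t * q t - (s t)\<^sup>2 = P * Q - S\<^sup>2 + (p t - P) * q t + P * (q t - Q) - (s t - S) * (s t + S)"
    by (simp add: power2_eq_square algebra_simps)
  ultimately show "nonparallel k (X t) (Y t)"
    using initial(5) eps unfolding nonparallel_def p_def[symmetric] q_def[symmetric] s_def[symmetric] by argo
qed

lemma relu_kernel_second_order: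
  assumes "well_conditioned k x y" and d: "dot k d d \<le> \<epsilon>\<^sup>2" and e: "dot k e e \<le> \<epsilon>\<^sup>2"
    and eps: "0 \<le> \<epsilon>" "\<epsilon> \<le> 1 / 1000000"
  shows "nonparallel k (\<lambda>j. x j + d j) (\<lambda>j. y j + e j)" and "\<bar>relu_kernel_remainder k x y d e\<bar> \<le> 1306 * \<epsilon> ^ 3"
proof -
  interpret linear_paths k x y d e .
  note path = well_conditioned_path[OF assms]
  show "nonparallel k (\<lambda>j. x j + d j) (\<lambda>j. y j + e j)" using path(1)[of 1] by (simp add: X_def Y_def)
  have "\<bar>relu_kernel_remainder k x y d e\<bar> \<le> 17 * (6 / 5) * (4 * \<epsilon>) ^ 3"
  proof (rule relu_kernel_taylor)
    fix t :: real assume t: "0 \<le> t" "t \<le> 1"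
    have small: "\<epsilon>\<^sup>2 \<le> r * (4 * \<epsilon>)\<^sup>2" if "1 / 16 \<le> r" for r
      using mult_right_mono[OF that, of "(4 * \<epsilon>)\<^sup>2"] by (simp add: power_mult_distrib)
    have "dot k d d \<le> p t * (4 * \<epsilon>)\<^sup>2" "dot k e e \<le> q t * (4 * \<epsilon>)\<^sup>2"
      using d e small[of "p t"] small[of "q t"] path(2,3)[OF t] by auto
    moreover have "p t * q t \<le> 6 / 5 * (6 / 5)" using path(2,3)[OF t] by (intro mult_mono) auto
    ultimately show "nonparallel k (X t) (Y t) \<and> dot k d d \<le> p t * (4 * \<epsilon>)\<^sup>2 \<and> dot k e e \<le> q t * (4 * \<epsilon>)\<^sup>2 \<and> p t * q t
      \<le> (6 / 5)\<^sup>2"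
      using path(1)[OF t] by (simp add: power2_eq_square)
  qed (use eps in auto)
  also have "\<dots> \<le> 1306 * \<epsilon> ^ 3" using eps by (simp add: power_mult_distrib)
  finally show "\<bar>relu_kernel_remainder k x y d e\<bar> \<le> 1306 * \<epsilon> ^ 3" .
qed

section \<open>Local minima near certified points\<close>

lemma sum_lower_triangle_both:
  fixes f :: "nat \<Rightarrow> nat \<Rightarrow> real"
  shows "(\<Sum>i<n. \<Sum>j<i. f i j + f j i) = (\<Sum>i<n. \<Sum>j\<in>{..<n} - {i}. f i j)"
proof -
  have "(\<Sum>i<n. \<Sum>j<n. f i j + f j i) = (\<Sum>i<n. f i i + f i i) + 2 * (\<Sum>i<n. \<Sum>j<i. f i j + f j i)"
    by (rule sum_symmetric_pairs) (rule add.commute)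
  moreover have "(\<Sum>i<n. \<Sum>j<n. f j i) = (\<Sum>i<n. \<Sum>j<n. f i j)" by (rule sum.swap)
  moreover have "(\<Sum>i<n. \<Sum>j\<in>{..<n} - {i}. f i j) = (\<Sum>i<n. \<Sum>j<n. f i j) - (\<Sum>i<n. f i i)"
    by (simp add: sum_diff1 sum_subtractf)
  ultimately show ?thesis by (simp only: sum.distrib) simp
qed

lemma sum_lower_triangle_add:
  fixes a :: "nat \<Rightarrow> real"
  shows "(\<Sum>i<n. \<Sum>j<i. a i + a j) = (real n - 1) * (\<Sum>i<n. a i)"
  by (simp add: sum_lower_triangle_both[of "\<lambda>i j. a i"] sum_diff1 sum_subtractf sum_distrib_left left_diff_distrib)

definition gram_gradient_form :: "nat \<Rightarrow> nat \<Rightarrow> (nat \<Rightarrow> nat \<Rightarrow> real) \<Rightarrow> (nat \<Rightarrow> nat \<Rightarrow> real) \<Rightarrow> real" where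
  "gram_gradient_form k n C d = (\<Sum>i<n. \<Sum>j<i. relu_kernel_gradient k (C i) (C j) (d i) (d j))
     + pi * (\<Sum>i<n. dot k (C i) (d i)) - (\<Sum>i<n. \<Sum>j<k. relu_kernel_gradient k (C i) (axis_vec j) (d i) (\<lambda>_. 0))"

definition gram_hessian_form :: "nat \<Rightarrow> nat \<Rightarrow> (nat \<Rightarrow> nat \<Rightarrow> real) \<Rightarrow> (nat \<Rightarrow> nat \<Rightarrow> real) \<Rightarrow> real" where
  "gram_hessian_form k n C d = (\<Sum>i<n. \<Sum>j<i. relu_kernel_hessian k (C i) (C j) (d i) (d j))
     + pi * (\<Sum>i<n. dot k (d i) (d i)) - (\<Sum>i<n. \<Sum>j<k. relu_kernel_hessian k (C i) (axis_vec j) (d i) (\<lambda>_. 0))"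

definition well_conditioned_point :: "nat \<Rightarrow> nat \<Rightarrow> (nat \<Rightarrow> nat \<Rightarrow> real) \<Rightarrow> bool" where
  "well_conditioned_point k n C \<longleftrightarrow> (\<forall>i<n. \<forall>j<i. well_conditioned k (C i) (C j))
    \<and> (\<forall>i<n. \<forall>j<k. well_conditioned k (C i) (axis_vec j))"

lemma well_conditioned_perturbation:
  assumes conditioned: "well_conditioned k x y" and r: "dot k d d + dot k e e \<le> r\<^sup>2" "0 \<le> r" "r \<le> 1 / 1000000"
  shows "nonparallel k (\<lambda>j. x j + d j) (\<lambda>j. y j + e j)"
    and "\<bar>relu_kernel_remainder k x y d e\<bar> \<le> 1306 * (r * (dot k d d + dot k e e))"
proof -
  define \<epsilon> where "\<epsilon> = sqrt (dot k d d + dot k e e)"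
  have eps_square: "\<epsilon>\<^sup>2 = dot k d d + dot k e e" by (simp add: \<epsilon>_def dot_nonneg)
  have "0 \<le> \<epsilon>" "\<epsilon> \<le> r" using r by (auto simp: \<epsilon>_def dot_nonneg intro: real_le_lsqrt)
  have "\<epsilon> ^ 3 \<le> r * \<epsilon>\<^sup>2"
    using mult_right_mono[OF \<open>\<epsilon> \<le> r\<close>, of "\<epsilon>\<^sup>2"] by (simp add: power3_eq_cube power2_eq_square mult.assoc)
  moreover have small: "dot k d d \<le> \<epsilon>\<^sup>2" "dot k e e \<le> \<epsilon>\<^sup>2" by (simp_all add: eps_square dot_nonneg)
  note expansion = relu_kernel_second_order[OF conditioned small \<open>0 \<le> \<epsilon>\<close> order_trans[OF \<open>\<epsilon> \<le> r\<close> r(3)]]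
  ultimately show "nonparallel k (\<lambda>j. x j + d j) (\<lambda>j. y j + e j)"
    and "\<bar>relu_kernel_remainder k x y d e\<bar> \<le> 1306 * (r * (dot k d d + dot k e e))"
    using expansion unfolding eps_square by auto
qed

lemma well_conditioned_point_perturbation:
  fixes k n :: nat and C d :: "nat \<Rightarrow> nat \<Rightarrow> real"
  defines "C' \<equiv> \<lambda>i j. C i j + d i j"
  assumes conditioned: "well_conditioned_point k n C"
    and r: "(\<Sum>i<n. dot k (d i) (d i)) \<le> r\<^sup>2" "0 \<le> r" "r \<le> 1 / 1000000" and "i < n"
  shows "j < i \<Longrightarrow> nonparallel k (C' i) (C' j)"
    and "j < i \<Longrightarrow> \<bar>relu_kernel_remainder k (C i) (C j) (d i) (d j)\<bar> \<le> 1306 * r * (dot k (d i) (d i) + dot k (d j) (d j))"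
    and "j < k \<Longrightarrow> nonparallel k (C' i) (axis_vec j)"
    and "j < k \<Longrightarrow> \<bar>relu_kernel_remainder k (C i) (axis_vec j) (d i) (\<lambda>_. 0)\<bar> \<le> 1306 * r * dot k (d i) (d i)"
proof -
  have rows: "(\<Sum>l\<in>I. dot k (d l) (d l)) \<le> r\<^sup>2" if "I \<subseteq> {..<n}" for I
    using that r(1) by (meson dual_order.trans finite_lessThan sum_mono2 dot_nonneg)
  have pair: "dot k (d i) (d i) + dot k (d j) (d j) \<le> r\<^sup>2" if "j < i"
    using rows[of "{i, j}"] \<open>i < n\<close> that by simp
  show "j < i \<Longrightarrow> nonparallel k (C' i) (C' j)"
    and "j < i \<Longrightarrow> \<bar>relu_kernel_remainder k (C i) (C j) (d i) (d j)\<bar> \<le> 1306 * r * (dot k (d i) (d i) + dot k (d j) (d j))"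
    using well_conditioned_perturbation[OF _ pair r(2,3), of "C i" "C j"] conditioned \<open>i < n\<close>
    by (simp_all add: well_conditioned_point_def C'_def)
  have single: "dot k (d i) (d i) + dot k (\<lambda>_. 0) (\<lambda>_. 0) \<le> r\<^sup>2"
    using rows[of "{i}"] \<open>i < n\<close> by (simp add: dot_def)
  show "j < k \<Longrightarrow> nonparallel k (C' i) (axis_vec j)"
    and "j < k \<Longrightarrow> \<bar>relu_kernel_remainder k (C i) (axis_vec j) (d i) (\<lambda>_. 0)\<bar> \<le> 1306 * r * dot k (d i) (d i)"
    using well_conditioned_perturbation[OF _ single r(2,3), of "C i" "axis_vec j"] conditioned \<open>i < n\<close>
    by (simp_all add: well_conditioned_point_def C'_def dot_zero_right)
qed

lemma gram_loss_expansion: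
  fixes k n :: nat and C d :: "nat \<Rightarrow> nat \<Rightarrow> real"
  defines "N \<equiv> \<Sum>i<n. dot k (d i) (d i)" and "C' \<equiv> \<lambda>i j. C i j + d i j"
  assumes conditioned: "well_conditioned_point k n C" and r: "N \<le> r\<^sup>2" "0 \<le> r" "r \<le> 1 / 1000000"
  shows "pairwise_nonparallel k n C'"
    and "gram_loss k n C' \<ge> gram_loss k n C + gram_gradient_form k n C d + gram_hessian_form k n C d / 2
      - 1306 * (real n - 1 + real k) * r * N"
proof -
  note remainder = well_conditioned_point_perturbation[OF conditioned r[unfolded N_def]]
  show "pairwise_nonparallel k n C'"
    unfolding pairwise_nonparallel_def C'_def using remainder(1,3) by blast
  have remainders: "(\<Sum>i<n. \<Sum>j<i. 1306 * r * (dot k (d i) (d i) + dot k (d j) (d j))) = 1306 * r * ((real n - 1) * N)"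
    "(\<Sum>i<n. \<Sum>j<k. 1306 * r * dot k (d i) (d i)) = 1306 * r * (real k * N)"
    by (simp_all only: sum_distrib_left[symmetric] sum_lower_triangle_add N_def) (simp add: sum_distrib_left mult_ac)
  have "(\<Sum>i<n. \<Sum>j<i. relu_kernel k (C' i) (C' j)) \<ge> (\<Sum>i<n. \<Sum>j<i. relu_kernel k (C i) (C j)
      + relu_kernel_gradient k (C i) (C j) (d i) (d j) + relu_kernel_hessian k (C i) (C j) (d i) (d j) / 2
      - 1306 * r * (dot k (d i) (d i) + dot k (d j) (d j)))"
    using remainder(2) unfolding C'_def relu_kernel_remainder_def abs_le_iff
    by (intro sum_mono) (force simp: algebra_simps)
  note pairs = this[unfolded sum_subtractf, unfolded remainders sum.distrib sum_divide_distrib[symmetric]]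
  have "(\<Sum>i<n. \<Sum>j<k. relu_kernel k (C' i) (axis_vec j)) \<le> (\<Sum>i<n. \<Sum>j<k. relu_kernel k (C i) (axis_vec j)
      + relu_kernel_gradient k (C i) (axis_vec j) (d i) (\<lambda>_. 0) + relu_kernel_hessian k (C i) (axis_vec j) (d i)
        (\<lambda>_. 0) / 2
      + 1306 * r * dot k (d i) (d i))"
    using remainder(4) unfolding C'_def relu_kernel_remainder_def abs_le_iff
    by (intro sum_mono) (force simp: algebra_simps)
  note targets = this[unfolded sum.distrib, unfolded remainders sum_divide_distrib[symmetric]]
  have norms: "(\<Sum>i<n. dot k (C' i) (C' i)) = (\<Sum>i<n. dot k (C i) (C i)) + 2 * (\<Sum>i<n. dot k (C i) (d i)) + N"
    unfolding C'_def N_def sum_distrib_left sum.distrib[symmetric]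
    by (intro sum.cong refl) (simp add: dot_linear dot_commute)
  have "1306 * (real n - 1 + real k) * r * N = 1306 * r * ((real n - 1) * N) + 1306 * r * (real k * N)"
    by (simp add: algebra_simps)
  with pairs targets show "gram_loss k n C' \<ge> gram_loss k n C + gram_gradient_form k n C d
    + gram_hessian_form k n C d / 2
      - 1306 * (real n - 1 + real k) * r * N"
    unfolding gram_loss_def gram_gradient_form_def gram_hessian_form_def norms distrib_left N_def[symmetric]
    by (simp add: field_simps)
qed

definition gram_multiplier :: "nat \<Rightarrow> nat \<Rightarrow> (nat \<Rightarrow> nat \<Rightarrow> real) \<Rightarrow> nat \<Rightarrow> real" where
  "gram_multiplier k n C i = pi + ((\<Sum>j\<in>{..<n} - {i}. area (dot k (C i) (C i)) (dot k (C j) (C j)) (dot k (C i) (C j)))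
     - (\<Sum>j<k. area (dot k (C i) (C i)) 1 (C i j))) / dot k (C i) (C i)"

definition gram_gradient :: "nat \<Rightarrow> nat \<Rightarrow> (nat \<Rightarrow> nat \<Rightarrow> real) \<Rightarrow> nat \<Rightarrow> nat \<Rightarrow> real" where
  "gram_gradient k n C i = (\<lambda>l. gram_multiplier k n C i * C i l
     + (\<Sum>j\<in>{..<n} - {i}. supp_angle (dot k (C i) (C i)) (dot k (C j) (C j)) (dot k (C i) (C j)) * C j l)
     - supp_angle (dot k (C i) (C i)) 1 (C i l))"

lemma gram_gradient_form_eq: "gram_gradient_form k n C d = (\<Sum>i<n. dot k (gram_gradient k n C i) (d i))"
proof -
  define a where "a i j = area (dot k (C i) (C i)) (dot k (C j) (C j)) (dot k (C i) (C j))" for i j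
  define t where "t i j = supp_angle (dot k (C i) (C i)) (dot k (C j) (C j)) (dot k (C i) (C j))" for i j
  define h where "h i j = a i j / dot k (C i) (C i) * dot k (C i) (d i) + t i j * dot k (C j) (d i)" for i j
  have "relu_kernel_gradient k (C i) (C j) (d i) (d j) = h i j + h j i" for i j
    by (simp add: relu_kernel_gradient_def h_def a_def t_def area_commute[of "dot k (C j) (C j)"]
      supp_angle_commute[of "dot k (C j) (C j)"] dot_commute[of k "C j" "C i"] algebra_simps)
  hence pairs: "(\<Sum>i<n. \<Sum>j<i. relu_kernel_gradient k (C i) (C j) (d i) (d j)) = (\<Sum>i<n. \<Sum>j\<in>{..<n} - {i}. h i j)"
    by (simp add: sum_lower_triangle_both)
  have target: "relu_kernel_gradient k (C i) (axis_vec j) (d i) (\<lambda>_. 0)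
      = area (dot k (C i) (C i)) 1 (C i j) / dot k (C i) (C i) * dot k (C i) (d i)
        + supp_angle (dot k (C i) (C i)) 1 (C i j) * d i j"
    if "j < k" for i j
    using that by (simp add: relu_kernel_gradient_def dot_axis_left dot_axis_right dot_zero_right)
      (simp add: axis_vec_def)
  have "dot k (gram_gradient k n C i) (d i)
      = (\<Sum>j\<in>{..<n} - {i}. h i j) + pi * dot k (C i) (d i)
        - (\<Sum>j<k. relu_kernel_gradient k (C i) (axis_vec j) (d i) (\<lambda>_. 0))" for i
  proof -
    have "dot k (gram_gradient k n C i) (d i)
        = (pi + ((\<Sum>j\<in>{..<n} - {i}. a i j) - (\<Sum>j<k. area (dot k (C i) (C i)) 1 (C i j))) / dot k (C i) (C i)) * dot
          k (C i) (d i)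
          + (\<Sum>j\<in>{..<n} - {i}. t i j * dot k (C j) (d i)) - (\<Sum>j<k. supp_angle (dot k (C i) (C i)) 1 (C i j) * d i j)"
      unfolding gram_gradient_def gram_multiplier_def a_def[symmetric] t_def[symmetric] dot_add_left dot_diff_left
        dot_scale_left dot_sum_left
      by (simp add: dot_def[of k "\<lambda>l. supp_angle (dot k (C i) (C i)) 1 (C i l)"])
    thus ?thesis
      by (simp add: h_def target sum.distrib sum_divide_distrib[symmetric] sum_distrib_right[symmetric]
        diff_divide_distrib distrib_right left_diff_distrib)
  qed
  thus ?thesis
    unfolding gram_gradient_form_def pairs sum_distrib_left sum_subtractf[symmetric] sum.distrib[symmetric]
    by (simp only:)
qed

definition certified_point :: "nat \<Rightarrow> nat \<Rightarrow> (nat \<Rightarrow> nat \<Rightarrow> real) \<Rightarrow> bool" where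
  "certified_point k n C \<longleftrightarrow> well_conditioned_point k n C
     \<and> (\<forall>i<n. \<forall>l<k. \<bar>gram_gradient k n C i l\<bar> \<le> 1 / 2 ^ 41)
     \<and> (\<forall>d. gram_hessian_form k n C d \<ge> 1 / 128 * (\<Sum>i<n. dot k (d i) (d i)))
     \<and> gram_loss k n C \<ge> 1 / 1000"

definition sq_dist :: "nat \<Rightarrow> nat \<Rightarrow> (nat \<Rightarrow> nat \<Rightarrow> real) \<Rightarrow> (nat \<Rightarrow> nat \<Rightarrow> real) \<Rightarrow> real" where
  "sq_dist n k A B = (\<Sum>i<n. \<Sum>j<k. (A i j - B i j)\<^sup>2)"

lemma sq_dist_nonneg: "0 \<le> sq_dist n k A B"
  by (simp add: sq_dist_def sum_nonneg)

lemma sqrt_sq_dist: "sqrt (sq_dist n k A B) = L2_set (\<lambda>(i, j). A i j - B i j) ({..<n} \<times> {..<k})"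
  by (simp add: sq_dist_def L2_set_def sum.cartesian_product case_prod_beta)

lemma sqrt_sq_dist_triangle: "sqrt (sq_dist n k A C) \<le> sqrt (sq_dist n k A B) + sqrt (sq_dist n k B C)"
  using L2_set_triangle_ineq[of "\<lambda>(i, j). A i j - B i j" "\<lambda>(i, j). B i j - C i j" "{..<n} \<times> {..<k}"]
  unfolding sqrt_sq_dist split_def by simp

lemma sum_abs_le_L2:
  assumes "\<And>i j. i < n \<Longrightarrow> j < k \<Longrightarrow> \<bar>G i j\<bar> \<le> g" "0 \<le> g"
  shows "\<bar>\<Sum>i<n. \<Sum>j<k. G i j * (A i j - B i j)\<bar> \<le> g * (sqrt (real (n * k)) * sqrt (sq_dist n k A B))"
proof -
  let ?S = "{..<n} \<times> {..<k}"
  have "\<bar>\<Sum>i<n. \<Sum>j<k. G i j * (A i j - B i j)\<bar> = \<bar>\<Sum>(i, j)\<in>?S. G i j * (A i j - B i j)\<bar>"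
    by (simp add: sum.cartesian_product case_prod_beta)
  also have "\<dots> \<le> (\<Sum>(i, j)\<in>?S. \<bar>g\<bar> * \<bar>A i j - B i j\<bar>)"
    using assms(2) by (intro order_trans[OF sum_abs] sum_mono) (auto simp: abs_mult assms(1) intro!: mult_right_mono)
  also have "\<dots> \<le> L2_set (\<lambda>_. g) ?S * L2_set (\<lambda>(i, j). A i j - B i j) ?S"
    using L2_set_mult_ineq[of "\<lambda>_. g" "\<lambda>(i, j). A i j - B i j" ?S] by (simp add: case_prod_beta)
  also have "L2_set (\<lambda>_. g) ?S = sqrt (real (n * k)) * g"
    using assms(2) by (simp add: L2_set_def card_cartesian_product real_sqrt_mult)
  finally show ?thesis by (simp add: sqrt_sq_dist mult_ac)
qed

text \<open>The remainder, at most \<open>50934 r N \<le> N / 2048\<close>, takes at most half of the \<open>N / 256\<close> that the Hessian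
  contributes.\<close>

lemma gram_loss_near_certified_point:
  assumes cert: "certified_point k n C" and size: "n \<le> 20" "k \<le> 20" and near: "sq_dist n k C' C \<le> (1 / 2 ^ 27)\<^sup>2"
  shows "pairwise_nonparallel k n C'"
    and "gram_loss k n C' \<ge> gram_loss k n C + sq_dist n k C' C / 512 - 20 / 2 ^ 41 * sqrt (sq_dist n k C' C)"
proof -
  define d where "d i j = C' i j - C i j" for i j
  define N where "N = sq_dist n k C' C"
  have N: "(\<Sum>i<n. dot k (d i) (d i)) = N" by (simp add: N_def sq_dist_def dot_def d_def power2_eq_square)
  have sum: "(\<lambda>i j. C i j + d i j) = C'" by (simp add: d_def)
  note expansion = gram_loss_expansion[where n = n and k = k and C = C and d = d and r = "1 / 2 ^ 27", unfolded N sum,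
    OF _ near[folded N_def]]
  have conditioned: "well_conditioned_point k n C" using cert by (simp add: certified_point_def)
  show "pairwise_nonparallel k n C'" by (rule expansion(1)[OF conditioned]) simp_all
  have "\<bar>gram_gradient_form k n C d\<bar> \<le> 1 / 2 ^ 41 * (sqrt (real (n * k)) * sqrt N)"
    using cert unfolding gram_gradient_form_eq dot_def d_def N_def
    by (intro sum_abs_le_L2) (simp_all add: certified_point_def)
  also have "sqrt (real (n * k)) * sqrt N \<le> 20 * sqrt N"
  proof (rule mult_right_mono)
    have "real (n * k) \<le> 20 * 20" using size unfolding of_nat_mult by (intro mult_mono) auto
    thus "sqrt (real (n * k)) \<le> 20" by (intro real_le_lsqrt) auto
  qed (simp add: N_def sq_dist_nonneg)
  finally have "- gram_gradient_form k n C d \<le> 20 / 2 ^ 41 * sqrt N" by simp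
  moreover have "gram_hessian_form k n C d \<ge> 1 / 128 * N" using cert unfolding certified_point_def N[symmetric] by blast
  moreover have remainder: "1306 * (real n - 1 + real k) * (1 / 2 ^ 27) * N \<le> 1 / 2048 * N"
    using size by (intro mult_right_mono) (simp_all add: N_def sq_dist_nonneg)
  have "gram_loss k n C' \<ge> gram_loss k n C + gram_gradient_form k n C d + gram_hessian_form k n C d / 2 - 1 / 2048 * N"
    by (rule order_trans[OF diff_left_mono[OF remainder] expansion(2)[OF conditioned]]) simp_all
  moreover have "0 \<le> N" by (simp add: N_def sq_dist_nonneg)
  ultimately show "gram_loss k n C' \<ge> gram_loss k n C + sq_dist n k C' C / 512 - 20 / 2 ^ 41 * sqrt (sq_dist n k C' C)"
    unfolding N_def[symmetric] by linarith
qed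

lemma compact_box:
  fixes l u :: "nat \<Rightarrow> nat \<Rightarrow> real"
  shows "compact {C. \<forall>i j. l i j \<le> C i j \<and> C i j \<le> u i j}"
proof -
  have compact_PiE: "compact (PiE UNIV S)" if "\<And>i :: nat. compact (S i)" for S :: "nat \<Rightarrow> 'a :: topological_space set"
    using compactin_PiE[of "\<lambda>_. euclidean" UNIV S] that by (simp add: euclidean_product_topology)
  have "compact (PiE UNIV (\<lambda>i. PiE UNIV (\<lambda>j. {l i j..u i j})))"
    by (intro compact_PiE) simp
  moreover have "PiE UNIV (\<lambda>i. PiE UNIV (\<lambda>j. {l i j..u i j})) = {C. \<forall>i j. l i j \<le> C i j \<and> C i j \<le> u i j}"
    by (auto simp: PiE_def Pi_iff)
  ultimately show ?thesis by simp
qed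

lemma continuous_on_entry: "continuous_on S (\<lambda>C :: nat \<Rightarrow> nat \<Rightarrow> real. C i j)"
proof -
  have "continuous_on UNIV (\<lambda>f :: nat \<Rightarrow> real. f j)" by (rule continuous_on_product_coordinates)
  moreover have "continuous_on S (\<lambda>C :: nat \<Rightarrow> nat \<Rightarrow> real. C i)"
    by (rule continuous_on_subset[OF continuous_on_product_coordinates]) simp
  ultimately show ?thesis by (rule continuous_on_compose2) simp
qed

lemma abs_entry_le_sqrt_sq_dist: "i < n \<Longrightarrow> j < k \<Longrightarrow> \<bar>A i j - B i j\<bar> \<le> sqrt (sq_dist n k A B)"
  using member_le_L2_set[of "{..<n} \<times> {..<k}" "(i, j)" "\<lambda>(i, j). \<bar>A i j - B i j\<bar>"]
  by (simp add: sqrt_sq_dist L2_set_def case_prod_beta)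

lemma attains_min_on_ball:
  fixes F :: "(nat \<Rightarrow> nat \<Rightarrow> real) \<Rightarrow> real"
  assumes cont: "continuous_on {A. sq_dist n k A C \<le> r\<^sup>2} F"
    and entries: "\<And>A B. (\<And>i j. i < n \<Longrightarrow> j < k \<Longrightarrow> A i j = B i j) \<Longrightarrow> F A = F B"
    and "0 \<le> r"
  obtains A where "sq_dist n k A C \<le> r\<^sup>2" "\<And>B. sq_dist n k B C \<le> r\<^sup>2 \<Longrightarrow> F A \<le> F B"
proof -
  define trunc :: "(nat \<Rightarrow> nat \<Rightarrow> real) \<Rightarrow> nat \<Rightarrow> nat \<Rightarrow> real" where "trunc A i j = (if i < n \<and> j < k then A i j else 0)"
    for A i j
  define box where "box = {A. \<forall>i j. trunc (\<lambda>i j. C i j - r) i j \<le> A i j \<and> A i j \<le> trunc (\<lambda>i j. C i j + r) i j}"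
  have trunc: "F (trunc A) = F A" "sq_dist n k (trunc A) C = sq_dist n k A C" for A
    by (auto intro!: entries sum.cong simp: trunc_def sq_dist_def)
  have in_box: "trunc A \<in> box" if "sq_dist n k A C \<le> r\<^sup>2" for A
  proof -
    have "sqrt (sq_dist n k A C) \<le> r" using that \<open>0 \<le> r\<close> by (rule real_le_lsqrt[rotated])
    hence "\<bar>A i j - C i j\<bar> \<le> r" if "i < n" "j < k" for i j
      using abs_entry_le_sqrt_sq_dist[OF that, of A C] by linarith
    thus ?thesis by (auto simp: box_def trunc_def abs_le_iff algebra_simps)
  qed
  have "continuous_on UNIV (\<lambda>A. sq_dist n k A C)"
    unfolding sq_dist_def by (intro continuous_intros continuous_on_entry)
  hence "closed {A. sq_dist n k A C \<le> r\<^sup>2}" by (intro closed_Collect_le continuous_on_const)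
  hence "compact (box \<inter> {A. sq_dist n k A C \<le> r\<^sup>2})"
    unfolding box_def by (intro compact_Int_closed compact_box)
  moreover have "box \<inter> {A. sq_dist n k A C \<le> r\<^sup>2} \<noteq> {}" using in_box[of C] trunc(2)[of C] by (auto simp: sq_dist_def)
  moreover have "continuous_on (box \<inter> {A. sq_dist n k A C \<le> r\<^sup>2}) F" by (rule continuous_on_subset[OF cont]) simp
  ultimately obtain A where A: "A \<in> box \<inter> {A. sq_dist n k A C \<le> r\<^sup>2}" "\<forall>B \<in> box \<inter> {A. sq_dist n k A C \<le> r\<^sup>2}. F A \<le> F B"
    by (rule continuous_attains_inf[THEN bexE])
  show ?thesis
  proof (rule that)
    show "sq_dist n k A C \<le> r\<^sup>2" using A(1) by simp
    show "F A \<le> F B" if "sq_dist n k B C \<le> r\<^sup>2" for B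
      using bspec[OF A(2), of "trunc B"] in_box[OF that] that by (simp add: trunc)
  qed
qed

lemma continuous_on_dot:
  "(\<And>l. continuous_on S (\<lambda>C. x C l)) \<Longrightarrow> (\<And>l. continuous_on S (\<lambda>C. y C l)) \<Longrightarrow> continuous_on S (\<lambda>C. dot k (x C) (y C))"
  unfolding dot_def by (intro continuous_intros)

lemma continuous_on_relu_kernel:
  assumes "\<And>l. continuous_on S (\<lambda>C. x C l)" "\<And>l. continuous_on S (\<lambda>C. y C l)" "\<And>C. C \<in> S \<Longrightarrow> nonparallel k (x C) (y C)"
  shows "continuous_on S (\<lambda>C. relu_kernel k (x C) (y C))"
proof -
  have "continuous_on S (\<lambda>C. area (dot k (x C) (x C)) (dot k (y C) (y C)) (dot k (x C) (y C)))"
    unfolding area_def by (intro continuous_intros continuous_on_dot assms(1,2))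
  moreover have "\<forall>C\<in>S. area (dot k (x C) (x C)) (dot k (y C) (y C)) (dot k (x C) (y C)) \<noteq> 0"
    using assms(3) by (fastforce simp: nonparallel_def area_def)
  ultimately show ?thesis
    unfolding relu_kernel_def arc_kernel_def supp_angle_def
    by (intro continuous_on_add continuous_on_mult continuous_on_arctan continuous_on_divide continuous_on_const
      continuous_on_dot assms(1,2))
qed

lemma continuous_on_gram_loss:
  assumes "\<And>C. C \<in> S \<Longrightarrow> pairwise_nonparallel k n C"
  shows "continuous_on S (gram_loss k n)"
  unfolding gram_loss_def[abs_def] dot_def using assms
  by (intro continuous_intros continuous_on_relu_kernel continuous_on_entry) (auto simp: pairwise_nonparallel_def)

lemma gram_loss_cong: "(\<And>i j. i < n \<Longrightarrow> j < k \<Longrightarrow> A i j = B i j) \<Longrightarrow> gram_loss k n A = gram_loss k n B"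
  by (simp add: gram_loss_def relu_kernel_def dot_def)

lemma certified_point_local_min:
  assumes cert: "certified_point k n C" and size: "n \<le> 20" "k \<le> 20"
  obtains A where "gram_loss k n A > 0" "sq_dist n k A C < (1 / 2 ^ 27)\<^sup>2"
    "\<And>B. sq_dist n k B C \<le> (1 / 2 ^ 27)\<^sup>2 \<Longrightarrow> gram_loss k n A \<le> gram_loss k n B"
proof -
  define r :: real where "r = 1 / 2 ^ 27"
  note near = gram_loss_near_certified_point[OF cert size, folded r_def]
  obtain A where A: "sq_dist n k A C \<le> r\<^sup>2" and min: "\<And>B. sq_dist n k B C \<le> r\<^sup>2 \<Longrightarrow> gram_loss k n A \<le> gram_loss k n B"
    by (rule attains_min_on_ball[of n k C r "gram_loss k n"])
      (auto intro!: continuous_on_gram_loss near(1) gram_loss_cong simp: r_def)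
  note lower = near(2)[OF A]
  have "sq_dist n k A C \<noteq> r\<^sup>2"
  proof
    assume sphere: "sq_dist n k A C = r\<^sup>2"
    have "gram_loss k n A \<ge> gram_loss k n C + r\<^sup>2 / 512 - 20 / 2 ^ 41 * r"
      using lower unfolding sphere by (simp add: r_def)
    moreover have "r\<^sup>2 / 512 - 20 / 2 ^ 41 * r > 0" by (simp add: r_def power_divide)
    moreover have "gram_loss k n A \<le> gram_loss k n C" by (rule min) (simp add: sq_dist_def)
    ultimately show False by linarith
  qed
  moreover have "gram_loss k n A > 0"
  proof -
    have "sqrt (sq_dist n k A C) \<le> r" using A by (intro real_le_lsqrt) (simp_all add: r_def)
    hence "20 / 2 ^ 41 * sqrt (sq_dist n k A C) \<le> 20 / 2 ^ 41 * r" by (rule mult_left_mono) simp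
    also have "\<dots> < 1 / 1000" by (simp add: r_def)
    finally show ?thesis using lower cert sq_dist_nonneg[of n k A C] unfolding certified_point_def by linarith
  qed
  ultimately show ?thesis using that[of A] A min by (simp add: r_def)
qed

lemma coords_sum_rows:
  assumes "orthonormal_rows k V" "l < k"
  shows "coords k V (\<lambda>j. \<Sum>m<k. a m * V m j) l = a l"
  using assms by (simp add: coords_def dot_sum_left dot_scale_left dot_orthonormal_rows if_distrib cong: if_cong)

lemma sq_dist_coords:
  assumes "orthonormal_rows k V"
  shows "sq_dist n k (\<lambda>i. coords k V (W i)) (\<lambda>i. coords k V (W' i)) = sq_dist n k W W'"
proof -
  have sq_dist_dot: "sq_dist n k A B = (\<Sum>i<n. dot k (\<lambda>j. A i j - B i j) (\<lambda>j. A i j - B i j))" for A B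
    by (simp add: sq_dist_def dot_def power2_eq_square)
  have "(\<lambda>j. coords k V (W i) j - coords k V (W' i) j) = coords k V (\<lambda>j. W i j - W' i j)" for i
    by (simp add: coords_def dot_diff_left)
  thus ?thesis by (simp add: sq_dist_dot parseval[OF assms])
qed

lemma relu_loss_target_network:
  assumes "k \<le> n"
  shows "relu_loss k n V (\<lambda>i j. if i < k then V i j else 0) = 0"
proof -
  have "(\<Sum>i<n. relu (\<Sum>j<k. (if i < k then V i j else 0) * x j)) = (\<Sum>i<k. relu (\<Sum>j<k. V i j * x j))"
    for x :: "nat \<Rightarrow> real"
    using assms by (intro sum.mono_neutral_cong_right) (auto simp: relu_def)
  thus ?thesis by (simp add: relu_loss_def)
qed

lemma spurious_local_min_of_interior_min:
  fixes A C :: "nat \<Rightarrow> nat \<Rightarrow> real"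
  assumes V: "orthonormal_rows k V" and "k \<le> n" and "gram_loss k n A > 0" and interior: "sq_dist n k A C < r\<^sup>2" "0 < r"
    and nonparallel: "\<And>B. sq_dist n k B C \<le> r\<^sup>2 \<Longrightarrow> pairwise_nonparallel k n B"
    and min: "\<And>B. sq_dist n k B C \<le> r\<^sup>2 \<Longrightarrow> gram_loss k n A \<le> gram_loss k n B"
  shows "spurious_local_min n k (relu_loss k n V) (\<lambda>i j. \<Sum>l<k. A i l * V l j)"
proof -
  define W where "W i j = (\<Sum>l<k. A i l * V l j)" for i j
  define coord where "coord W' i = coords k V (W' i)" for W' :: "nat \<Rightarrow> nat \<Rightarrow> real" and i
  have coord_W: "coord W i l = A i l" if "l < k" for i l
    unfolding coord_def W_def[abs_def] by (rule coords_sum_rows[OF V that])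
  have loss: "relu_loss k n V W' = gram_loss k n (coord W') / (2 * pi)" if "sq_dist n k (coord W') C \<le> r\<^sup>2" for W'
    using relu_loss_eq_gram_loss[OF V] nonparallel[OF that] unfolding coord_def[abs_def] by blast
  have sq_dist_W: "sq_dist n k (coord W) B = sq_dist n k A B" "sq_dist n k B (coord W) = sq_dist n k B A" for B
    by (simp_all add: sq_dist_def coord_W)
  have loss_W: "relu_loss k n V W = gram_loss k n A / (2 * pi)"
    using loss[of W] interior(1) gram_loss_cong[of n k "coord W" A] by (simp add: sq_dist_W coord_W)
  define e where "e = r - sqrt (sq_dist n k A C)"
  have "sqrt (sq_dist n k A C) < r" using interior by (intro real_less_lsqrt) simp_all
  hence "e > 0" by (simp add: e_def)
  moreover have "relu_loss k n V W \<le> relu_loss k n V W'" if "(\<Sum>i<n. \<Sum>j<k. (W' i j - W i j)\<^sup>2) < e\<^sup>2" for W'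
  proof -
    have "sq_dist n k (coord W') A = sq_dist n k W' W"
      unfolding sq_dist_W(2)[symmetric] coord_def by (rule sq_dist_coords[OF V])
    hence "sqrt (sq_dist n k (coord W') A) \<le> e" using that \<open>e > 0\<close> by (intro real_le_lsqrt) (simp_all add: sq_dist_def)
    hence "sqrt (sq_dist n k (coord W') C) \<le> r" using sqrt_sq_dist_triangle[of n k "coord W'" C A] by (simp add: e_def)
    hence near: "sq_dist n k (coord W') C \<le> r\<^sup>2" by (rule sqrt_le_D)
    show ?thesis unfolding loss_W loss[OF near] by (intro divide_right_mono min near) simp
  qed
  moreover have "relu_loss k n V (\<lambda>i j. if i < k then V i j else 0) < relu_loss k n V W"
    using \<open>gram_loss k n A > 0\<close> by (simp add: relu_loss_target_network[OF \<open>k \<le> n\<close>] loss_W)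
  ultimately show ?thesis unfolding spurious_local_min_def W_def[abs_def] by blast
qed

theorem certified_point_spurious:
  assumes cert: "certified_point k n C" and size: "n \<le> 20" "k \<le> n" and V: "orthonormal_rows k V"
  shows "\<exists>W. spurious_local_min n k (relu_loss k n V) W"
proof -
  have "k \<le> 20" using size by simp
  obtain A where "gram_loss k n A > 0" "sq_dist n k A C < (1 / 2 ^ 27)\<^sup>2"
    "\<And>B. sq_dist n k B C \<le> (1 / 2 ^ 27)\<^sup>2 \<Longrightarrow> gram_loss k n A \<le> gram_loss k n B"
    by (rule certified_point_local_min[OF cert size(1) \<open>k \<le> 20\<close>]) blast
  hence "spurious_local_min n k (relu_loss k n V) (\<lambda>i j. \<Sum>l<k. A i l * V l j)"
    by (intro spurious_local_min_of_interior_min[OF V size(2)]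
      gram_loss_near_certified_point(1)[OF cert size(1) \<open>k \<le> 20\<close>]) simp_all
  thus ?thesis by blast
qed

section \<open>Points with a block of symmetric rows\<close>

text \<open>Formulas over this class are read both in the reals and in interval arithmetic.\<close>

class arith = comm_monoid_add + minus + uminus + times + inverse + one

instance real :: arith ..

datatype 'a sym_point = Sym_Point (block_size: 'a) (on_diag: 'a) (off_diag: 'a) (last_col: 'a)
  (extra_off: "nat \<Rightarrow> 'a") (extra_last: "nat \<Rightarrow> 'a")

definition sym_matrix :: "nat \<Rightarrow> real sym_point \<Rightarrow> nat \<Rightarrow> nat \<Rightarrow> real" where
  "sym_matrix m X i j = (if i < m then if j = m then last_col X else if j = i then on_diag X else off_diag X
     else if j = m then extra_last X (i - m) else extra_off X (i - m))"

text \<open>One entry for each kind of pair of rows of the matrix, or of a row and a target, up to symmetry.\<close>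

datatype 'p pair_family = Pair_Family (block_block: 'p) (block_target_diag: 'p) (block_target_off: 'p)
  (block_target_last: 'p)
  (extra_block: "nat \<Rightarrow> 'p") (extra_target: "nat \<Rightarrow> 'p") (extra_target_last: "nat \<Rightarrow> 'p") (extra_extra: "nat \<Rightarrow> nat \<Rightarrow> 'p")

definition family_list :: "nat \<Rightarrow> 'p pair_family \<Rightarrow> 'p list" where
  "family_list h F = [block_block F, block_target_diag F, block_target_off F, block_target_last F]
     @ concat (map (\<lambda>r. [extra_block F r, extra_target F r, extra_target_last F r] @ map (extra_extra F r) [0..<r])
       [0..<h])"

definition block_sq_norm :: "'a::arith sym_point \<Rightarrow> 'a" where
  "block_sq_norm X = on_diag X * on_diag X + (block_size X - 1) * (off_diag X * off_diag X) + last_col X * last_col X"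

definition block_inner :: "'a::arith sym_point \<Rightarrow> 'a" where
  "block_inner X = on_diag X * off_diag X + on_diag X * off_diag X + (block_size X - 1 - 1) * (off_diag X * off_diag X)
    + last_col X * last_col X"

definition extra_inner :: "'a::arith sym_point \<Rightarrow> nat \<Rightarrow> nat \<Rightarrow> 'a" where
  "extra_inner X r t = block_size X * (extra_off X r * extra_off X t) + extra_last X r * extra_last X t"

definition extra_block_inner :: "'a::arith sym_point \<Rightarrow> nat \<Rightarrow> 'a" where
  "extra_block_inner X r = extra_off X r * (on_diag X + (block_size X - 1) * off_diag X) + extra_last X r * last_col X"

definition extra_block_gram :: "'a::arith sym_point \<Rightarrow> nat \<Rightarrow> 'a \<times> 'a \<times> 'a" where
  "extra_block_gram X r = (extra_inner X r r, block_sq_norm X, extra_block_inner X r)"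

definition extra_target_gram :: "'a::arith sym_point \<Rightarrow> nat \<Rightarrow> 'a \<times> 'a \<times> 'a" where
  "extra_target_gram X r = (extra_inner X r r, 1, extra_off X r)"

definition extra_target_last_gram :: "'a::arith sym_point \<Rightarrow> nat \<Rightarrow> 'a \<times> 'a \<times> 'a" where
  "extra_target_last_gram X r = (extra_inner X r r, 1, extra_last X r)"

definition extra_extra_gram :: "'a::arith sym_point \<Rightarrow> nat \<Rightarrow> nat \<Rightarrow> 'a \<times> 'a \<times> 'a" where
  "extra_extra_gram X r t = (extra_inner X r r, extra_inner X t t, extra_inner X r t)"

definition gram_family :: "'a::arith sym_point \<Rightarrow> ('a \<times> 'a \<times> 'a) pair_family" where
  "gram_family X = Pair_Family (block_sq_norm X, block_sq_norm X, block_inner X)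
     (block_sq_norm X, 1, on_diag X) (block_sq_norm X, 1, off_diag X) (block_sq_norm X, 1, last_col X)
     (extra_block_gram X) (extra_target_gram X) (extra_target_last_gram X) (extra_extra_gram X)"

lemmas gram_family_simps = gram_family_def extra_block_gram_def extra_target_gram_def extra_target_last_gram_def
  extra_extra_gram_def

datatype 'a pair_values = Pair_Values (left_sq: 'a) (right_sq: 'a) (inner_value: 'a) (area_value: 'a) (angle_value: 'a)

definition kernel_value :: "'a::arith pair_values \<Rightarrow> 'a" where
  "kernel_value v = area_value v + inner_value v * angle_value v"

definition arc_values :: "real \<times> real \<times> real \<Rightarrow> real pair_values" where
  "arc_values = (\<lambda>(p, q, s). Pair_Values p q s (area p q s) (supp_angle p q s))"

definition arc_family :: "real sym_point \<Rightarrow> real pair_values pair_family" where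
  "arc_family X = map_pair_family arc_values (gram_family X)"

definition block_multiplier :: "nat \<Rightarrow> 'a::arith \<Rightarrow> 'a sym_point \<Rightarrow> 'a pair_values pair_family \<Rightarrow> 'a" where
  "block_multiplier h \<pi> X K = \<pi> + ((block_size X - 1) * area_value (block_block K)
    + (\<Sum>r\<leftarrow>[0..<h]. area_value (extra_block K r))
     - (area_value (block_target_diag K) + (block_size X - 1) * area_value (block_target_off K)
       + area_value (block_target_last K)))
     / left_sq (block_block K)"

definition extra_multiplier :: "nat \<Rightarrow> 'a::arith \<Rightarrow> 'a sym_point \<Rightarrow> 'a pair_values pair_family \<Rightarrow> nat \<Rightarrow> 'a" where
  "extra_multiplier h \<pi> X K r = \<pi> + (block_size X * area_value (extra_block K r)
     + (\<Sum>t\<leftarrow>filter (\<lambda>t. t \<noteq> r) [0..<h]. area_value (extra_extra K r t))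
     - (block_size X * area_value (extra_target K r) + area_value (extra_target_last K r))) / left_sq (extra_block K r)"

definition block_gradient :: "nat \<Rightarrow> 'a::arith \<Rightarrow> 'a sym_point \<Rightarrow> 'a pair_values pair_family \<Rightarrow> 'a list" where
  "block_gradient h \<pi> X K = (let \<kappa> = block_multiplier h \<pi> X K; \<theta> = angle_value (block_block K);
       off_sum = (\<Sum>r\<leftarrow>[0..<h]. angle_value (extra_block K r) * extra_off X r);
       last_sum = (\<Sum>r\<leftarrow>[0..<h]. angle_value (extra_block K r) * extra_last X r) in
     [\<kappa> * on_diag X + \<theta> * ((block_size X - 1) * off_diag X) + off_sum - angle_value (block_target_diag K),
      \<kappa> * off_diag X + \<theta> * (on_diag X + (block_size X - 1 - 1) * off_diag X) + off_sum
        - angle_value (block_target_off K),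
      \<kappa> * last_col X + \<theta> * ((block_size X - 1) * last_col X) + last_sum - angle_value (block_target_last K)])"

definition extra_gradient :: "nat \<Rightarrow> 'a::arith \<Rightarrow> 'a sym_point \<Rightarrow> 'a pair_values pair_family \<Rightarrow> nat \<Rightarrow> 'a list" where
  "extra_gradient h \<pi> X K r = (let \<kappa> = extra_multiplier h \<pi> X K r; \<theta> = angle_value (extra_block K r) in
     [\<kappa> * extra_off X r + \<theta> * (on_diag X + (block_size X - 1) * off_diag X)
        + (\<Sum>t\<leftarrow>filter (\<lambda>t. t \<noteq> r) [0..<h]. angle_value (extra_extra K r t) * extra_off X t)
          - angle_value (extra_target K r),
      \<kappa> * extra_last X r + \<theta> * (block_size X * last_col X)
        + (\<Sum>t\<leftarrow>filter (\<lambda>t. t \<noteq> r) [0..<h]. angle_value (extra_extra K r t) * extra_last X t)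
          - angle_value (extra_target_last K r)])"

definition sym_gradient :: "nat \<Rightarrow> 'a::arith \<Rightarrow> 'a sym_point \<Rightarrow> 'a pair_values pair_family \<Rightarrow> 'a list" where
  "sym_gradient h \<pi> X K = block_gradient h \<pi> X K @ concat (map (extra_gradient h \<pi> X K) [0..<h])"

definition sym_loss :: "nat \<Rightarrow> 'a::arith \<Rightarrow> 'a sym_point \<Rightarrow> 'a pair_values pair_family \<Rightarrow> 'a" where
  "sym_loss h \<pi> X K = (let m = block_size X; half = inverse (1 + 1) in
     half * (m * (m - 1)) * kernel_value (block_block K)
     + (\<Sum>r\<leftarrow>[0..<h]. m * kernel_value (extra_block K r) + (\<Sum>t\<leftarrow>[0..<r]. kernel_value (extra_extra K r t)))
     + half * \<pi> * (m * left_sq (block_block K) + (\<Sum>r\<leftarrow>[0..<h]. left_sq (extra_block K r)))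
     - (m * (kernel_value (block_target_diag K) + (m - 1) * kernel_value (block_target_off K)
       + kernel_value (block_target_last K))
        + (\<Sum>r\<leftarrow>[0..<h]. m * kernel_value (extra_target K r) + kernel_value (extra_target_last K r)))
     + half * ((m + 1) * \<pi> + (m + 1) * m))"

lemma sum_if_eq_diff:
  fixes x y :: real and f :: "nat \<Rightarrow> real"
  shows "i < m \<Longrightarrow> (\<Sum>j<m. (if j = i then x else y) * f j) = (x - y) * f i + y * (\<Sum>j<m. f j)"
  by (simp add: if_distrib[of "\<lambda>x. x * _"] sum.If_cases Int_absorb1 sum_diff1 sum_distrib_left[symmetric]
    left_diff_distrib right_diff_distrib
      flip: Diff_eq cong: if_cong)

lemma sum_lessThan_add:
  fixes f :: "nat \<Rightarrow> 'a::comm_monoid_add"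
  shows "(\<Sum>i<m + h. f i) = (\<Sum>i<m. f i) + (\<Sum>r<h. f (m + r))"
  by (induction h) (simp_all add: add.assoc)

lemma sum_upt_list: "(\<Sum>r\<leftarrow>[0..<h]. f r) = (\<Sum>r<h. f r)"
  by (simp add: interv_sum_list_conv_sum_set_nat atLeast0LessThan)

lemma sum_upt_list_neq: "(\<Sum>t\<leftarrow>filter (\<lambda>t. t \<noteq> r) [0..<h]. f t) = (\<Sum>t\<in>{..<h} - {r}. f t)"
  by (simp add: sum_list_distinct_conv_sum_set) (rule sum.cong, auto)

lemma kernel_value_arc_values: "kernel_value (arc_values (p, q, s)) = arc_kernel p q s"
  by (simp add: kernel_value_def arc_values_def arc_kernel_def)

lemma axis_vec_same [simp]: "axis_vec j j = 1"
  by (simp add: axis_vec_def)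

lemma relu_kernel_axis: "j < k \<Longrightarrow> relu_kernel k x (axis_vec j) = arc_kernel (dot k x x) 1 (x j)"
  by (simp add: relu_kernel_def dot_axis_right)

locale symmetric_point =
  fixes m h :: nat and X :: "real sym_point"
  assumes size: "2 < m" "block_size X = real m"
begin

abbreviation "a \<equiv> on_diag X"
abbreviation "b \<equiv> off_diag X"
abbreviation "c \<equiv> last_col X"
abbreviation "\<delta> \<equiv> extra_off X"
abbreviation "\<gamma> \<equiv> extra_last X"
abbreviation "C \<equiv> sym_matrix m X"
abbreviation "k \<equiv> Suc m"
abbreviation "n \<equiv> m + h"
abbreviation "K \<equiv> arc_family X"

lemma entry_block: "i < m \<Longrightarrow> C i j = (if j = m then c else if j = i then a else b)"
  by (simp add: sym_matrix_def)

lemma entry_extra: "C (m + r) j = (if j = m then \<gamma> r else \<delta> r)"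
  by (simp add: sym_matrix_def)

lemma dot_block: "i < m \<Longrightarrow> dot k (C i) y = (a - b) * y i + b * (\<Sum>j<m. y j) + c * y m"
  using sum_if_eq_diff[of i m a b y] by (simp add: dot_def entry_block)

lemma dot_extra: "dot k (C (m + r)) y = \<delta> r * (\<Sum>j<m. y j) + \<gamma> r * y m"
  by (simp add: dot_def entry_extra sum_distrib_left)

lemma sum_entries_block: "i < m \<Longrightarrow> (\<Sum>j<m. C i j) = a + (real m - 1) * b"
  using sum_if_eq_diff[of i m a b "\<lambda>_. 1"] by (simp add: entry_block algebra_simps)

lemma sum_entries_extra: "(\<Sum>j<m. C (m + r) j) = real m * \<delta> r"
  by (simp add: entry_extra)

lemma gram_block: "i < m \<Longrightarrow> dot k (C i) (C i) = block_sq_norm X"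
  by (simp add: dot_block sum_entries_block) (simp add: entry_block block_sq_norm_def size algebra_simps)

lemma gram_block_block: "i < m \<Longrightarrow> j < m \<Longrightarrow> i \<noteq> j \<Longrightarrow> dot k (C i) (C j) = block_inner X"
  by (simp add: dot_block sum_entries_block) (simp add: entry_block block_inner_def size algebra_simps)

lemma gram_extra_block: "j < m \<Longrightarrow> dot k (C (m + r)) (C j) = extra_block_inner X r"
  by (simp add: dot_extra sum_entries_block) (simp add: entry_block extra_block_inner_def size)

lemma gram_block_extra: "j < m \<Longrightarrow> dot k (C j) (C (m + r)) = extra_block_inner X r"
  using gram_extra_block by (simp add: dot_commute)

lemma gram_extra: "dot k (C (m + r)) (C (m + t)) = extra_inner X r t"
  by (simp add: dot_extra sum_entries_extra) (simp add: entry_extra extra_inner_def size)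

lemmas gram = gram_block gram_block_block gram_extra_block gram_block_extra gram_extra

lemma arc_family_simps:
  "block_block K = arc_values (block_sq_norm X, block_sq_norm X, block_inner X)"
  "block_target_diag K = arc_values (block_sq_norm X, 1, a)"
  "block_target_off K = arc_values (block_sq_norm X, 1, b)"
  "block_target_last K = arc_values (block_sq_norm X, 1, c)"
  "extra_block K r = arc_values (extra_inner X r r, block_sq_norm X, extra_block_inner X r)"
  "extra_target K r = arc_values (extra_inner X r r, 1, \<delta> r)"
  "extra_target_last K r = arc_values (extra_inner X r r, 1, \<gamma> r)"
  "extra_extra K r t = arc_values (extra_inner X r r, extra_inner X t t, extra_inner X r t)"
  by (simp_all add: arc_family_def gram_family_simps)

lemma sum_other_rows_block:
  fixes f :: "nat \<Rightarrow> real"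
  shows "i < m \<Longrightarrow> (\<Sum>j\<in>{..<n} - {i}. f j) = (\<Sum>j\<in>{..<m} - {i}. f j) + (\<Sum>r<h. f (m + r))"
  by (simp add: sum_diff1 sum_lessThan_add)

lemma sum_other_rows_extra:
  fixes f :: "nat \<Rightarrow> real"
  shows "r < h \<Longrightarrow> (\<Sum>j\<in>{..<n} - {m + r}. f j) = (\<Sum>j<m. f j) + (\<Sum>t\<in>{..<h} - {r}. f (m + t))"
  by (simp add: sum_diff1 sum_lessThan_add)

lemma sum_off_block_column:
  assumes "i < m" "l < k"
  shows "(\<Sum>j\<in>{..<m} - {i}. C j l)
    = (if l = m then (real m - 1) * c else if l = i then (real m - 1) * b else a + (real m - 2) * b)"
proof (cases "l = m")
  case False
  hence "(\<Sum>j<m. C j l) = (\<Sum>j<m. C l j)" using assms by (intro sum.cong refl) (simp add: entry_block)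
  also have "\<dots> = a + (real m - 1) * b" using assms False by (intro sum_entries_block) simp
  finally have "(\<Sum>j<m. C j l) = a + (real m - 1) * b" .
  thus ?thesis using assms False by (simp add: sum_diff1) (simp add: entry_block algebra_simps)
qed (use assms in \<open>simp add: sum_diff1 entry_block algebra_simps\<close>)

lemma sum_block_targets:
  fixes f :: "real \<Rightarrow> real"
  assumes "i < m"
  shows "(\<Sum>j<k. f (C i j)) = f a + (real m - 1) * f b + f c"
proof -
  have "(\<Sum>j<m. f (C i j)) = (\<Sum>j<m. (if j = i then f a else f b) * 1)"
    using assms by (intro sum.cong refl) (simp add: entry_block)
  also have "\<dots> = f a + (real m - 1) * f b"
    using sum_if_eq_diff[OF assms, of "f a" "f b" "\<lambda>_. 1"] by (simp add: algebra_simps)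
  finally show ?thesis using assms by (simp add: entry_block)
qed

lemma sum_extra_targets:
  fixes f :: "real \<Rightarrow> real"
  shows "(\<Sum>j<k. f (C (m + r) j)) = real m * f (\<delta> r) + f (\<gamma> r)"
  by (simp add: entry_extra)

lemma gram_multiplier_block: "i < m \<Longrightarrow> gram_multiplier k n C i = block_multiplier h pi X K"
  unfolding gram_multiplier_def block_multiplier_def sum_other_rows_block sum_block_targets
  by (simp add: gram arc_family_simps arc_values_def sum_upt_list size
    area_commute[of "block_sq_norm X" "extra_inner X _ _"])

lemma gram_multiplier_extra: "r < h \<Longrightarrow> gram_multiplier k n C (m + r) = extra_multiplier h pi X K r"
  unfolding gram_multiplier_def extra_multiplier_def sum_other_rows_extra sum_extra_targets
  by (simp add: gram arc_family_simps arc_values_def sum_upt_list_neq size)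

lemma gram_gradient_block:
  assumes "i < m" "l < k"
  shows "gram_gradient k n C i l \<in> set (block_gradient h pi X K)"
proof -
  have row: "gram_gradient k n C i l = block_multiplier h pi X K * C i l + (angle_value (block_block K)
      * (if l = m then (real m - 1) * c else if l = i then (real m - 1) * b else a + (real m - 2) * b)
      + (\<Sum>r<h. angle_value (extra_block K r) * C (m + r) l)) - supp_angle (block_sq_norm X) 1 (C i l)"
    using assms(1) unfolding gram_gradient_def gram_multiplier_block[OF assms(1)] sum_other_rows_block[OF assms(1)]
      sum_off_block_column[OF assms, symmetric]
    by (simp add: gram arc_family_simps arc_values_def supp_angle_commute[of "block_sq_norm X" "extra_inner X _ _"]
      sum_distrib_left)
  consider "l = i" | "l \<noteq> i" "l < m" | "l = m" using assms(2) by linarith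
  thus ?thesis
    unfolding row using assms by cases (simp_all add: entry_block entry_extra block_gradient_def Let_def
      arc_family_simps arc_values_def sum_upt_list size)
qed

lemma gram_gradient_extra:
  assumes "r < h" "l < k"
  shows "gram_gradient k n C (m + r) l \<in> set (extra_gradient h pi X K r)"
proof -
  have column: "(\<Sum>j<m. C j l) = (if l = m then real m * c else a + (real m - 1) * b)"
  proof (cases "l = m")
    case False
    hence "(\<Sum>j<m. C j l) = (\<Sum>j<m. C l j)" using assms by (intro sum.cong refl) (simp add: entry_block)
    thus ?thesis using sum_entries_block[of l] assms False by simp
  qed (simp add: entry_block)
  have row: "gram_gradient k n C (m + r) l = extra_multiplier h pi X K r * C (m + r) l + (angle_value (extra_block K r)
      * (if l = m then real m * c else a + (real m - 1) * b)
      + (\<Sum>t\<in>{..<h} - {r}. angle_value (extra_extra K r t) * C (m + t) l))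
        - supp_angle (extra_inner X r r) 1 (C (m + r) l)"
    unfolding gram_gradient_def gram_multiplier_extra[OF assms(1)] sum_other_rows_extra[OF assms(1)] column[symmetric]
    by (simp add: gram arc_family_simps arc_values_def sum_distrib_left)
  show ?thesis
    unfolding row using assms(2) by (cases "l = m")
      (simp_all add: entry_extra extra_gradient_def Let_def arc_family_simps arc_values_def sum_upt_list_neq size)
qed

lemma row_cases:
  assumes "i < n"
  obtains (block) "i < m" | (extra) r where "i = m + r" "r < h"
  using assms by (metis add_less_cancel_left le_iff_add not_less)

lemma abs_gram_gradient_le:
  assumes "\<forall>g \<in> set (sym_gradient h pi X K). \<bar>g\<bar> \<le> \<epsilon>" "i < n" "l < k"
  shows "\<bar>gram_gradient k n C i l\<bar> \<le> \<epsilon>"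
proof -
  from \<open>i < n\<close> have "gram_gradient k n C i l \<in> set (sym_gradient h pi X K)"
  proof (cases rule: row_cases)
    case block
    thus ?thesis using gram_gradient_block assms(3) by (simp add: sym_gradient_def)
  next
    case (extra r)
    thus ?thesis using gram_gradient_extra[of r l] assms(3) by (auto simp: sym_gradient_def)
  qed
  thus ?thesis using assms(1) by blast
qed

lemma sum_pairs_split:
  fixes f :: "nat \<Rightarrow> nat \<Rightarrow> real"
  shows "(\<Sum>i<n. \<Sum>j<i. f i j) = (\<Sum>i<m. \<Sum>j<i. f i j) + (\<Sum>r<h. (\<Sum>j<m. f (m + r) j) + (\<Sum>t<r. f (m + r) (m + t)))"
  by (simp add: sum_lessThan_add)

lemma relu_kernel_rows:
  "i < m \<Longrightarrow> j < m \<Longrightarrow> i \<noteq> j \<Longrightarrow> relu_kernel k (C i) (C j) = kernel_value (block_block K)"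
  "j < m \<Longrightarrow> relu_kernel k (C (m + r)) (C j) = kernel_value (extra_block K r)"
  "relu_kernel k (C (m + r)) (C (m + t)) = kernel_value (extra_extra K r t)"
  by (simp_all add: relu_kernel_def gram arc_family_simps kernel_value_arc_values)

lemma sum_relu_kernel_targets:
  "i < m \<Longrightarrow> (\<Sum>j<k. relu_kernel k (C i) (axis_vec j))
    = kernel_value (block_target_diag K) + (real m - 1) * kernel_value (block_target_off K)
      + kernel_value (block_target_last K)"
  "(\<Sum>j<k. relu_kernel k (C (m + r)) (axis_vec j)) = real m * kernel_value (extra_target K r)
    + kernel_value (extra_target_last K r)"
  using sum_block_targets[of i "arc_kernel (block_sq_norm X) 1"]
    sum_extra_targets[of "arc_kernel (extra_inner X r r) 1" r]
  by (simp_all add: relu_kernel_axis gram arc_family_simps kernel_value_arc_values del: sum.lessThan_Suc)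

lemma gram_loss_sym_matrix: "gram_loss k n C = sym_loss h pi X K"
proof -
  have "(\<Sum>i<m. \<Sum>j<i. relu_kernel k (C i) (C j)) = (\<Sum>i<m. real i * kernel_value (block_block K))"
    by (intro sum.cong refl) (simp add: relu_kernel_rows)
  moreover have "(\<Sum>i<m. real i) = real m * (real m - 1) / 2" by (induction m) (simp_all add: field_simps)
  ultimately have pairs: "(\<Sum>i<m. \<Sum>j<i. relu_kernel k (C i) (C j))
    = real m * (real m - 1) / 2 * kernel_value (block_block K)"
    by (simp flip: sum_distrib_right)
  show ?thesis
    unfolding gram_loss_def sum_pairs_split pairs sum_lessThan_add
    by (simp add: relu_kernel_rows sum_relu_kernel_targets sym_loss_def Let_def sum_upt_list size gram del:
      sum.lessThan_Suc)
      (simp add: arc_family_simps arc_values_def algebra_simps add_divide_distrib)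
qed

lemma well_conditioned_point_sym_matrix:
  assumes "list_all well_conditioned_gram (family_list h (gram_family X))"
  shows "well_conditioned_point k n C"
proof -
  note family = assms[unfolded list_all_iff]
  have pairs: "well_conditioned k (C i) (C j)" if "i < n" "j < i" for i j
    using \<open>i < n\<close>
  proof (cases rule: row_cases)
    case block
    thus ?thesis using family that by (simp add: well_conditioned_def gram family_list_def gram_family_simps)
  next
    case (extra r)
    from that have "j < n" by simp
    thus ?thesis using family that extra by (cases rule: row_cases)
      (auto simp: well_conditioned_def gram family_list_def gram_family_simps)
  qed
  have targets: "well_conditioned k (C i) (axis_vec j)" if "i < n" "j < k" for i j
    using \<open>i < n\<close>
  proof (cases rule: row_cases)
    case block
    thus ?thesis using family that by (auto simp: well_conditioned_def gram dot_axis_right entry_block family_list_def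
      gram_family_simps)
  next
    case (extra r)
    thus ?thesis using family that by (auto simp: well_conditioned_def gram dot_axis_right entry_extra family_list_def
      gram_family_simps)
  qed
  show ?thesis unfolding well_conditioned_point_def using pairs targets by blast
qed

end

section \<open>The Hessian at a symmetric point\<close>

definition relu_kernel_coupling :: "nat \<Rightarrow> (nat \<Rightarrow> real) \<Rightarrow> (nat \<Rightarrow> real) \<Rightarrow> (nat \<Rightarrow> real) \<Rightarrow> (nat \<Rightarrow> real) \<Rightarrow> real" where
  "relu_kernel_coupling k x y d e =
     2 * area (dot k x x) (dot k y y) (dot k x y) * (dot k x d / dot k x x * (dot k y e / dot k y y))
     + (dot k x e + dot k y d - dot k x y * (dot k x d / dot k x x + dot k y e / dot k y y))\<^sup>2
         / area (dot k x x) (dot k y y) (dot k x y)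
     + 2 * supp_angle (dot k x x) (dot k y y) (dot k x y) * dot k d e"

lemma relu_kernel_hessian_eq: "relu_kernel_hessian k x y d e =
    area (dot k x x) (dot k y y) (dot k x y) / dot k x x * (dot k d d - (dot k x d)\<^sup>2 / dot k x x)
    + area (dot k y y) (dot k x x) (dot k y x) / dot k y y * (dot k e e - (dot k y e)\<^sup>2 / dot k y y)
    + relu_kernel_coupling k x y d e"
  by (simp add: relu_kernel_hessian_def relu_kernel_coupling_def area_commute[of "dot k y y"] dot_commute[of k y x]
    power2_diff
    power_divide power2_eq_square algebra_simps)

lemma relu_kernel_hessian_axis:
  assumes "j < k"
  shows "relu_kernel_hessian k x (axis_vec j) d (\<lambda>_. 0) =
    area (dot k x x) 1 (x j) / dot k x x * (dot k d d - (dot k x d)\<^sup>2 / dot k x x)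
    + (d j - x j * (dot k x d / dot k x x))\<^sup>2 / area (dot k x x) 1 (x j)"
  using assms by (simp add: relu_kernel_hessian_def dot_axis_right dot_axis_left dot_zero_right power_divide
    power2_eq_square algebra_simps)

lemma gram_hessian_form_eq: "gram_hessian_form k n C d =
    (\<Sum>i<n. gram_multiplier k n C i * dot k (d i) (d i)
       - (gram_multiplier k n C i - pi) / dot k (C i) (C i) * (dot k (C i) (d i))\<^sup>2)
    + (\<Sum>i<n. \<Sum>j<i. relu_kernel_coupling k (C i) (C j) (d i) (d j))
    - (\<Sum>i<n. \<Sum>j<k. (d i j - C i j * (dot k (C i) (d i) / dot k (C i) (C i)))\<^sup>2 / area (dot k (C i) (C i)) 1 (C i j))"
proof -
  define u where "u i = dot k (d i) (d i) - (dot k (C i) (d i))\<^sup>2 / dot k (C i) (C i)" for i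
  define a where "a i j = area (dot k (C i) (C i)) (dot k (C j) (C j)) (dot k (C i) (C j)) / dot k (C i) (C i)" for i j
  define a' where "a' i j = area (dot k (C i) (C i)) 1 (C i j) / dot k (C i) (C i)" for i j
  have "(\<Sum>i<n. \<Sum>j<i. relu_kernel_hessian k (C i) (C j) (d i) (d j))
      = (\<Sum>i<n. \<Sum>j<i. a i j * u i + a j i * u j) + (\<Sum>i<n. \<Sum>j<i. relu_kernel_coupling k (C i) (C j) (d i) (d j))"
    by (simp add: relu_kernel_hessian_eq u_def a_def sum.distrib)
  moreover have "(\<Sum>i<n. \<Sum>j<i. a i j * u i + a j i * u j) = (\<Sum>i<n. (\<Sum>j\<in>{..<n} - {i}. a i j) * u i)"
    by (simp add: sum_lower_triangle_both[of "\<lambda>i j. a i j * u i"] sum_distrib_right)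
  moreover have "(\<Sum>i<n. \<Sum>j<k. relu_kernel_hessian k (C i) (axis_vec j) (d i) (\<lambda>_. 0)) = (\<Sum>i<n. (\<Sum>j<k. a' i j) * u i)
      + (\<Sum>i<n. \<Sum>j<k. (d i j - C i j * (dot k (C i) (d i) / dot k (C i) (C i)))\<^sup>2 / area (dot k (C i) (C i)) 1 (C i j))"
    by (simp add: relu_kernel_hessian_axis u_def a'_def sum.distrib sum_distrib_right)
  moreover have "gram_multiplier k n C i * dot k (d i) (d i) - (gram_multiplier k n C i - pi) / dot k (C i) (C i) *
    (dot k (C i) (d i))\<^sup>2
      = (\<Sum>j\<in>{..<n} - {i}. a i j) * u i + pi * dot k (d i) (d i) - (\<Sum>j<k. a' i j) * u i" for i
  proof -
    have multiplier: "gram_multiplier k n C i = pi + (\<Sum>j\<in>{..<n} - {i}. a i j) - (\<Sum>j<k. a' i j)"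
      by (simp add: gram_multiplier_def a_def a'_def sum_divide_distrib[symmetric] diff_divide_distrib)
    show ?thesis unfolding multiplier u_def by (simp add: algebra_simps diff_divide_distrib)
  qed
  ultimately show ?thesis
    unfolding gram_hessian_form_def by (simp add: sum.distrib sum_subtractf sum_distrib_left)
qed

lemma sum_lower_triangle_symmetric:
  fixes f :: "nat \<Rightarrow> nat \<Rightarrow> real"
  assumes "\<And>i j. f i j = f j i"
  shows "(\<Sum>i<m. \<Sum>j<i. f i j) = ((\<Sum>i<m. \<Sum>j<m. f i j) - (\<Sum>i<m. f i i)) / 2"
  using sum_symmetric_pairs[of m f] assms by simp

lemma sum_lower_triangle_product:
  fixes u :: "nat \<Rightarrow> real"
  shows "(\<Sum>i<m. \<Sum>j<i. u i * u j) = ((\<Sum>i<m. u i)\<^sup>2 - (\<Sum>i<m. (u i)\<^sup>2)) / 2"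
  by (subst sum_lower_triangle_symmetric) (simp_all add: power2_eq_square sum_product)

lemma sum_lower_triangle_dot:
  fixes d :: "nat \<Rightarrow> nat \<Rightarrow> real"
  shows "(\<Sum>i<m. \<Sum>j<i. dot k (d i) (d j)) = ((\<Sum>l<k. (\<Sum>i<m. d i l)\<^sup>2) - (\<Sum>i<m. dot k (d i) (d i))) / 2"
proof -
  have "(\<Sum>i<m. \<Sum>j<i. dot k (d i) (d j)) = (\<Sum>l<k. \<Sum>i<m. \<Sum>j<i. d i l * d j l)"
    unfolding dot_def by (subst (2) sum.swap, subst sum.swap) simp
  also have "\<dots> = ((\<Sum>l<k. (\<Sum>i<m. d i l)\<^sup>2) - (\<Sum>l<k. \<Sum>i<m. (d i l)\<^sup>2)) / 2"
    by (simp add: sum_lower_triangle_product sum_subtractf flip: sum_divide_distrib)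
  also have "(\<Sum>l<k. \<Sum>i<m. (d i l)\<^sup>2) = (\<Sum>i<m. dot k (d i) (d i))"
    unfolding dot_def by (subst sum.swap) (simp add: power2_eq_square)
  finally show ?thesis .
qed

lemma sum_off_row_add:
  fixes Z :: "nat \<Rightarrow> nat \<Rightarrow> real"
  shows "i < m \<Longrightarrow> (\<Sum>j\<in>{..<m} - {i}. Z i j + Z j i) = (\<Sum>j<m. Z i j) + (\<Sum>j<m. Z j i) - 2 * Z i i"
  by (simp add: sum_diff1 sum.distrib)

lemma sum_lower_triangle_square:
  fixes Z :: "nat \<Rightarrow> nat \<Rightarrow> real" and u :: "nat \<Rightarrow> real" and s :: real
  shows "(\<Sum>i<m. \<Sum>j<i. (s * (Z i j + Z j i) + u i + u j)\<^sup>2)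
    = s\<^sup>2 * (\<Sum>i<m. \<Sum>j<i. (Z i j + Z j i)\<^sup>2)
      + 2 * s * (\<Sum>i<m. u i * ((\<Sum>j<m. Z i j) + (\<Sum>j<m. Z j i) - 2 * Z i i))
      + (real m - 2) * (\<Sum>i<m. (u i)\<^sup>2) + (\<Sum>i<m. u i)\<^sup>2"
proof -
  have "(\<Sum>i<m. \<Sum>j<i. u i * (Z i j + Z j i) + u j * (Z j i + Z i j)) = (\<Sum>i<m. \<Sum>j\<in>{..<m} - {i}. u i * (Z i j + Z j i))"
    by (rule sum_lower_triangle_both)
  also have "\<dots> = (\<Sum>i<m. u i * ((\<Sum>j<m. Z i j) + (\<Sum>j<m. Z j i) - 2 * Z i i))"
    by (intro sum.cong refl) (simp add: sum_off_row_add flip: sum_distrib_left)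
  finally have mixed: "(\<Sum>i<m. \<Sum>j<i. u i * (Z i j + Z j i) + u j * (Z j i + Z i j))
      = (\<Sum>i<m. u i * ((\<Sum>j<m. Z i j) + (\<Sum>j<m. Z j i) - 2 * Z i i))" .
  have "(\<Sum>i<m. \<Sum>j<i. (s * (Z i j + Z j i) + u i + u j)\<^sup>2) = (\<Sum>i<m. \<Sum>j<i. s\<^sup>2 * (Z i j + Z j i)\<^sup>2
      + 2 * s * (u i * (Z i j + Z j i) + u j * (Z j i + Z i j)) + ((u i)\<^sup>2 + (u j)\<^sup>2) + 2 * (u i * u j))"
    by (intro sum.cong refl) (simp add: power2_eq_square algebra_simps)
  also have "\<dots> = s\<^sup>2 * (\<Sum>i<m. \<Sum>j<i. (Z i j + Z j i)\<^sup>2)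
      + 2 * s * (\<Sum>i<m. \<Sum>j<i. u i * (Z i j + Z j i) + u j * (Z j i + Z i j))
      + (\<Sum>i<m. \<Sum>j<i. (u i)\<^sup>2 + (u j)\<^sup>2) + 2 * (\<Sum>i<m. \<Sum>j<i. u i * u j)"
    by (simp only: sum.distrib sum_distrib_left[symmetric])
  finally show ?thesis
    unfolding mixed sum_lower_triangle_add sum_lower_triangle_product by (simp add: algebra_simps diff_divide_distrib)
qed

lemma sum_lower_triangle_diff_square:
  fixes u :: "nat \<Rightarrow> real"
  shows "(\<Sum>i<m. \<Sum>j<i. (u i - u j)\<^sup>2) = real m * (\<Sum>i<m. (u i)\<^sup>2) - (\<Sum>i<m. u i)\<^sup>2"
proof -
  have "(\<Sum>i<m. \<Sum>j<i. (u i - u j)\<^sup>2) = (\<Sum>i<m. \<Sum>j<i. (u i)\<^sup>2 + (u j)\<^sup>2) - 2 * (\<Sum>i<m. \<Sum>j<i. u i * u j)"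
    by (simp add: power2_diff sum_subtractf sum_distrib_left mult.assoc)
  thus ?thesis unfolding sum_lower_triangle_add sum_lower_triangle_product by (simp add: field_simps)
qed

lemma sum_symmetric_square_lower:
  fixes Z :: "nat \<Rightarrow> nat \<Rightarrow> real" and m :: nat
  defines "g \<equiv> \<lambda>i. (\<Sum>j<m. Z i j) + (\<Sum>j<m. Z j i) - 2 * Z i i"
  assumes m: "2 < m"
  shows "(\<Sum>i<m. (g i)\<^sup>2) / (real m - 2) - (\<Sum>i<m. g i)\<^sup>2 / (2 * (real m - 1) * (real m - 2))
    \<le> (\<Sum>i<m. \<Sum>j<i. (Z i j + Z j i)\<^sup>2)"
proof -
  define \<mu> where "\<mu> = (\<Sum>i<m. g i) / (2 * (real m - 1))"
  define u where "u i = (g i - \<mu>) / (real m - 2)" for i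
  have size: "real m - 2 > 0" "real m - 1 > 0" using m by auto
  have off_row: "(\<Sum>j<m. Z i j) + (\<Sum>j<m. Z j i) - 2 * Z i i = g i" for i by (simp add: g_def)
  have "(\<Sum>i<m. u i) = ((\<Sum>i<m. g i) - real m * \<mu>) / (real m - 2)"
    by (simp add: u_def sum_subtractf flip: sum_divide_distrib)
  also have "(\<Sum>i<m. g i) - real m * \<mu> = \<mu> * (real m - 2)" using size by (simp add: \<mu>_def field_simps)
  finally have mean: "(\<Sum>i<m. u i) = \<mu>" using size by simp
  have "(real m - 2) * (u i)\<^sup>2 = u i * g i - \<mu> * u i" for i
  proof -
    have "(real m - 2) * u i = g i - \<mu>" using size by (simp add: u_def)
    thus ?thesis by (metis mult.assoc mult.commute power2_eq_square right_diff_distrib)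
  qed
  hence squares: "(real m - 2) * (\<Sum>i<m. (u i)\<^sup>2) = (\<Sum>i<m. u i * g i) - \<mu>\<^sup>2"
    by (simp add: sum_distrib_left sum_subtractf mean power2_eq_square flip: sum_distrib_left[of \<mu>])
  have "0 \<le> (\<Sum>i<m. \<Sum>j<i. (1 * (Z i j + Z j i) + (- u i) + (- u j))\<^sup>2)" by (intro sum_nonneg) simp
  hence "(\<Sum>i<m. u i * g i) \<le> (\<Sum>i<m. \<Sum>j<i. (Z i j + Z j i)\<^sup>2)"
    unfolding sum_lower_triangle_square off_row by (simp add: sum_negf mean squares)
  also have "(\<Sum>i<m. u i * g i) = ((\<Sum>i<m. (g i)\<^sup>2) - \<mu> * (\<Sum>i<m. g i)) / (real m - 2)"
    unfolding sum_distrib_left sum_subtractf[symmetric] sum_divide_distrib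
    by (intro sum.cong refl) (simp add: u_def power2_eq_square left_diff_distrib)
  finally show ?thesis by (simp add: \<mu>_def power2_eq_square diff_divide_distrib)
qed

lemma sum_antisymmetric_square_lower:
  fixes Z :: "nat \<Rightarrow> nat \<Rightarrow> real"
  assumes m: "0 < m"
  shows "(\<Sum>i<m. ((\<Sum>j<m. Z i j) - (\<Sum>j<m. Z j i))\<^sup>2) / real m \<le> (\<Sum>i<m. \<Sum>j<i. (Z i j - Z j i)\<^sup>2)"
proof -
  define u where "u i = (\<Sum>j<m. Z i j) - (\<Sum>j<m. Z j i)" for i
  have mean: "(\<Sum>i<m. u i) = 0"
    unfolding u_def sum_subtractf by (subst (2) sum.swap) simp
  have "(\<Sum>i<m. \<Sum>j<i. u i * (Z i j - Z j i) + u j * (Z j i - Z i j)) = (\<Sum>i<m. \<Sum>j\<in>{..<m} - {i}. u i * (Z i j - Z j i))"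
    by (rule sum_lower_triangle_both)
  also have "\<dots> = (\<Sum>i<m. (u i)\<^sup>2)"
    by (intro sum.cong refl) (simp add: sum_diff1 sum_subtractf u_def power2_eq_square flip: sum_distrib_left)
  finally have mixed: "(\<Sum>i<m. \<Sum>j<i. u i * (Z i j - Z j i) + u j * (Z j i - Z i j)) = (\<Sum>i<m. (u i)\<^sup>2)" .
  have square: "(z - w / real m)\<^sup>2 = z\<^sup>2 - 2 / real m * (w * z) + 1 / (real m)\<^sup>2 * w\<^sup>2" for z w :: real
    by (simp add: power2_diff power_divide)
  have "0 \<le> (\<Sum>i<m. \<Sum>j<i. ((Z i j - Z j i) - (u i - u j) / real m)\<^sup>2)" by (intro sum_nonneg) simp
  also have "\<dots> = (\<Sum>i<m. \<Sum>j<i. (Z i j - Z j i)\<^sup>2 - 2 / real m * (u i * (Z i j - Z j i) + u j * (Z j i - Z i j))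
      + 1 / (real m)\<^sup>2 * (u i - u j)\<^sup>2)"
    unfolding square by (intro sum.cong refl) (simp add: algebra_simps)
  also have "\<dots> = (\<Sum>i<m. \<Sum>j<i. (Z i j - Z j i)\<^sup>2) - 2 / real m * (\<Sum>i<m. (u i)\<^sup>2)
    + 1 / (real m)\<^sup>2 * (real m * (\<Sum>i<m. (u i)\<^sup>2))"
    by (simp only: sum.distrib[of "\<lambda>i. _ i - _ i"] sum.distrib[of "\<lambda>j. _ j - _ j"] sum_subtractf
      sum_distrib_left[symmetric] mixed
      sum_lower_triangle_diff_square mean) simp
  also have "1 / (real m)\<^sup>2 * (real m * (\<Sum>i<m. (u i)\<^sup>2)) = (\<Sum>i<m. (u i)\<^sup>2) / real m"
    using m by (simp add: power2_eq_square)
  finally show ?thesis unfolding u_def by simp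
qed

lemma sum_off_diagonal_squares:
  fixes Z :: "nat \<Rightarrow> nat \<Rightarrow> real"
  shows "(\<Sum>i<m. \<Sum>j\<in>{..<m} - {i}. (Z i j)\<^sup>2) = ((\<Sum>i<m. \<Sum>j<i. (Z i j + Z j i)\<^sup>2) + (\<Sum>i<m. \<Sum>j<i. (Z i j - Z j i)\<^sup>2)) / 2"
proof -
  have "(\<Sum>i<m. \<Sum>j\<in>{..<m} - {i}. (Z i j)\<^sup>2) = (\<Sum>i<m. \<Sum>j<i. (Z i j)\<^sup>2 + (Z j i)\<^sup>2)"
    by (rule sum_lower_triangle_both[symmetric])
  also have "\<dots> = (\<Sum>i<m. \<Sum>j<i. ((Z i j + Z j i)\<^sup>2 + (Z i j - Z j i)\<^sup>2) / 2)"
    by (intro sum.cong refl) (simp add: power2_sum power2_diff)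
  finally show ?thesis by (simp add: sum.distrib flip: sum_divide_distrib)
qed

text \<open>A linear form is the list of its coefficients, trailing zeros being optional. The triple \<open>(\<kappa>, l, l')\<close>
  stands for \<open>\<kappa>\<close> times the product of the forms \<open>l\<close> and \<open>l'\<close>, and a list of triples for the sum of these
  products.\<close>

fun lin_add :: "'a::plus list \<Rightarrow> 'a list \<Rightarrow> 'a list" (infixl "\<boxplus>" 65) where
  "[] \<boxplus> l = l"
| "(x # xs) \<boxplus> [] = x # xs"
| "(x # xs) \<boxplus> (y # ys) = (x + y) # (xs \<boxplus> ys)"

definition lin_scale :: "'a::times \<Rightarrow> 'a list \<Rightarrow> 'a list" (infixr "\<boxdot>" 70) where
  "c \<boxdot> l = map ((*) c) l"

definition coord_form :: "nat \<Rightarrow> 'a::zero \<Rightarrow> 'a list" where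
  "coord_form i x = replicate i 0 @ [x]"

definition apply_form :: "real list \<Rightarrow> real list \<Rightarrow> real" where
  "apply_form l z = (\<Sum>(x, y)\<leftarrow>zip l z. x * y)"

type_synonym 'a quad_form = "('a \<times> 'a list \<times> 'a list) list"

definition quad_form :: "real quad_form \<Rightarrow> real list \<Rightarrow> real" where
  "quad_form fs z = (\<Sum>(\<kappa>, l, l')\<leftarrow>fs. \<kappa> * (apply_form l z * apply_form l' z))"

lemma apply_form_simps [simp]:
  "apply_form [] z = 0" "apply_form l [] = 0" "apply_form (x # l) (y # z) = x * y + apply_form l z"
  by (simp_all add: apply_form_def)

lemma apply_form_add [simp]: "apply_form (l \<boxplus> l') z = apply_form l z + apply_form l' z"
proof (induction l l' arbitrary: z rule: lin_add.induct)
  case (3 x xs y ys)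
  thus ?case by (cases z) (auto simp: algebra_simps)
qed auto

lemma apply_form_scale [simp]: "apply_form (c \<boxdot> l) z = c * apply_form l z"
proof (induction l arbitrary: z)
  case (Cons x l)
  thus ?case by (cases z) (auto simp: lin_scale_def algebra_simps)
qed (simp add: lin_scale_def)

lemma apply_form_replicate_zero: "apply_form (replicate i 0 @ l) z = apply_form l (drop i z)"
proof (induction i arbitrary: z)
  case (Suc i)
  thus ?case by (cases z) auto
qed simp

lemma apply_form_coord: "i < length z \<Longrightarrow> apply_form (coord_form i x) z = x * z ! i"
  by (simp add: coord_form_def apply_form_replicate_zero Cons_nth_drop_Suc[symmetric])

lemma apply_form_sum: "apply_form l (map (\<lambda>f. \<Sum>i<m. f i) fs) = (\<Sum>i<m. apply_form l (map (\<lambda>f. f i) fs))"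
proof (induction fs arbitrary: l)
  case (Cons f fs)
  thus ?case by (cases l) (simp_all add: sum.distrib sum_distrib_left)
qed simp

lemma quad_form_simps [simp]:
  "quad_form [] z = 0" "quad_form ((\<kappa>, l, l') # fs) z = \<kappa> * (apply_form l z * apply_form l' z) + quad_form fs z"
  "quad_form (fs @ gs) z = quad_form fs z + quad_form gs z"
  by (simp_all add: quad_form_def)

lemma quad_form_concat_upt: "quad_form (concat (map f [0..<h])) z = (\<Sum>r<h. quad_form (f r) z)"
  by (induction h) simp_all

text \<open>A perturbation \<open>d\<close> enters through the local coordinates \<open>row i - column i\<close>, \<open>d i i\<close>, \<open>d i m\<close>,
  \<open>column i\<close>, \<open>d (m + r) i\<close> of each symmetric row, where \<open>row\<close> and \<open>column\<close> are the sums over the block, and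
  through the global coordinates \<open>d (m + r) m\<close> followed by the sums over \<open>i\<close> of all local coordinates but the
  first, which sums to zero.\<close>

definition lift_form :: "nat \<Rightarrow> 'a::zero list \<Rightarrow> 'a list" where
  "lift_form h l = replicate h 0 @ tl l"

definition row_form :: "'a::arith \<Rightarrow> 'a \<Rightarrow> 'a list" where
  "row_form x y = [x, 0, y, x]"

definition off_row_form :: "'a::arith list" where
  "off_row_form = [1, - (1 + 1), 0, 1 + 1]"

definition extra_form :: "nat \<Rightarrow> nat \<Rightarrow> 'a::arith \<Rightarrow> 'a \<Rightarrow> 'a list" where
  "extra_form h r x y = coord_form (h + 3 + r) x \<boxplus> coord_form r y"

definition block_form :: "'a::arith sym_point \<Rightarrow> 'a list" where
  "block_form X = row_form (off_diag X) (last_col X) \<boxplus> coord_form 1 (on_diag X - off_diag X)"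

definition own_form :: "nat \<Rightarrow> 'a::arith sym_point \<Rightarrow> nat \<Rightarrow> 'a list" where
  "own_form h X r = extra_form h r (extra_off X r) (extra_last X r)"

definition block_coupling_form :: "'a::arith sym_point \<Rightarrow> 'a pair_values \<Rightarrow> 'a list" where
  "block_coupling_form X v = row_form (off_diag X) (last_col X) \<boxplus> - (inner_value v / left_sq v) \<boxdot> block_form X"

definition block_coupling_local :: "'a::arith sym_point \<Rightarrow> 'a pair_values \<Rightarrow> 'a quad_form" where
  "block_coupling_local X v = (let l = block_coupling_form X v; D = inverse (area_value v); \<theta> = angle_value v in
     [(\<theta>, coord_form 3 1, coord_form 3 1), ((D + D) * (on_diag X - off_diag X), l, off_row_form),
      (D * (block_size X - 1 - 1), l, l), (- (area_value v / (left_sq v * left_sq v)), block_form X, block_form X)])"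

definition block_coupling_global :: "nat \<Rightarrow> 'a::arith sym_point \<Rightarrow> 'a pair_values \<Rightarrow> 'a quad_form" where
  "block_coupling_global h X v = (let l = lift_form h (block_coupling_form X v); P = lift_form h (block_form X);
       y = lift_form h (coord_form 2 1) in
     [(angle_value v, y, y), (inverse (area_value v), l, l), (area_value v / (left_sq v * left_sq v), P, P)])"

definition extra_coupling_form :: "'a::arith sym_point \<Rightarrow> 'a pair_values \<Rightarrow> nat \<Rightarrow> 'a list" where
  "extra_coupling_form X v r = row_form (extra_off X r) (extra_last X r) \<boxplus> coord_form (4 + r) (on_diag X - off_diag X)
     \<boxplus> - (inner_value v / right_sq v) \<boxdot> block_form X"

definition extra_coupling_local :: "'a::arith sym_point \<Rightarrow> 'a pair_values \<Rightarrow> nat \<Rightarrow> 'a quad_form" where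
  "extra_coupling_local X v r = (let l = extra_coupling_form X v r in
     [(angle_value v + angle_value v, coord_form 3 1, coord_form (4 + r) 1), (inverse (area_value v), l, l)])"

definition extra_coupling_global :: "nat \<Rightarrow> 'a::arith sym_point \<Rightarrow> 'a pair_values \<Rightarrow> nat \<Rightarrow> 'a quad_form" where
  "extra_coupling_global h X v r = (let l = lift_form h (extra_coupling_form X v r); Q = own_form h X r;
       l' = extra_form h r (off_diag X) (last_col X) \<boxplus> - (inner_value v / left_sq v) \<boxdot> Q;
       D = inverse (area_value v) in
     [(angle_value v + angle_value v, lift_form h (coord_form 2 1), coord_form r 1), (D + D, l, l'),
       (block_size X * D, l', l'),
      ((area_value v + area_value v) / (left_sq v * right_sq v), lift_form h (block_form X), Q)])"

definition extra_pair_local :: "'a::arith pair_values \<Rightarrow> nat \<Rightarrow> nat \<Rightarrow> 'a quad_form" where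
  "extra_pair_local v r t = [(angle_value v + angle_value v, coord_form (4 + r) 1, coord_form (4 + t) 1)]"

definition extra_pair_global :: "nat \<Rightarrow> 'a::arith sym_point \<Rightarrow> 'a pair_values \<Rightarrow> nat \<Rightarrow> nat \<Rightarrow> 'a quad_form" where
  "extra_pair_global h X v r t = (let Q = own_form h X r; Q' = own_form h X t;
       l = extra_form h t (extra_off X r) (extra_last X r) \<boxplus> extra_form h r (extra_off X t) (extra_last X t)
         \<boxplus> - (inner_value v / left_sq v) \<boxdot> Q \<boxplus> - (inner_value v / right_sq v) \<boxdot> Q' in
     [(angle_value v + angle_value v, coord_form r 1, coord_form t 1), (inverse (area_value v), l, l),
      ((area_value v + area_value v) / (left_sq v * right_sq v), Q, Q')])"

definition block_target_form :: "'a::arith sym_point \<Rightarrow> 'a pair_values \<Rightarrow> nat \<Rightarrow> 'a list" where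
  "block_target_form X v i = coord_form i 1 \<boxplus> - (inner_value v / left_sq v) \<boxdot> block_form X"

definition block_target_local :: "'a::arith sym_point \<Rightarrow> 'a pair_values pair_family \<Rightarrow> 'a quad_form" where
  "block_target_local X K = (let P = block_form X; v = block_target_off K; \<beta> = inner_value v / left_sq v;
       D = inverse (area_value v); l = block_target_form X v 1;
       l' = block_target_form X (block_target_diag K) 1;
       l'' = block_target_form X (block_target_last K) 2 in
     [(D, coord_form 2 1, coord_form 2 1), (D * (\<beta> + \<beta>), P, row_form 1 0), (- (D * (block_size X * (\<beta> * \<beta>))), P, P),
       (D, l, l),
      (- inverse (area_value (block_target_diag K)), l', l'),
        (- inverse (area_value (block_target_last K)), l'', l'')])"

definition extra_target_local :: "'a::arith pair_values pair_family \<Rightarrow> nat \<Rightarrow> 'a quad_form" where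
  "extra_target_local K r = [(- inverse (area_value (extra_target K r)), coord_form (4 + r) 1, coord_form (4 + r) 1)]"

definition extra_target_global :: "nat \<Rightarrow> 'a::arith sym_point \<Rightarrow> 'a pair_values pair_family \<Rightarrow> nat \<Rightarrow> 'a quad_form" where
  "extra_target_global h X K r = (let Q = own_form h X r; v = extra_target K r; \<beta> = inner_value v / left_sq v;
       D = inverse (area_value v); w = extra_target_last K r; l = coord_form r 1 \<boxplus> - (inner_value w / left_sq w) \<boxdot> Q in
     [(D * (\<beta> + \<beta>), coord_form (h + 3 + r) 1, Q), (- (D * (block_size X * (\<beta> * \<beta>))), Q, Q),
       (- inverse (area_value w), l, l)])"

definition off_diag_weight :: "nat \<Rightarrow> 'a::arith \<Rightarrow> 'a \<Rightarrow> 'a sym_point \<Rightarrow> 'a pair_values pair_family \<Rightarrow> 'a" where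
  "off_diag_weight h \<pi> \<mu> X K = block_multiplier h \<pi> X K - \<mu> - angle_value (block_block K)
    - inverse (area_value (block_target_off K))"

definition extra_local_form :: "nat \<Rightarrow> 'a::arith \<Rightarrow> 'a \<Rightarrow> 'a sym_point \<Rightarrow> 'a pair_values pair_family \<Rightarrow> nat
  \<Rightarrow> 'a quad_form" where
  "extra_local_form h \<pi> \<mu> X K r = [(extra_multiplier h \<pi> X K r - \<mu>, coord_form (4 + r) 1, coord_form (4 + r) 1)]
     @ extra_coupling_local X (extra_block K r) r @ extra_target_local K r
     @ concat (map (\<lambda>t. extra_pair_local (extra_extra K r t) r t) [0..<r])"

definition local_form :: "nat \<Rightarrow> 'a::arith \<Rightarrow> 'a \<Rightarrow> 'a sym_point \<Rightarrow> 'a pair_values pair_family \<Rightarrow> 'a quad_form" where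
  "local_form h \<pi> \<mu> X K =
     [(off_diag_weight h \<pi> \<mu> X K, coord_form 1 1, coord_form 1 1),
       (off_diag_weight h \<pi> \<mu> X K, coord_form 2 1, coord_form 2 1),
      (- ((block_multiplier h \<pi> X K - \<pi>) / left_sq (block_block K)), block_form X, block_form X)]
     @ block_coupling_local X (block_block K) @ block_target_local X K
       @ concat (map (extra_local_form h \<pi> \<mu> X K) [0..<h])"

definition extra_global_form :: "nat \<Rightarrow> 'a::arith \<Rightarrow> 'a \<Rightarrow> 'a sym_point \<Rightarrow> 'a pair_values pair_family \<Rightarrow> nat
  \<Rightarrow> 'a quad_form" where
  "extra_global_form h \<pi> \<mu> X K r = [(extra_multiplier h \<pi> X K r - \<mu>, coord_form r 1, coord_form r 1),
       (- ((extra_multiplier h \<pi> X K r - \<pi>) / left_sq (extra_block K r)), own_form h X r, own_form h X r)]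
     @ extra_coupling_global h X (extra_block K r) r @ extra_target_global h X K r
     @ concat (map (\<lambda>t. extra_pair_global h X (extra_extra K r t) r t) [0..<r])"

definition global_form :: "nat \<Rightarrow> 'a::arith \<Rightarrow> 'a \<Rightarrow> 'a sym_point \<Rightarrow> 'a pair_values pair_family \<Rightarrow> 'a quad_form" where
  "global_form h \<pi> \<mu> X K = block_coupling_global h X (block_block K)
    @ concat (map (extra_global_form h \<pi> \<mu> X K) [0..<h])"

definition antisymmetric_weight :: "nat \<Rightarrow> 'a::arith \<Rightarrow> 'a \<Rightarrow> 'a sym_point \<Rightarrow> 'a pair_values pair_family \<Rightarrow> 'a" where
  "antisymmetric_weight h \<pi> \<mu> X K = off_diag_weight h \<pi> \<mu> X K * inverse (1 + 1)"

definition symmetric_weight :: "nat \<Rightarrow> 'a::arith \<Rightarrow> 'a \<Rightarrow> 'a sym_point \<Rightarrow> 'a pair_values pair_family \<Rightarrow> 'a" where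
  "symmetric_weight h \<pi> \<mu> X K = antisymmetric_weight h \<pi> \<mu> X K
     + (on_diag X - off_diag X) * (on_diag X - off_diag X) * inverse (area_value (block_block K))"

text \<open>The squares of the off-diagonal entries are bounded below by means of their row and column sums. The
  local form is applied to the local coordinates minus their means, and the global form receives the
  contribution of the means.\<close>

definition off_diag_local :: "nat \<Rightarrow> 'a::arith \<Rightarrow> 'a \<Rightarrow> 'a sym_point \<Rightarrow> 'a pair_values pair_family \<Rightarrow> 'a quad_form" where
  "off_diag_local h \<pi> \<mu> X K = [(symmetric_weight h \<pi> \<mu> X K / (block_size X - 1 - 1), off_row_form, off_row_form),
     (antisymmetric_weight h \<pi> \<mu> X K / block_size X, coord_form 0 1, coord_form 0 1)]"

definition off_diag_global :: "nat \<Rightarrow> 'a::arith \<Rightarrow> 'a \<Rightarrow> 'a sym_point \<Rightarrow> 'a pair_values pair_family \<Rightarrow> 'a quad_form" where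
  "off_diag_global h \<pi> \<mu> X K = [(- (symmetric_weight h \<pi> \<mu> X K /
    ((1 + 1) * (block_size X - 1) * (block_size X - 1 - 1))),
     lift_form h off_row_form, lift_form h off_row_form)]"

definition lift_quad_form :: "nat \<Rightarrow> 'a::arith \<Rightarrow> 'a quad_form \<Rightarrow> 'a quad_form" where
  "lift_quad_form h c fs = map (\<lambda>(\<kappa>, l, l'). (c * \<kappa>, lift_form h l, lift_form h l')) fs"

definition reduced_local_form :: "nat \<Rightarrow> 'a::arith \<Rightarrow> 'a \<Rightarrow> 'a sym_point \<Rightarrow> 'a pair_values pair_family \<Rightarrow> 'a quad_form" where
  "reduced_local_form h \<pi> \<mu> X K = off_diag_local h \<pi> \<mu> X K @ local_form h \<pi> \<mu> X K"

definition reduced_global_form :: "nat \<Rightarrow> 'a::arith \<Rightarrow> 'a \<Rightarrow> 'a sym_point \<Rightarrow> 'a pair_values pair_family \<Rightarrow> 'a quad_form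
  \<Rightarrow> 'a quad_form" where
  "reduced_global_form h \<pi> \<mu> X K fs = off_diag_global h \<pi> \<mu> X K @ global_form h \<pi> \<mu> X K
     @ lift_quad_form h (inverse (block_size X)) fs"

lemma centered_product_sum:
  fixes u v :: "nat \<Rightarrow> real"
  assumes "0 < m"
  shows "(\<Sum>i<m. (u i - inverse (real m) * (\<Sum>j<m. u j)) * (v i - inverse (real m) * (\<Sum>j<m. v j)))
    = (\<Sum>i<m. u i * v i) - inverse (real m) * ((\<Sum>j<m. u j) * (\<Sum>j<m. v j))"
proof -
  define U where "U = (\<Sum>j<m. u j)"
  define W where "W = (\<Sum>j<m. v j)"
  have "(\<Sum>i<m. (u i - inverse (real m) * U) * (v i - inverse (real m) * W))
     = (\<Sum>i<m. u i * v i - inverse (real m) * W * u i - inverse (real m) * U * v i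
       + inverse (real m) * U * (inverse (real m) * W))"
    by (intro sum.cong refl) (simp add: algebra_simps)
  also have "\<dots> = (\<Sum>i<m. u i * v i) - inverse (real m) * (U * W)"
    using assms by (simp add: sum.distrib sum_subtractf U_def[symmetric] W_def[symmetric] flip: sum_distrib_left)
  finally show ?thesis unfolding U_def W_def .
qed

locale symmetric_perturbation = symmetric_point +
  fixes d :: "nat \<Rightarrow> nat \<Rightarrow> real"
begin

definition "row_sum i = (\<Sum>j<m. d i j)"
definition "col_sum i = (\<Sum>j<m. d j i)"
definition "coord_funs = [\<lambda>i. d i i, \<lambda>i. d i m, col_sum] @ map (\<lambda>r i. d (m + r) i) [0..<h]"
definition "local_coords i = (row_sum i - col_sum i) # map (\<lambda>f. f i) coord_funs"
definition "global_coords = map (\<lambda>r. d (m + r) m) [0..<h] @ map (\<lambda>f. \<Sum>i<m. f i) coord_funs"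
definition "block_part i = (a - b) * d i i + b * row_sum i + c * d i m"
definition "extra_part r = \<delta> r * row_sum (m + r) + \<gamma> r * d (m + r) m"

lemma sum_row_eq_sum_col: "(\<Sum>i<m. row_sum i) = (\<Sum>i<m. col_sum i)"
  unfolding row_sum_def col_sum_def by (rule sum.swap)

lemma apply_lift_form: "apply_form (lift_form h l) global_coords = (\<Sum>i<m. apply_form l (local_coords i))"
proof (cases l)
  case (Cons x l')
  have "apply_form (lift_form h l) global_coords = apply_form l' (map (\<lambda>f. \<Sum>i<m. f i) coord_funs)"
    by (simp add: Cons lift_form_def global_coords_def apply_form_replicate_zero)
  thus ?thesis
    by (simp add: Cons local_coords_def apply_form_sum sum.distrib sum_subtractf sum_row_eq_sum_col flip:
      sum_distrib_left)
qed (use apply_form_replicate_zero[of h "[]"] in \<open>simp add: lift_form_def\<close>)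

lemma apply_coord_local:
  "apply_form (coord_form 1 x) (local_coords i) = x * d i i" "apply_form (coord_form (Suc 0) x) (local_coords i)
    = x * d i i"
  "apply_form (coord_form 2 x) (local_coords i) = x * d i m"
  "apply_form (coord_form 3 x) (local_coords i) = x * col_sum i" "r < h
    \<Longrightarrow> apply_form (coord_form (4 + r) x) (local_coords i) = x * d (m + r) i"
  by (simp_all add: apply_form_coord local_coords_def coord_funs_def nth_append eval_nat_numeral)

lemma apply_row_form: "apply_form (row_form x y) (local_coords i) = x * row_sum i + y * d i m"
  by (simp add: row_form_def local_coords_def coord_funs_def algebra_simps)

lemma apply_off_row_form: "apply_form off_row_form (local_coords i) = row_sum i + col_sum i - 2 * d i i"
  by (simp add: off_row_form_def local_coords_def coord_funs_def algebra_simps)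

lemma apply_block_form: "apply_form (block_form X) (local_coords i) = block_part i"
  by (simp add: block_form_def apply_row_form apply_coord_local block_part_def)

lemma apply_coord_global:
  "r < h \<Longrightarrow> apply_form (coord_form r x) global_coords = x * d (m + r) m"
  "r < h \<Longrightarrow> apply_form (coord_form (h + 3 + r) x) global_coords = x * row_sum (m + r)"
  by (simp_all add: apply_form_coord global_coords_def coord_funs_def nth_append eval_nat_numeral row_sum_def)

lemma apply_extra_form: "r < h \<Longrightarrow> apply_form (extra_form h r x y) global_coords = x * row_sum (m + r) + y * d (m + r) m"
  by (simp add: extra_form_def apply_coord_global)

lemma apply_own_form: "r < h \<Longrightarrow> apply_form (own_form h X r) global_coords = extra_part r"
  by (simp add: own_form_def apply_extra_form extra_part_def)

lemma dot_block_part: "i < m \<Longrightarrow> dot k (C i) (d i) = block_part i"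
  by (simp add: dot_block block_part_def row_sum_def)

lemma dot_extra_part: "dot k (C (m + r)) (d (m + r)) = extra_part r"
  by (simp add: dot_extra extra_part_def row_sum_def)

lemma dot_self: "dot k (d i) (d i) = (\<Sum>j<m. (d i j)\<^sup>2) + (d i m)\<^sup>2"
  by (simp add: dot_def power2_eq_square)

lemmas apply_forms = apply_lift_form apply_coord_local apply_coord_global apply_row_form apply_off_row_form
  apply_block_form apply_extra_form apply_own_form

definition "block_residual i = b * row_sum i + c * d i m - block_inner X / block_sq_norm X * block_part i"

lemma block_block_sel:
  "left_sq (block_block K) = block_sq_norm X" "inner_value (block_block K) = block_inner X"
  "area_value (block_block K) = area (block_sq_norm X) (block_sq_norm X) (block_inner X)"
  "angle_value (block_block K) = supp_angle (block_sq_norm X) (block_sq_norm X) (block_inner X)"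
  by (simp_all add: arc_family_simps arc_values_def)

lemma relu_kernel_coupling_block:
  assumes "i < m" "j < m" "i \<noteq> j"
  shows "relu_kernel_coupling k (C i) (C j) (d i) (d j) =
    2 * (area_value (block_block K) / (block_sq_norm X * block_sq_norm X)) * (block_part i * block_part j)
    + inverse (area_value (block_block K)) * ((a - b) * (d i j + d j i) + block_residual i + block_residual j)\<^sup>2
    + 2 * angle_value (block_block K) * dot k (d i) (d j)"
proof -
  have "dot k (C i) (d j) + dot k (C j) (d i) - block_inner X * (block_part i / block_sq_norm X
    + block_part j / block_sq_norm X)
      = (a - b) * (d i j + d j i) + block_residual i + block_residual j"
    using assms by (simp add: dot_block block_residual_def row_sum_def algebra_simps)
  thus ?thesis
    using assms unfolding relu_kernel_coupling_def
    by (simp add: gram dot_block_part block_block_sel divide_inverse mult_ac)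
qed

lemma apply_block_coupling_form: "apply_form (block_coupling_form X (block_block K)) (local_coords i)
  = block_residual i"
  by (simp add: block_coupling_form_def apply_forms block_residual_def block_block_sel)

lemma quad_form_block_coupling_local:
  "(\<Sum>i<m. quad_form (block_coupling_local X (block_block K)) (local_coords i)) =
    angle_value (block_block K) * (\<Sum>i<m. (col_sum i)\<^sup>2)
    + inverse (area_value (block_block K)) * (2 * (a - b) *
      (\<Sum>i<m. block_residual i * (row_sum i + col_sum i - 2 * d i i))
        + (real m - 2) * (\<Sum>i<m. (block_residual i)\<^sup>2))
    - area_value (block_block K) / (block_sq_norm X * block_sq_norm X) * (\<Sum>i<m. (block_part i)\<^sup>2)"
  unfolding sum_distrib_left sum.distrib[symmetric] sum_subtractf[symmetric]
  by (intro sum.cong refl) (simp add: block_coupling_local_def Let_def apply_block_coupling_form apply_forms size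
    block_block_sel(1)
    power2_eq_square algebra_simps)

lemma quad_form_block_coupling_global:
  "quad_form (block_coupling_global h X (block_block K)) global_coords =
    angle_value (block_block K) * (\<Sum>i<m. d i m)\<^sup>2 + inverse (area_value (block_block K)) * (\<Sum>i<m. block_residual i)\<^sup>2
    + area_value (block_block K) / (block_sq_norm X * block_sq_norm X) * (\<Sum>i<m. block_part i)\<^sup>2"
  by (simp add: block_coupling_global_def Let_def apply_block_coupling_form apply_forms block_block_sel(1)
    power2_eq_square)

lemma block_coupling:
  "(\<Sum>i<m. \<Sum>j<i. relu_kernel_coupling k (C i) (C j) (d i) (d j)) =
     (a - b)\<^sup>2 * inverse (area_value (block_block K)) * (\<Sum>i<m. \<Sum>j<i. (d i j + d j i)\<^sup>2)
     - angle_value (block_block K) * (\<Sum>i<m. dot k (d i) (d i))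
     + (\<Sum>i<m. quad_form (block_coupling_local X (block_block K)) (local_coords i))
     + quad_form (block_coupling_global h X (block_block K)) global_coords"
proof -
  let ?r = "area_value (block_block K) / (block_sq_norm X * block_sq_norm X)"
  let ?D = "inverse (area_value (block_block K))" and ?\<theta> = "angle_value (block_block K)"
  have "(\<Sum>i<m. \<Sum>j<i. relu_kernel_coupling k (C i) (C j) (d i) (d j))
    = (\<Sum>i<m. \<Sum>j<i. 2 * ?r * (block_part i * block_part j)
      + ?D * ((a - b) * (d i j + d j i) + block_residual i + block_residual j)\<^sup>2 + 2 * ?\<theta> * dot k (d i) (d j))"
    by (intro sum.cong refl) (simp add: relu_kernel_coupling_block)
  also have "\<dots> = 2 * ?r * (\<Sum>i<m. \<Sum>j<i. block_part i * block_part j)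
      + ?D * (\<Sum>i<m. \<Sum>j<i. ((a - b) * (d i j + d j i) + block_residual i + block_residual j)\<^sup>2)
      + 2 * ?\<theta> * (\<Sum>i<m. \<Sum>j<i. dot k (d i) (d j))"
    by (simp only: sum.distrib sum_distrib_left[symmetric])
  also have "\<dots> = ?r * ((\<Sum>i<m. block_part i)\<^sup>2 - (\<Sum>i<m. (block_part i)\<^sup>2))
      + ?D * ((a - b)\<^sup>2 * (\<Sum>i<m. \<Sum>j<i. (d i j + d j i)\<^sup>2)
        + 2 * (a - b) * (\<Sum>i<m. block_residual i * (row_sum i + col_sum i - 2 * d i i))
        + (real m - 2) * (\<Sum>i<m. (block_residual i)\<^sup>2) + (\<Sum>i<m. block_residual i)\<^sup>2)
      + ?\<theta> * ((\<Sum>i<m. (col_sum i)\<^sup>2) + (\<Sum>i<m. d i m)\<^sup>2 - (\<Sum>i<m. dot k (d i) (d i)))"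
    unfolding sum_lower_triangle_product sum_lower_triangle_square sum_lower_triangle_dot
    by (simp add: row_sum_def col_sum_def)
  finally show ?thesis
    unfolding quad_form_block_coupling_local quad_form_block_coupling_global by (simp add: algebra_simps)
qed

definition "extra_residual r i = \<delta> r * row_sum i + \<gamma> r * d i m + (a - b) * d (m + r) i
  - extra_block_inner X r / block_sq_norm X * block_part i"
definition "cross_residual r = b * row_sum (m + r) + c * d (m + r) m
  - extra_block_inner X r / extra_inner X r r * extra_part r"

lemma extra_block_sel:
  "left_sq (extra_block K r) = extra_inner X r r" "right_sq (extra_block K r) = block_sq_norm X"
  "inner_value (extra_block K r) = extra_block_inner X r"
  "area_value (extra_block K r) = area (extra_inner X r r) (block_sq_norm X) (extra_block_inner X r)"
  "angle_value (extra_block K r) = supp_angle (extra_inner X r r) (block_sq_norm X) (extra_block_inner X r)"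
  by (simp_all add: arc_family_simps arc_values_def)

lemma relu_kernel_coupling_extra_block:
  assumes "j < m"
  shows "relu_kernel_coupling k (C (m + r)) (C j) (d (m + r)) (d j) =
    2 * area_value (extra_block K r) / (extra_inner X r r * block_sq_norm X) * (extra_part r * block_part j)
    + inverse (area_value (extra_block K r)) * (extra_residual r j + cross_residual r)\<^sup>2
    + 2 * angle_value (extra_block K r) * dot k (d (m + r)) (d j)"
proof -
  have "dot k (C (m + r)) (d j) + dot k (C j) (d (m + r))
      - extra_block_inner X r * (extra_part r / extra_inner X r r + block_part j / block_sq_norm X)
    = extra_residual r j + cross_residual r"
    using assms by (simp add: dot_block dot_extra extra_residual_def cross_residual_def row_sum_def algebra_simps)
  thus ?thesis
    using assms unfolding relu_kernel_coupling_def
    by (simp add: gram dot_block_part dot_extra_part extra_block_sel divide_inverse mult_ac)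
qed

lemma sum_dot_extra_block: "(\<Sum>j<m. dot k (d (m + r)) (d j))
  = (\<Sum>l<m. col_sum l * d (m + r) l) + (\<Sum>i<m. d i m) * d (m + r) m"
proof -
  have "(\<Sum>j<m. dot k (d (m + r)) (d j)) = (\<Sum>j<m. \<Sum>l<m. d j l * d (m + r) l) + (\<Sum>j<m. d j m * d (m + r) m)"
    by (simp add: dot_def sum.distrib mult.commute)
  also have "(\<Sum>j<m. \<Sum>l<m. d j l * d (m + r) l) = (\<Sum>l<m. col_sum l * d (m + r) l)"
    unfolding col_sum_def sum_distrib_right by (rule sum.swap)
  finally show ?thesis by (simp add: sum_distrib_right)
qed

lemma extra_coupling:
  assumes "r < h"
  shows "(\<Sum>j<m. relu_kernel_coupling k (C (m + r)) (C j) (d (m + r)) (d j)) =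
    (\<Sum>i<m. quad_form (extra_coupling_local X (extra_block K r) r) (local_coords i))
    + quad_form (extra_coupling_global h X (extra_block K r) r) global_coords"
proof -
  let ?v = "extra_block K r"
  have residual: "apply_form (extra_coupling_form X ?v r) (local_coords i) = extra_residual r i" for i
    using assms by (simp add: extra_coupling_form_def apply_forms extra_residual_def extra_block_sel(1-3))
  have local: "(\<Sum>i<m. quad_form (extra_coupling_local X ?v r) (local_coords i))
      = 2 * angle_value ?v * (\<Sum>i<m. col_sum i * d (m + r) i) + inverse (area_value ?v) * (\<Sum>i<m. (extra_residual r i)\<^sup>2)"
    unfolding sum_distrib_left sum.distrib[symmetric] using assms
    by (intro sum.cong refl) (simp add: extra_coupling_local_def Let_def residual apply_forms power2_eq_square)
  have global: "quad_form (extra_coupling_global h X ?v r) global_coords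
    = 2 * angle_value ?v * ((\<Sum>i<m. d i m) * d (m + r) m)
      + inverse (area_value ?v) * (2 * (\<Sum>i<m. extra_residual r i) * cross_residual r + real m * (cross_residual r)\<^sup>2)
      + 2 * area_value ?v / (extra_inner X r r * block_sq_norm X) * (extra_part r * (\<Sum>i<m. block_part i))"
    using assms by (simp add: extra_coupling_global_def Let_def residual apply_forms cross_residual_def
      extra_block_sel(1-3) size
      power2_eq_square algebra_simps)
  have "(\<Sum>j<m. relu_kernel_coupling k (C (m + r)) (C j) (d (m + r)) (d j))
      = (\<Sum>j<m. 2 * area_value ?v / (extra_inner X r r * block_sq_norm X) * extra_part r * block_part j
        + inverse (area_value ?v) * (extra_residual r j)\<^sup>2
          + inverse (area_value ?v) * (2 * cross_residual r) * extra_residual r j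
        + inverse (area_value ?v) * (cross_residual r)\<^sup>2 + 2 * angle_value ?v * dot k (d (m + r)) (d j))"
    by (intro sum.cong refl) (simp add: relu_kernel_coupling_extra_block power2_eq_square algebra_simps)
  also have "\<dots> = 2 * area_value ?v / (extra_inner X r r * block_sq_norm X) * extra_part r * (\<Sum>i<m. block_part i)
      + inverse (area_value ?v) * (\<Sum>i<m. (extra_residual r i)\<^sup>2) + inverse (area_value ?v) * (2 * cross_residual r) *
        (\<Sum>i<m. extra_residual r i)
      + real m * (inverse (area_value ?v) * (cross_residual r)\<^sup>2)
        + 2 * angle_value ?v * (\<Sum>j<m. dot k (d (m + r)) (d j))"
    by (simp add: sum.distrib flip: sum_distrib_left sum_divide_distrib)
  finally show ?thesis unfolding local global sum_dot_extra_block by (simp add: algebra_simps)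
qed

lemma extra_pair:
  assumes "r < h" "t < h"
  shows "relu_kernel_coupling k (C (m + r)) (C (m + t)) (d (m + r)) (d (m + t)) =
    (\<Sum>i<m. quad_form (extra_pair_local (extra_extra K r t) r t) (local_coords i))
    + quad_form (extra_pair_global h X (extra_extra K r t) r t) global_coords"
proof -
  let ?v = "extra_extra K r t"
  have sel: "left_sq ?v = extra_inner X r r" "right_sq ?v = extra_inner X t t" "inner_value ?v = extra_inner X r t"
    "area_value ?v = area (extra_inner X r r) (extra_inner X t t) (extra_inner X r t)"
    "angle_value ?v = supp_angle (extra_inner X r r) (extra_inner X t t) (extra_inner X r t)"
    by (simp_all add: arc_family_simps arc_values_def)
  have "dot k (d (m + r)) (d (m + t)) = (\<Sum>i<m. d (m + r) i * d (m + t) i) + d (m + r) m * d (m + t) m"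
    by (simp add: dot_def)
  hence "relu_kernel_coupling k (C (m + r)) (C (m + t)) (d (m + r)) (d (m + t)) =
      2 * area_value ?v / (extra_inner X r r * extra_inner X t t) * (extra_part r * extra_part t)
      + inverse (area_value ?v) * (\<delta> r * row_sum (m + t) + \<gamma> r * d (m + t) m + \<delta> t * row_sum (m + r) + \<gamma> t * d (m + r) m
          - extra_inner X r t / extra_inner X r r * extra_part r
            - extra_inner X r t / extra_inner X t t * extra_part t)\<^sup>2
      + 2 * angle_value ?v * ((\<Sum>i<m. d (m + r) i * d (m + t) i) + d (m + r) m * d (m + t) m)"
    unfolding relu_kernel_coupling_def gram dot_extra_part sel(4,5)
    by (simp add: dot_extra row_sum_def divide_inverse algebra_simps)
  moreover have "(\<Sum>i<m. quad_form (extra_pair_local ?v r t) (local_coords i))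
    = 2 * angle_value ?v * (\<Sum>i<m. d (m + r) i * d (m + t) i)"
    using assms by (simp add: extra_pair_local_def apply_forms sum_distrib_left)
  ultimately show ?thesis
    using assms by (simp add: extra_pair_global_def Let_def apply_forms sel(1-3) power2_eq_square algebra_simps)
qed

lemma block_targets:
  "(\<Sum>i<m. \<Sum>j<k. (d i j - C i j * (block_part i / block_sq_norm X))\<^sup>2 / area (block_sq_norm X) 1 (C i j)) =
    inverse (area_value (block_target_off K)) * (\<Sum>i<m. dot k (d i) (d i))
      - (\<Sum>i<m. quad_form (block_target_local X K) (local_coords i))"
proof -
  have target: "(\<Sum>j<k. (d i j - C i j * (block_part i / block_sq_norm X))\<^sup>2 / area (block_sq_norm X) 1 (C i j)) =
      inverse (area_value (block_target_off K)) * dot k (d i) (d i)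
        - quad_form (block_target_local X K) (local_coords i)" if i: "i < m" for i
  proof -
    define P where "P = block_part i / block_sq_norm X"
    define f where "f w x = (x - w * P)\<^sup>2 * inverse (area (block_sq_norm X) 1 w)" for w x
    have "(\<Sum>j<m. (d i j - b * P)\<^sup>2) = (\<Sum>j<m. (d i j)\<^sup>2 - 2 * b * P * d i j + (b * P)\<^sup>2)"
      by (intro sum.cong refl) (simp add: power2_diff)
    hence "(\<Sum>j<m. f b (d i j)) = inverse (area (block_sq_norm X) 1 b) * ((\<Sum>j<m. (d i j)\<^sup>2) - 2 * b * P * row_sum i
      + real m * (b * P)\<^sup>2)"
      by (simp add: f_def row_sum_def sum.distrib sum_subtractf flip: sum_distrib_left sum_distrib_right)
    moreover have "(\<Sum>j<k. f (C i j) (d i j)) = f a (d i i) + (\<Sum>j\<in>{..<m} - {i}. f b (d i j)) + f c (d i m)"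
      using i by (simp add: sum.remove[of "{..<m}" i] entry_block)
    moreover have "(\<Sum>j\<in>{..<m} - {i}. f b (d i j)) = (\<Sum>j<m. f b (d i j)) - f b (d i i)"
      using i by (simp add: sum_diff1)
    ultimately have "(\<Sum>j<k. f (C i j) (d i j)) = inverse (area (block_sq_norm X) 1 b)
        * (dot k (d i) (d i) - (d i m)\<^sup>2 - 2 * b * P * row_sum i + real m * (b * P)\<^sup>2) + f a (d i i) - f b (d i i)
          + f c (d i m)"
      by (simp add: dot_self)
    also have "\<dots> = inverse (area_value (block_target_off K)) * dot k (d i) (d i)
      - quad_form (block_target_local X K) (local_coords i)"
      by (simp add: f_def P_def block_target_local_def block_target_form_def Let_def apply_forms arc_family_simps
        arc_values_def size
        divide_inverse power2_eq_square algebra_simps)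
    finally show ?thesis by (simp add: f_def P_def divide_inverse)
  qed
  show ?thesis unfolding sum_distrib_left sum_subtractf[symmetric] by (intro sum.cong refl target) simp
qed

lemma extra_targets:
  assumes r: "r < h"
  shows "(\<Sum>j<k. (d (m + r) j - C (m + r) j * (extra_part r / extra_inner X r r))\<^sup>2 / area (extra_inner X r r) 1
    (C (m + r) j)) =
    - (\<Sum>i<m. quad_form (extra_target_local K r) (local_coords i))
      - quad_form (extra_target_global h X K r) global_coords"
proof -
  define Q where "Q = extra_part r / extra_inner X r r"
  have "(\<Sum>j<m. (d (m + r) j - \<delta> r * Q)\<^sup>2) = (\<Sum>j<m. (d (m + r) j)\<^sup>2 - 2 * \<delta> r * Q * d (m + r) j + (\<delta> r * Q)\<^sup>2)"
    by (intro sum.cong refl) (simp add: power2_diff)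
  also have "\<dots> = (\<Sum>j<m. (d (m + r) j)\<^sup>2) - 2 * \<delta> r * Q * row_sum (m + r) + real m * (\<delta> r * Q)\<^sup>2"
    by (simp add: row_sum_def sum.distrib sum_subtractf flip: sum_distrib_left)
  finally have "(\<Sum>j<k. (d (m + r) j - C (m + r) j * Q)\<^sup>2 / area (extra_inner X r r) 1 (C (m + r) j)) =
      inverse (area (extra_inner X r r) 1 (\<delta> r)) * ((\<Sum>j<m. (d (m + r) j)\<^sup>2) - 2 * \<delta> r * Q * row_sum (m + r)
        + real m * (\<delta> r * Q)\<^sup>2)
      + inverse (area (extra_inner X r r) 1 (\<gamma> r)) * (d (m + r) m - \<gamma> r * Q)\<^sup>2"
    by (simp add: entry_extra divide_inverse flip: sum_distrib_right)
  moreover have "(\<Sum>i<m. quad_form (extra_target_local K r) (local_coords i))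
      = - (inverse (area (extra_inner X r r) 1 (\<delta> r)) * (\<Sum>j<m. (d (m + r) j)\<^sup>2))"
    using r by (simp add: extra_target_local_def apply_forms arc_family_simps arc_values_def power2_eq_square sum_negf
      sum_distrib_left)
  moreover have "quad_form (extra_target_global h X K r) global_coords
      = inverse (area (extra_inner X r r) 1 (\<delta> r)) * (2 * \<delta> r * Q * row_sum (m + r) - real m * (\<delta> r * Q)\<^sup>2)
        - inverse (area (extra_inner X r r) 1 (\<gamma> r)) * (d (m + r) m - \<gamma> r * Q)\<^sup>2"
    using r by (simp add: extra_target_global_def Let_def apply_forms arc_family_simps arc_values_def size Q_def)
      (simp add: divide_inverse power2_eq_square algebra_simps)
  ultimately show ?thesis by (simp add: Q_def algebra_simps)
qed

definition "off_diag_squares = (\<Sum>i<m. \<Sum>j\<in>{..<m} - {i}. (d i j)\<^sup>2)"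

lemma sum_dot_block: "(\<Sum>i<m. dot k (d i) (d i)) = off_diag_squares + (\<Sum>i<m. (d i i)\<^sup>2) + (\<Sum>i<m. (d i m)\<^sup>2)"
  by (simp add: off_diag_squares_def dot_self sum_diff1 sum.distrib sum_subtractf)

lemma gram_hessian_form_diagonal:
  "(\<Sum>i<n. gram_multiplier k n C i * dot k (d i) (d i)
      - (gram_multiplier k n C i - pi) / dot k (C i) (C i) * (dot k (C i) (d i))\<^sup>2) - \<mu> * (\<Sum>i<n. dot k (d i) (d i)) =
    (block_multiplier h pi X K - \<mu>) * (\<Sum>i<m. dot k (d i) (d i))
    - (block_multiplier h pi X K - pi) / block_sq_norm X * (\<Sum>i<m. (block_part i)\<^sup>2)
    + (\<Sum>r<h. (extra_multiplier h pi X K r - \<mu>) * ((\<Sum>i<m. (d (m + r) i)\<^sup>2) + (d (m + r) m)\<^sup>2)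
        - (extra_multiplier h pi X K r - pi) / extra_inner X r r * (extra_part r)\<^sup>2)"
  unfolding sum_lessThan_add distrib_left sum_distrib_left dot_self[of "m + _", symmetric]
  by (simp add: gram_multiplier_block gram_multiplier_extra gram dot_block_part dot_extra_part)
    (simp add: sum.distrib sum_subtractf left_diff_distrib)

lemma sum_quad_form_local:
  "(\<Sum>i<m. quad_form (local_form h pi \<mu> X K) (local_coords i)) =
    off_diag_weight h pi \<mu> X K * ((\<Sum>i<m. (d i i)\<^sup>2) + (\<Sum>i<m. (d i m)\<^sup>2))
    - (block_multiplier h pi X K - pi) / block_sq_norm X * (\<Sum>i<m. (block_part i)\<^sup>2)
    + (\<Sum>i<m. quad_form (block_coupling_local X (block_block K)) (local_coords i))
      + (\<Sum>i<m. quad_form (block_target_local X K) (local_coords i))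
    + (\<Sum>r<h. (extra_multiplier h pi X K r - \<mu>) * (\<Sum>i<m. (d (m + r) i)\<^sup>2)
        + (\<Sum>i<m. quad_form (extra_coupling_local X (extra_block K r) r) (local_coords i))
        + (\<Sum>i<m. quad_form (extra_target_local K r) (local_coords i))
        + (\<Sum>t<r. \<Sum>i<m. quad_form (extra_pair_local (extra_extra K r t) r t) (local_coords i)))"
proof -
  have "quad_form (local_form h pi \<mu> X K) (local_coords i) =
    off_diag_weight h pi \<mu> X K * ((d i i)\<^sup>2 + (d i m)\<^sup>2) - (block_multiplier h pi X K - pi) / block_sq_norm X *
      (block_part i)\<^sup>2
    + quad_form (block_coupling_local X (block_block K)) (local_coords i)
      + quad_form (block_target_local X K) (local_coords i)
    + (\<Sum>r<h. (extra_multiplier h pi X K r - \<mu>) * (d (m + r) i)\<^sup>2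
      + quad_form (extra_coupling_local X (extra_block K r) r) (local_coords i)
        + quad_form (extra_target_local K r) (local_coords i)
        + (\<Sum>t<r. quad_form (extra_pair_local (extra_extra K r t) r t) (local_coords i)))" for i
    by (simp add: local_form_def extra_local_form_def quad_form_concat_upt apply_forms block_block_sel(1))
      (simp add: power2_eq_square algebra_simps)
  thus ?thesis
    by (simp add: sum.distrib sum_subtractf sum_distrib_left sum.swap[of _ "{..<h}" "{..<m}"]
      sum.swap[of _ "{..<_}" "{..<m}"] distrib_left)
qed

lemma quad_form_global:
  "quad_form (global_form h pi \<mu> X K) global_coords
    = quad_form (block_coupling_global h X (block_block K)) global_coords
    + (\<Sum>r<h. (extra_multiplier h pi X K r - \<mu>) * (d (m + r) m)\<^sup>2
        - (extra_multiplier h pi X K r - pi) / extra_inner X r r * (extra_part r)\<^sup>2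
        + quad_form (extra_coupling_global h X (extra_block K r) r) global_coords
        + quad_form (extra_target_global h X K r) global_coords
        + (\<Sum>t<r. quad_form (extra_pair_global h X (extra_extra K r t) r t) global_coords))"
  by (simp add: global_form_def extra_global_form_def quad_form_concat_upt apply_forms extra_block_sel(1)
    power2_eq_square algebra_simps)

lemma gram_hessian_form_decomposition:
  "gram_hessian_form k n C d - \<mu> * (\<Sum>i<n. dot k (d i) (d i)) =
    off_diag_weight h pi \<mu> X K * off_diag_squares
    + (a - b)\<^sup>2 * inverse (area_value (block_block K)) * (\<Sum>i<m. \<Sum>j<i. (d i j + d j i)\<^sup>2)
    + (\<Sum>i<m. quad_form (local_form h pi \<mu> X K) (local_coords i)) + quad_form (global_form h pi \<mu> X K) global_coords"
proof -
  let ?t = "\<lambda>i j. (d i j - C i j * (dot k (C i) (d i) / dot k (C i) (C i)))\<^sup>2 / area (dot k (C i) (C i)) 1 (C i j)"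
  have couplings: "(\<Sum>i<n. \<Sum>j<i. relu_kernel_coupling k (C i) (C j) (d i) (d j)) =
      (\<Sum>i<m. \<Sum>j<i. relu_kernel_coupling k (C i) (C j) (d i) (d j))
      + (\<Sum>r<h. (\<Sum>i<m. quad_form (extra_coupling_local X (extra_block K r) r) (local_coords i))
          + quad_form (extra_coupling_global h X (extra_block K r) r) global_coords
          + (\<Sum>t<r. (\<Sum>i<m. quad_form (extra_pair_local (extra_extra K r t) r t) (local_coords i))
            + quad_form (extra_pair_global h X (extra_extra K r t) r t) global_coords))"
    unfolding sum_pairs_split by (simp add: extra_coupling extra_pair)
  have "(\<Sum>i<n. \<Sum>j<k. ?t i j)
      = (\<Sum>i<m. \<Sum>j<k. (d i j - C i j * (block_part i / block_sq_norm X))\<^sup>2 / area (block_sq_norm X) 1 (C i j))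
        + (\<Sum>r<h. \<Sum>j<k. (d (m + r) j - C (m + r) j * (extra_part r / extra_inner X r r))\<^sup>2 / area (extra_inner X r r) 1
          (C (m + r) j))"
    by (simp add: sum_lessThan_add gram dot_block_part dot_extra_part del: sum.lessThan_Suc)
  hence targets: "(\<Sum>i<n. \<Sum>j<k. ?t i j) = inverse (area_value (block_target_off K)) * (\<Sum>i<m. dot k (d i) (d i))
      - (\<Sum>i<m. quad_form (block_target_local X K) (local_coords i))
      + (\<Sum>r<h. - (\<Sum>i<m. quad_form (extra_target_local K r) (local_coords i))
        - quad_form (extra_target_global h X K r) global_coords)"
    unfolding block_targets by (simp add: extra_targets del: sum.lessThan_Suc times_divide_eq_right)
  have "gram_hessian_form k n C d - \<mu> * (\<Sum>i<n. dot k (d i) (d i))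
      = ((\<Sum>i<n. gram_multiplier k n C i * dot k (d i) (d i)
          - (gram_multiplier k n C i - pi) / dot k (C i) (C i) * (dot k (C i) (d i))\<^sup>2) - \<mu> * (\<Sum>i<n. dot k (d i) (d i)))
        + (\<Sum>i<n. \<Sum>j<i. relu_kernel_coupling k (C i) (C j) (d i) (d j)) - (\<Sum>i<n. \<Sum>j<k. ?t i j)"
    unfolding gram_hessian_form_eq by simp
  also have "\<dots> = off_diag_weight h pi \<mu> X K * off_diag_squares
    + (a - b)\<^sup>2 * inverse (area_value (block_block K)) * (\<Sum>i<m. \<Sum>j<i. (d i j + d j i)\<^sup>2)
    + (\<Sum>i<m. quad_form (local_form h pi \<mu> X K) (local_coords i)) + quad_form (global_form h pi \<mu> X K) global_coords"
    unfolding gram_hessian_form_diagonal couplings targets block_coupling sum_quad_form_local quad_form_global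
      off_diag_weight_def sum_dot_block
    by (simp add: sum.distrib sum_subtractf sum_negf algebra_simps)
  finally show ?thesis .
qed

definition "centered_coords i = map (\<lambda>f. f i - inverse (real m) * (\<Sum>j<m. f j)) ((\<lambda>i. row_sum i - col_sum i)
  # coord_funs)"

lemma apply_form_centered:
  "apply_form l (centered_coords i)
    = apply_form l (local_coords i) - inverse (real m) * (\<Sum>j<m. apply_form l (local_coords j))"
proof -
  have "apply_form l (map (\<lambda>f. f i - inverse (real m) * (\<Sum>j<m. f j)) fs)
      = apply_form l (map (\<lambda>f. f i) fs) - inverse (real m) * apply_form l (map (\<lambda>f. \<Sum>j<m. f j) fs)" for fs
  proof (induction fs arbitrary: l)
    case (Cons f fs)
    thus ?case by (cases l) (simp_all add: algebra_simps)
  qed simp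
  from this[of "(\<lambda>i. row_sum i - col_sum i) # coord_funs"] show ?thesis
    unfolding centered_coords_def apply_form_sum by (simp add: local_coords_def)
qed

lemma sum_quad_form_centered:
  "(\<Sum>i<m. quad_form fs (centered_coords i))
    = (\<Sum>i<m. quad_form fs (local_coords i)) - quad_form (lift_quad_form h (inverse (real m)) fs) global_coords"
proof (induction fs)
  case (Cons f fs)
  obtain \<kappa> l l' where f: "f = (\<kappa>, l, l')" by (cases f)
  have "0 < m" using size(1) by simp
  have "(\<Sum>i<m. quad_form (f # fs) (centered_coords i))
    = \<kappa> * (\<Sum>i<m. apply_form l (centered_coords i) * apply_form l' (centered_coords i))
      + (\<Sum>i<m. quad_form fs (centered_coords i))"
    by (simp add: f sum.distrib sum_distrib_left)
  thus ?case
    unfolding Cons.IH apply_form_centered centered_product_sum[OF \<open>0 < m\<close>]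
    by (simp add: f lift_quad_form_def apply_lift_form sum.distrib right_diff_distrib flip: sum_distrib_left)
qed (simp add: lift_quad_form_def)

lemma off_diag_lower:
  assumes "0 \<le> antisymmetric_weight h pi \<mu> X K" "0 \<le> symmetric_weight h pi \<mu> X K"
  shows "off_diag_weight h pi \<mu> X K * off_diag_squares
      + (a - b)\<^sup>2 * inverse (area_value (block_block K)) * (\<Sum>i<m. \<Sum>j<i. (d i j + d j i)\<^sup>2)
    \<ge> (\<Sum>i<m. quad_form (off_diag_local h pi \<mu> X K) (local_coords i))
      + quad_form (off_diag_global h pi \<mu> X K) global_coords"
proof -
  let ?G = "\<Sum>i<m. \<Sum>j<i. (d i j + d j i)\<^sup>2" and ?H = "\<Sum>i<m. \<Sum>j<i. (d i j - d j i)\<^sup>2"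
  let ?g = "\<lambda>i. row_sum i + col_sum i - 2 * d i i" and ?w = "\<lambda>i. row_sum i - col_sum i"
  let ?s = "symmetric_weight h pi \<mu> X K" and ?t = "antisymmetric_weight h pi \<mu> X K"
  have "(\<Sum>i<m. (?g i)\<^sup>2) / (real m - 2) - (\<Sum>i<m. ?g i)\<^sup>2 / (2 * (real m - 1) * (real m - 2)) \<le> ?G"
    unfolding row_sum_def col_sum_def by (rule sum_symmetric_square_lower[OF size(1)])
  hence symmetric: "?s * ((\<Sum>i<m. (?g i)\<^sup>2) / (real m - 2) - (\<Sum>i<m. ?g i)\<^sup>2 / (2 * (real m - 1) * (real m - 2)))
    \<le> ?s * ?G"
    using assms(2) by (rule mult_left_mono)
  have "(\<Sum>i<m. (?w i)\<^sup>2) / real m \<le> ?H"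
    unfolding row_sum_def col_sum_def by (rule sum_antisymmetric_square_lower) (use size(1) in simp)
  hence antisymmetric: "?t * ((\<Sum>i<m. (?w i)\<^sup>2) / real m) \<le> ?t * ?H"
    using assms(1) by (rule mult_left_mono)
  have w: "apply_form (coord_form 0 1) (local_coords i) = ?w i" for i by (simp add: coord_form_def local_coords_def)
  have "(\<Sum>i<m. quad_form (off_diag_local h pi \<mu> X K) (local_coords i))
    = ?s / (real m - 2) * (\<Sum>i<m. (?g i)\<^sup>2) + ?t / real m * (\<Sum>i<m. (?w i)\<^sup>2)"
    unfolding sum_distrib_left sum.distrib[symmetric]
    by (simp add: off_diag_local_def apply_forms w size power2_eq_square)
  moreover have "quad_form (off_diag_global h pi \<mu> X K) global_coords
    = - ?s / (2 * (real m - 1) * (real m - 2)) * (\<Sum>i<m. ?g i)\<^sup>2"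
    by (simp add: off_diag_global_def apply_forms size power2_eq_square)
  ultimately have "(\<Sum>i<m. quad_form (off_diag_local h pi \<mu> X K) (local_coords i))
    + quad_form (off_diag_global h pi \<mu> X K) global_coords
      = ?s * ((\<Sum>i<m. (?g i)\<^sup>2) / (real m - 2) - (\<Sum>i<m. ?g i)\<^sup>2 / (2 * (real m - 1) * (real m - 2)))
        + ?t * ((\<Sum>i<m. (?w i)\<^sup>2) / real m)"
    by (simp add: right_diff_distrib)
  also have "\<dots> \<le> ?s * ?G + ?t * ?H" using symmetric antisymmetric by (rule add_mono)
  also have "\<dots> = off_diag_weight h pi \<mu> X K * off_diag_squares + (a - b)\<^sup>2 * inverse (area_value (block_block K)) * ?G"
    unfolding off_diag_squares_def sum_off_diagonal_squares
    by (simp add: symmetric_weight_def antisymmetric_weight_def power2_eq_square field_simps)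
  finally show ?thesis .
qed

lemma gram_hessian_form_lower:
  assumes weights: "0 \<le> antisymmetric_weight h pi \<mu> X K" "0 \<le> symmetric_weight h pi \<mu> X K"
    and local: "\<And>z. length z = h + 4 \<Longrightarrow> 0 \<le> quad_form (reduced_local_form h pi \<mu> X K) z"
    and global: "\<And>z. length z = h + 3 + h \<Longrightarrow> 0 \<le> quad_form
      (reduced_global_form h pi \<mu> X K (reduced_local_form h pi \<mu> X K)) z"
  shows "\<mu> * (\<Sum>i<n. dot k (d i) (d i)) \<le> gram_hessian_form k n C d"
proof -
  let ?l = "reduced_local_form h pi \<mu> X K"
  have "0 \<le> (\<Sum>i<m. quad_form ?l (centered_coords i))"
    by (intro sum_nonneg local) (simp add: centered_coords_def coord_funs_def)
  moreover have "0 \<le> quad_form (reduced_global_form h pi \<mu> X K ?l) global_coords"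
    by (rule global) (simp add: global_coords_def coord_funs_def)
  ultimately have "0 \<le> (\<Sum>i<m. quad_form (off_diag_local h pi \<mu> X K) (local_coords i))
    + quad_form (off_diag_global h pi \<mu> X K) global_coords
      + (\<Sum>i<m. quad_form (local_form h pi \<mu> X K) (local_coords i)) + quad_form (global_form h pi \<mu> X K) global_coords"
    unfolding sum_quad_form_centered by (simp add: reduced_local_form_def reduced_global_form_def size sum.distrib)
  also have "\<dots> \<le> gram_hessian_form k n C d - \<mu> * (\<Sum>i<n. dot k (d i) (d i))"
    unfolding gram_hessian_form_decomposition using off_diag_lower[OF weights] by simp
  finally show ?thesis by simp
qed

end

section \<open>Interval arithmetic\<close>

text \<open>\<open>Iv a r\<close> is the interval of radius \<open>r\<close> about \<open>a\<close>, both in units of \<open>2 ^ - LENGTH('b)\<close>; \<open>Any\<close> is the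
  whole line, which makes the partial operations total.\<close>

datatype 'b iv = Iv int int | Any

fun approximates :: "real \<Rightarrow> 'b::len iv \<Rightarrow> bool" where
  "approximates x (Iv a r :: 'b iv) \<longleftrightarrow> \<bar>x * 2 ^ LENGTH('b) - real_of_int a\<bar> \<le> real_of_int r"
| "approximates x Any \<longleftrightarrow> True"

instantiation iv :: (len) arith
begin

definition zero_iv :: "'a iv" where "zero_iv = Iv 0 0"

definition one_iv :: "'a iv" where "one_iv = Iv (push_bit LENGTH('a) 1) 0"

fun plus_iv :: "'a iv \<Rightarrow> 'a iv \<Rightarrow> 'a iv" where
  "Iv a r + Iv b q = Iv (a + b) (r + q)"
| "Any + Y = Any"
| "X + Any = Any"

fun minus_iv :: "'a iv \<Rightarrow> 'a iv \<Rightarrow> 'a iv" where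
  "Iv a r - Iv b q = Iv (a - b) (r + q)"
| "Any - Y = Any"
| "X - Any = Any"

fun uminus_iv :: "'a iv \<Rightarrow> 'a iv" where
  "- Iv a r = Iv (- a) r"
| "- Any = Any"

fun times_iv :: "'a iv \<Rightarrow> 'a iv \<Rightarrow> 'a iv" where
  "Iv a r * Iv b q = (if a = 0 \<and> r = 0 \<or> b = 0 \<and> q = 0 then Iv 0 0
     else Iv (drop_bit LENGTH('a) (a * b)) (drop_bit LENGTH('a) (\<bar>a\<bar> * q + \<bar>b\<bar> * r + r * q) + 2))"
| "Any * Y = Any"
| "X * Any = Any"

fun inverse_iv :: "'a iv \<Rightarrow> 'a iv" where
  "inverse (Iv a r) = (if 0 \<le> r \<and> r < a then
     let one = push_bit (2 * LENGTH('a)) 1; y = one div a in Iv y ((\<bar>one - a * y\<bar> + \<bar>y\<bar> * r) div (a - r) + 1)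
     else Any)"
| "inverse Any = Any"

definition divide_iv :: "'a iv \<Rightarrow> 'a iv \<Rightarrow> 'a iv" where "divide_iv X Y = X * inverse Y"

instance proof
  fix X Y Z :: "'a iv"
  show "X + Y + Z = X + (Y + Z)" by (cases X; cases Y; cases Z) auto
  show "X + Y = Y + X" by (cases X; cases Y) auto
  show "0 + X = X" by (cases X) (auto simp: zero_iv_def)
qed

end

lemma drop_bit_error: "\<bar>real_of_int x / 2 ^ n - real_of_int (drop_bit n x)\<bar> \<le> 1"
proof -
  have "drop_bit n x = \<lfloor>real_of_int x / 2 ^ n\<rfloor>"
    using floor_divide_of_int_eq[of x "2 ^ n", where 'a = real] by (simp add: drop_bit_eq_div)
  thus ?thesis by linarith
qed

lemma abs_diff_le_drop_bit:
  assumes "\<bar>x * 2 ^ n - real_of_int a\<bar> \<le> real_of_int r"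
  shows "\<bar>x - real_of_int (drop_bit n a)\<bar> \<le> real_of_int (drop_bit n r + 2)"
proof -
  have "x - real_of_int a / 2 ^ n = (x * 2 ^ n - real_of_int a) / 2 ^ n" by (simp add: field_simps)
  hence "\<bar>x - real_of_int a / 2 ^ n\<bar> \<le> real_of_int r / 2 ^ n"
    using assms by (simp add: divide_right_mono)
  thus ?thesis using drop_bit_error[of a n] drop_bit_error[of r n] by linarith
qed

lemma approximates_zero: "approximates 0 0"
  by (simp add: zero_iv_def)

lemma approximates_one: "approximates 1 1"
  by (simp add: one_iv_def push_bit_eq_mult)

lemma approximates_add: "approximates x X \<Longrightarrow> approximates y Y \<Longrightarrow> approximates (x + y) (X + Y)"
  by (cases X; cases Y) (auto simp: distrib_right)

lemma approximates_diff: "approximates x X \<Longrightarrow> approximates y Y \<Longrightarrow> approximates (x - y) (X - Y)"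
  by (cases X; cases Y) (auto simp: left_diff_distrib)

lemma approximates_minus: "approximates x X \<Longrightarrow> approximates (- x) (- X)"
  by (cases X) auto

lemma approximates_mult:
  assumes "approximates x (X :: 'b::len iv)" "approximates y Y"
  shows "approximates (x * y) (X * Y)"
proof (cases X; cases Y)
  fix a r b q assume X: "X = Iv a r" and Y: "Y = Iv b q"
  define u where "u = x * 2 ^ LENGTH('b) - a"
  define v where "v = y * 2 ^ LENGTH('b) - b"
  have bounds: "\<bar>u\<bar> \<le> r" "\<bar>v\<bar> \<le> q" using assms by (simp_all add: X Y u_def v_def)
  have "x * y * 2 ^ LENGTH('b) * 2 ^ LENGTH('b) - real_of_int (a * b) = a * v + b * u + u * v"
    by (simp add: u_def v_def algebra_simps)
  moreover have "\<bar>a * v\<bar> \<le> \<bar>a\<bar> * q" "\<bar>b * u\<bar> \<le> \<bar>b\<bar> * r" "\<bar>u * v\<bar> \<le> real_of_int r * q"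
    using bounds by (simp_all add: abs_mult_le)
  ultimately have "\<bar>x * y * 2 ^ LENGTH('b) * 2 ^ LENGTH('b) - real_of_int (a * b)\<bar>
    \<le> real_of_int (\<bar>a\<bar> * q + \<bar>b\<bar> * r + r * q)"
    by simp
  hence "\<bar>x * y * 2 ^ LENGTH('b) - real_of_int (drop_bit LENGTH('b) (a * b))\<bar>
      \<le> real_of_int (drop_bit LENGTH('b) (\<bar>a\<bar> * q + \<bar>b\<bar> * r + r * q) + 2)"
    by (rule abs_diff_le_drop_bit)
  thus ?thesis using assms by (auto simp: X Y)
qed simp_all

lemma le_div_add_one_mult: "0 < c \<Longrightarrow> e \<le> (e div c + 1) * c" for c e :: int
  by (simp add: distrib_right less_imp_le flip: minus_mod_eq_div_mult)

text \<open>From \<open>(a + u) (1 / x) = 1\<close> in units of \<open>1 / P\<close>, \<open>(a + u) (1 / x - y) = P\<^sup>2 - a y - u y\<close>.\<close>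

lemma abs_inverse_diff_le:
  fixes x P a r y t :: real
  assumes x: "\<bar>x * P - a\<bar> \<le> r" "r < a" "0 < P" and t: "\<bar>P * P - a * y\<bar> + \<bar>y\<bar> * r \<le> t * (a - r)" "0 \<le> t"
  shows "\<bar>inverse x * P - y\<bar> \<le> t"
proof -
  define u where "u = x * P - a"
  have pos: "a - r \<le> a + u" "0 < a + u" using x(1,2) by (auto simp: u_def abs_le_iff)
  hence "0 < x" using x(3) by (simp add: u_def zero_less_mult_iff)
  hence "(a + u) * (inverse x * P - y) = (P * P - a * y) - u * y" by (simp add: u_def field_simps)
  hence "\<bar>inverse x * P - y\<bar> * (a + u) = \<bar>(P * P - a * y) - u * y\<bar>"
    using pos(2) by (metis abs_mult abs_of_pos mult.commute)
  also have "\<dots> \<le> \<bar>P * P - a * y\<bar> + \<bar>y\<bar> * r"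
    using abs_mult_le[of u r y "\<bar>y\<bar>"] x(1) by (simp add: u_def mult.commute)
  also have "\<dots> \<le> t * (a - r)" by (rule t(1))
  also have "\<dots> \<le> t * (a + u)" using pos(1) t(2) by (rule mult_left_mono)
  finally show ?thesis using pos(2) by (simp add: mult_le_cancel_right)
qed

lemma approximates_inverse:
  assumes "approximates x (X :: 'b::len iv)"
  shows "approximates (inverse x) (inverse X)"
proof (cases X)
  case (Iv a r)
  show ?thesis
  proof (cases "0 \<le> r \<and> r < a")
    case True
    define one :: int where "one = push_bit (2 * LENGTH('b)) 1"
    define y where "y = one div a"
    define t where "t = (\<bar>one - a * y\<bar> + \<bar>y\<bar> * r) div (a - r) + 1"
    have one: "real_of_int one = 2 ^ LENGTH('b) * 2 ^ LENGTH('b)"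
      by (simp add: one_def push_bit_eq_mult power_add[symmetric] mult_2)
    have "\<bar>one - a * y\<bar> + \<bar>y\<bar> * r \<le> t * (a - r)" unfolding t_def using True by (intro le_div_add_one_mult) simp
    hence "real_of_int (\<bar>one - a * y\<bar> + \<bar>y\<bar> * r) \<le> real_of_int (t * (a - r))" by (simp only: of_int_le_iff)
    moreover have "0 \<le> t" using True by (simp add: t_def pos_imp_zdiv_nonneg_iff)
    ultimately have "\<bar>inverse x * 2 ^ LENGTH('b) - y\<bar> \<le> t"
      using assms True by (intro abs_inverse_diff_le[of x "2 ^ LENGTH('b)" a r]) (simp_all add: Iv one)
    moreover have "inverse X = Iv y t" using True by (simp add: Iv one_def y_def t_def Let_def)
    ultimately show ?thesis by simp
  qed (auto simp: Iv)
qed simp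

lemma approximates_divide: "approximates x X \<Longrightarrow> approximates y Y \<Longrightarrow> approximates (x / y) (X / Y)"
  by (simp add: divide_iv_def divide_inverse approximates_mult approximates_inverse)

fun iv_positive :: "'b iv \<Rightarrow> bool" where
  "iv_positive (Iv a r) \<longleftrightarrow> r < a"
| "iv_positive Any \<longleftrightarrow> False"

fun iv_at_least :: "int \<Rightarrow> int \<Rightarrow> 'b::len iv \<Rightarrow> bool" where
  "iv_at_least n d (Iv a r :: 'b iv) \<longleftrightarrow> push_bit LENGTH('b) n \<le> d * (a - r)"
| "iv_at_least n d Any \<longleftrightarrow> False"

lemma iv_positive: "approximates x (X :: 'b::len iv) \<Longrightarrow> iv_positive X \<Longrightarrow> 0 < x"
proof (cases X)
  case (Iv a r)
  assume "approximates x X" "iv_positive X"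
  hence "0 < x * 2 ^ LENGTH('b)" by (simp add: Iv abs_le_iff)
  thus ?thesis by (simp add: zero_less_mult_iff)
qed simp

lemma iv_at_least:
  assumes "approximates x (X :: 'b::len iv)" "iv_at_least n d X" "0 < d"
  shows "real_of_int n / real_of_int d \<le> x"
proof (cases X)
  case (Iv a r)
  have "real_of_int (n * 2 ^ LENGTH('b)) \<le> real_of_int (d * (a - r))"
    using assms(2) unfolding Iv by (simp only: iv_at_least.simps push_bit_eq_mult of_int_le_iff)
  also have "\<dots> \<le> d * (x * 2 ^ LENGTH('b))"
    using assms(1,3) unfolding of_int_mult by (intro mult_left_mono) (auto simp: Iv abs_le_iff)
  finally show ?thesis using assms(3) by (simp add: field_simps)
qed (use assms(2) in simp)

fun iv_chop :: "'b::len iv \<Rightarrow> 'c::len iv" where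
  "iv_chop (Iv a r :: 'b iv) = (if LENGTH('c) \<le> LENGTH('b)
     then Iv (drop_bit (LENGTH('b) - LENGTH('c)) a) (drop_bit (LENGTH('b) - LENGTH('c)) r + 2) else Any)"
| "iv_chop Any = Any"

lemma approximates_chop:
  assumes "approximates x (X :: 'b::len iv)"
  shows "approximates x (iv_chop X :: 'c::len iv)"
proof (cases X)
  case (Iv a r)
  show ?thesis
  proof (cases "LENGTH('c) \<le> LENGTH('b)")
    case True
    hence "(2 :: real) ^ LENGTH('b) = 2 ^ LENGTH('c) * 2 ^ (LENGTH('b) - LENGTH('c))" by (simp flip: power_add)
    hence "\<bar>x * 2 ^ LENGTH('c) * 2 ^ (LENGTH('b) - LENGTH('c)) - a\<bar> \<le> r" using assms by (simp add: Iv mult.assoc)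
    thus ?thesis using abs_diff_le_drop_bit True by (simp add: Iv)
  qed (simp add: Iv)
qed simp

text \<open>\<open>y\<close> is a guess of the square root, and the radius is enough for roots above \<open>1 / 10\<close>.\<close>

fun iv_sqrt :: "int \<Rightarrow> 'b::len iv \<Rightarrow> 'b iv" where
  "iv_sqrt y (Iv a r :: 'b iv) = (let q = 5 * (r + 1); u = y - q; v = y + q in
     if 0 \<le> u \<and> u * u \<le> push_bit LENGTH('b) (a - r) \<and> push_bit LENGTH('b) (a + r) \<le> v * v then Iv y q else Any)"
| "iv_sqrt y Any = Any"

lemma approximates_sqrt:
  assumes "approximates x (X :: 'b::len iv)"
  shows "approximates (sqrt x) (iv_sqrt y X)"
proof (cases X)
  case (Iv a r)
  define P where "P = (2 ^ LENGTH('b) :: real)"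
  have "0 < P" by (simp add: P_def)
  define q where "q = 5 * (r + 1)"
  have "0 \<le> real_of_int r" using assms unfolding Iv approximates.simps by (rule order_trans[OF abs_ge_zero])
  hence "0 \<le> q" by (simp add: q_def)
  show ?thesis
  proof (cases "iv_sqrt y X = Any")
    case False
    hence bounds: "0 \<le> y - q" "(y - q) * (y - q) \<le> push_bit LENGTH('b) (a - r)"
      "push_bit LENGTH('b) (a + r) \<le> (y + q) * (y + q)" and hint: "iv_sqrt y X = Iv y q"
      by (auto simp: Iv Let_def q_def split: if_splits)
    have "real_of_int (a - r) \<le> x * P" "x * P \<le> real_of_int (a + r)" using assms by (auto simp: Iv P_def abs_le_iff)
    hence "real_of_int (a - r) * P \<le> x * P\<^sup>2" "x * P\<^sup>2 \<le> real_of_int (a + r) * P"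
      using \<open>0 < P\<close> by (auto simp: power2_eq_square mult.assoc[symmetric])
    moreover have "(real_of_int (y - q))\<^sup>2 \<le> real_of_int (a - r) * P" "real_of_int (a + r) * P
      \<le> (real_of_int (y + q))\<^sup>2"
      using iffD2[OF of_int_le_iff[where 'a = real] bounds(2)] iffD2[OF of_int_le_iff[where 'a = real] bounds(3)]
      by (simp_all add: push_bit_eq_mult P_def power2_eq_square)
    ultimately have "real_of_int (y - q) \<le> sqrt (x * P\<^sup>2)" "sqrt (x * P\<^sup>2) \<le> real_of_int (y + q)"
      using bounds(1) \<open>0 \<le> q\<close> by (auto intro!: real_le_rsqrt real_le_lsqrt)
    moreover have "sqrt (x * P\<^sup>2) = sqrt x * P" using \<open>0 < P\<close> by (simp add: real_sqrt_mult)
    ultimately show ?thesis unfolding hint by (simp add: P_def abs_le_iff)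
  qed simp
qed simp

fun horner :: "'a::arith list \<Rightarrow> 'a \<Rightarrow> 'a" where
  "horner [] y = 0"
| "horner (c # cs) y = c + y * horner cs y"

lemma approximates_horner:
  assumes "list_all2 approximates cs Cs" "approximates y Y"
  shows "approximates (horner cs y) (horner Cs Y)"
  using assms(1) by (induction rule: list_all2_induct)
    (simp_all add: approximates_zero approximates_add approximates_mult assms(2))

definition cos_coeffs :: "real list" where
  "cos_coeffs = map (\<lambda>j. (- 1) ^ j / fact (2 * j)) [0..<10]"

definition sin_coeffs :: "real list" where
  "sin_coeffs = map (\<lambda>j. (- 1) ^ j / fact (2 * j + 1)) [0..<10]"

lemma horner_map_upt: "horner (map f [a..<a + n]) y = (\<Sum>j<n. f (a + j) * y ^ j)" for y :: real
proof (induction n arbitrary: a)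
  case (Suc n)
  have "horner (map f [a..<a + Suc n]) y = f a + y * horner (map f [Suc a..<Suc a + n]) y"
    by (simp add: upt_conv_Cons del: upt_Suc)
  also have "\<dots> = f a + (\<Sum>j<n. f (a + Suc j) * y ^ Suc j)"
    unfolding Suc.IH by (simp add: sum_distrib_left mult.left_commute)
  also have "\<dots> = (\<Sum>j<Suc n. f (a + j) * y ^ j)" by (subst sum.lessThan_Suc_shift) simp
  finally show ?case .
qed simp

lemma abs_cos_diff_horner_le:
  assumes "\<bar>h\<bar> \<le> 1"
  shows "\<bar>cos h - horner cos_coeffs (h\<^sup>2)\<bar> \<le> 1 / fact 20"
proof -
  obtain t where t: "cos h = (\<Sum>m<20. cos_coeff m * h ^ m) + cos (t + 1 / 2 * real 20 * pi) / fact 20 * h ^ 20"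
    using Maclaurin_cos_expansion[of h 20] by blast
  have "(\<Sum>m<2 * n. cos_coeff m * h ^ m) = (\<Sum>j<n. (- 1) ^ j / fact (2 * j) * (h\<^sup>2) ^ j)" for n
    by (induction n) (simp_all add: cos_coeff_def power_mult)
  from this[of 10] have "(\<Sum>m<20. cos_coeff m * h ^ m) = horner cos_coeffs (h\<^sup>2)"
    unfolding cos_coeffs_def using horner_map_upt[of "\<lambda>j. (- 1) ^ j / fact (2 * j)" 0 10 "h\<^sup>2"] by simp
  hence "\<bar>cos h - horner cos_coeffs (h\<^sup>2)\<bar> = \<bar>cos (t + 1 / 2 * real 20 * pi)\<bar> * \<bar>h\<bar> ^ 20 / fact 20"
    using t by (simp add: abs_mult power_abs)
  also have "\<dots> \<le> 1 * 1 / fact 20"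
    using assms by (intro divide_right_mono mult_mono power_le_one) auto
  finally show ?thesis by simp
qed

lemma abs_sin_diff_horner_le:
  assumes "\<bar>h\<bar> \<le> 1"
  shows "\<bar>sin h - h * horner sin_coeffs (h\<^sup>2)\<bar> \<le> 1 / fact 20"
proof -
  obtain t where t: "sin h = (\<Sum>m<20. sin_coeff m * h ^ m) + sin (t + 1 / 2 * real 20 * pi) / fact 20 * h ^ 20"
    using Maclaurin_sin_expansion[of h 20] by blast
  have "(\<Sum>m<2 * n. sin_coeff m * h ^ m) = h * (\<Sum>j<n. (- 1) ^ j / fact (2 * j + 1) * (h\<^sup>2) ^ j)" for n
    by (induction n) (simp_all add: sin_coeff_def power_mult distrib_left)
  from this[of 10] have "(\<Sum>m<20. sin_coeff m * h ^ m) = h * horner sin_coeffs (h\<^sup>2)"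
    unfolding sin_coeffs_def using horner_map_upt[of "\<lambda>j. (- 1) ^ j / fact (2 * j + 1)" 0 10 "h\<^sup>2"] by simp
  hence "\<bar>sin h - h * horner sin_coeffs (h\<^sup>2)\<bar> = \<bar>sin (t + 1 / 2 * real 20 * pi)\<bar> * \<bar>h\<bar> ^ 20 / fact 20"
    using t by (simp add: abs_mult power_abs)
  also have "\<dots> \<le> 1 * 1 / fact 20"
    using assms by (intro divide_right_mono mult_mono power_le_one) auto
  finally show ?thesis by simp
qed

definition iv_cos_coeffs :: "56 iv list" where
  "iv_cos_coeffs = map (\<lambda>a. Iv a 1) [72057594037927936, -36028797018963968, 3002399751580331, -100079991719344,
     1787142709274, -19857141214, 150432888, -826554, 3444, -11]"

definition iv_sin_coeffs :: "56 iv list" where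
  "iv_sin_coeffs = map (\<lambda>a. Iv a 1) [72057594037927936, -12009599006321323, 600479950316066, -14297141674192,
     198571412142, -1805194656, 11571761, -55104, 203, -1]"

lemma approximates_coeffs:
  "list_all2 approximates cos_coeffs iv_cos_coeffs" "list_all2 approximates sin_coeffs iv_sin_coeffs"
  by (simp_all add: cos_coeffs_def iv_cos_coeffs_def sin_coeffs_def iv_sin_coeffs_def abs_le_iff upt_rec fact_numeral)

fun iv_widen :: "'b iv \<Rightarrow> 'b iv" where
  "iv_widen (Iv a r) = Iv a (r + 1)"
| "iv_widen Any = Any"

lemma approximates_widen: "approximates x X \<Longrightarrow> \<bar>y - x\<bar> \<le> 1 / fact 20 \<Longrightarrow> approximates y (iv_widen X :: 56 iv)"
  by (cases X) (auto simp: fact_numeral abs_if split: if_splits)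

definition iv_cos :: "56 iv \<Rightarrow> 56 iv" where
  "iv_cos H = iv_widen (horner iv_cos_coeffs (H * H))"

definition iv_sin :: "56 iv \<Rightarrow> 56 iv" where
  "iv_sin H = iv_widen (H * horner iv_sin_coeffs (H * H))"

lemma approximates_cos_sin:
  assumes "approximates h H" "\<bar>h\<bar> \<le> 1"
  shows "approximates (cos h) (iv_cos H)" "approximates (sin h) (iv_sin H)"
  unfolding iv_cos_def iv_sin_def
  using assms abs_cos_diff_horner_le[OF assms(2)] abs_sin_diff_horner_le[OF assms(2)]
  by (auto simp: power2_eq_square intro!: approximates_widen approximates_horner approximates_coeffs approximates_mult)

lemma abs_arctan_diff_le:
  fixes s D \<phi> :: real
  assumes "0 < D" and pos: "0 < D * cos \<phi> + s * sin \<phi>" and "\<bar>\<phi>\<bar> \<le> 2"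
  shows "\<bar>arctan (s / D) - \<phi>\<bar> \<le> \<bar>s * cos \<phi> - D * sin \<phi>\<bar> / (D * cos \<phi> + s * sin \<phi>)"
proof -
  define \<alpha> where "\<alpha> = arctan (s / D)"
  define \<rho> where "\<rho> = D / cos \<alpha>"
  have "0 < cos \<alpha>" unfolding \<alpha>_def by (rule cos_gt_zero_pi) (use arctan_lbound arctan_ubound in auto)
  moreover have "sin \<alpha> / cos \<alpha> = s / D" using tan_arctan[of "s / D"] by (simp add: \<alpha>_def tan_def)
  ultimately have polar: "0 < \<rho>" "D = \<rho> * cos \<alpha>" "s = \<rho> * sin \<alpha>" using \<open>0 < D\<close> by (auto simp: \<rho>_def field_simps)
  have sub: "s * cos \<phi> - D * sin \<phi> = \<rho> * sin (\<alpha> - \<phi>)" "D * cos \<phi> + s * sin \<phi> = \<rho> * cos (\<alpha> - \<phi>)"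
    unfolding polar(2,3) sin_diff cos_diff by (simp_all add: algebra_simps)
  have "0 < cos (\<alpha> - \<phi>)" using pos polar(1) unfolding sub by (simp add: zero_less_mult_iff)
  have "\<bar>\<alpha>\<bar> < pi / 2" unfolding \<alpha>_def using arctan_bounded[of "s / D"] by auto
  have "\<bar>\<alpha> - \<phi>\<bar> < pi / 2"
  proof (rule ccontr)
    assume "\<not> \<bar>\<alpha> - \<phi>\<bar> < pi / 2"
    moreover have "\<bar>\<alpha> - \<phi>\<bar> \<le> 3 * pi / 2" using \<open>\<bar>\<alpha>\<bar> < pi / 2\<close> \<open>\<bar>\<phi>\<bar> \<le> 2\<close> pi_ge_two by linarith
    ultimately have "0 \<le> cos (\<bar>\<alpha> - \<phi>\<bar> - pi)" by (intro cos_ge_zero) auto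
    hence "cos \<bar>\<alpha> - \<phi>\<bar> \<le> 0" by (simp add: cos_diff)
    thus False using \<open>0 < cos (\<alpha> - \<phi>)\<close> unfolding cos_abs_real by linarith
  qed
  hence "\<alpha> - \<phi> = arctan (tan (\<alpha> - \<phi>))" by (intro arctan_tan[symmetric]) linarith+
  also have "tan (\<alpha> - \<phi>) = (s * cos \<phi> - D * sin \<phi>) / (D * cos \<phi> + s * sin \<phi>)"
    unfolding sub tan_def using polar(1) by simp
  finally have "\<bar>\<alpha> - \<phi>\<bar> \<le> \<bar>(s * cos \<phi> - D * sin \<phi>) / (D * cos \<phi> + s * sin \<phi>)\<bar>" by (metis abs_arctan_le)
  thus ?thesis using pos by (simp add: \<alpha>_def abs_divide)
qed

fun iv_radius :: "int \<Rightarrow> 'b iv \<Rightarrow> 'b iv" where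
  "iv_radius a (Iv e r) = Iv a (8 * (\<bar>e\<bar> + r))"
| "iv_radius a Any = Any"

text \<open>\<open>h\<close> is a guess of half the angle \<open>arctan (s / D)\<close>, in units of \<open>2 ^ - 56\<close>. The \<open>1 / 8\<close> checked here
  explains the factor \<open>8\<close> in \<open>iv_radius\<close>.\<close>

definition iv_arctan_quotient :: "int \<Rightarrow> 56 iv \<Rightarrow> 56 iv \<Rightarrow> 56 iv" where
  "iv_arctan_quotient h S D = (let C = iv_cos (Iv h 0); Z = iv_sin (Iv h 0); C2 = C * C - Z * Z; Z2 = Z * C + Z * C in
     if \<bar>h\<bar> \<le> 2 ^ 56 \<and> iv_positive D \<and> iv_at_least 1 8 (D * C2 + S * Z2)
     then iv_radius (2 * h) (S * C2 - D * Z2) else Any)"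

lemma approximates_arctan_quotient:
  assumes S: "approximates s S" and D: "approximates q D"
  shows "approximates (arctan (s / q)) (iv_arctan_quotient h S D)"
proof -
  define x where "x = real_of_int h / 2 ^ 56"
  define C where "C = iv_cos (Iv h 0)"
  define Z where "Z = iv_sin (Iv h 0)"
  define E where "E = S * (C * C - Z * Z) - D * (Z * C + Z * C)"
  define e where "e = s * cos (2 * x) - q * sin (2 * x)"
  show ?thesis
  proof (cases "\<bar>h\<bar> \<le> 2 ^ 56 \<and> iv_positive D \<and> iv_at_least 1 8 (D * (C * C - Z * Z) + S * (Z * C + Z * C))")
    case True
    have "real_of_int \<bar>h\<bar> \<le> real_of_int (2 ^ 56)" using True by (simp only: of_int_le_iff)
    hence x: "approximates x (Iv h 0 :: 56 iv)" "\<bar>x\<bar> \<le> 1" by (simp_all add: x_def)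
    have double: "cos (2 * x) = cos x * cos x - sin x * sin x" "sin (2 * x) = sin x * cos x + sin x * cos x"
      by (simp_all add: cos_double sin_double power2_eq_square)
    have cos_angle: "approximates (cos (2 * x)) (C * C - Z * Z)" and sin_angle: "approximates (sin (2 * x))
      (Z * C + Z * C)"
      unfolding double C_def Z_def
      by (intro approximates_add approximates_diff approximates_mult approximates_cos_sin x)+
    have "0 < q" using iv_positive[OF D] True by simp
    have "approximates (q * cos (2 * x) + s * sin (2 * x)) (D * (C * C - Z * Z) + S * (Z * C + Z * C))"
      by (intro approximates_add approximates_mult S D cos_angle sin_angle)
    from iv_at_least[OF this, of 1 8] have pos: "1 / 8 \<le> q * cos (2 * x) + s * sin (2 * x)" using True by simp
    have "approximates e E" unfolding e_def E_def by (intro approximates_diff approximates_mult S D cos_angle sin_angle)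
    have "\<bar>arctan (s / q) - 2 * x\<bar> \<le> \<bar>e\<bar> / (q * cos (2 * x) + s * sin (2 * x))"
      unfolding e_def by (rule abs_arctan_diff_le) (use \<open>0 < q\<close> pos x(2) in auto)
    also have "\<dots> \<le> \<bar>e\<bar> / (1 / 8)" using pos by (intro divide_left_mono) auto
    finally have "approximates (arctan (s / q)) (iv_radius (2 * h) E)"
      using \<open>approximates e E\<close> by (cases E) (auto simp: x_def abs_le_iff field_simps)
    thus ?thesis using True by (simp add: iv_arctan_quotient_def Let_def C_def Z_def E_def)
  qed (simp only: iv_arctan_quotient_def Let_def if_False approximates.simps flip: C_def Z_def)
qed

section \<open>Positive semidefiniteness\<close>

text \<open>The list \<open>row\<^sub>0, row\<^sub>1, \<dots>\<close> stands for the quadratic form \<open>\<Sum>\<^sub>i z\<^sub>i row\<^sub>i(z\<^sub>i, z\<^sub>i\<^sub>+\<^sub>1, \<dots>)\<close>.\<close>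

fun tri_form :: "real list list \<Rightarrow> real list \<Rightarrow> real" where
  "tri_form (r # rs) (x # xs) = x * apply_form r (x # xs) + tri_form rs xs"
| "tri_form _ _ = 0"

fun tri_add :: "'a::plus list list \<Rightarrow> 'a list list \<Rightarrow> 'a list list" where
  "tri_add [] A = A"
| "tri_add (r # rs) [] = r # rs"
| "tri_add (r # rs) (q # qs) = (r \<boxplus> q) # tri_add rs qs"

fun tri_product :: "'a::{plus,times} \<Rightarrow> 'a list \<Rightarrow> 'a list \<Rightarrow> 'a list list" where
  "tri_product \<kappa> (x # l) (y # l') = (\<kappa> * x * y # ((\<kappa> * x) \<boxdot> l' \<boxplus> (\<kappa> * y) \<boxdot> l)) # tri_product \<kappa> l l'"
| "tri_product \<kappa> _ _ = []"

definition tri_sum :: "'a::{plus,times} quad_form \<Rightarrow> 'a list list" where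
  "tri_sum fs = foldr (\<lambda>(\<kappa>, l, l'). tri_add (tri_product \<kappa> l l')) fs []"

lemma tri_form_Nil [simp]: "tri_form A [] = 0"
  by (cases A) simp_all

lemma tri_form_add: "tri_form (tri_add A B) z = tri_form A z + tri_form B z"
proof (induction A B arbitrary: z rule: tri_add.induct)
  case (3 r rs q qs)
  thus ?case by (cases z) (simp_all add: algebra_simps)
qed simp_all

lemma tri_form_product: "tri_form (tri_product \<kappa> l l') z = \<kappa> * (apply_form l z * apply_form l' z)"
proof (induction \<kappa> l l' arbitrary: z rule: tri_product.induct)
  case (1 \<kappa> x l y l')
  thus ?case by (cases z) (simp_all add: algebra_simps)
qed simp_all

lemma tri_form_sum: "tri_form (tri_sum fs) z = quad_form fs z"
  by (induction fs) (auto simp: tri_sum_def tri_form_add tri_form_product)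

text \<open>Completing the square, \<open>a x\<^sup>2 + x t + s\<close> is nonnegative if \<open>a > 0\<close> and \<open>s - t\<^sup>2 / (4 a)\<close> is.\<close>

fun positive_pivots :: "('a::arith \<Rightarrow> bool) \<Rightarrow> nat \<Rightarrow> 'a list list \<Rightarrow> bool" where
  "positive_pivots pos (Suc n) ((a # l) # rs) \<longleftrightarrow>
     pos a \<and> positive_pivots pos n (tri_add rs (tri_product (- inverse (a + a + a + a)) l l))"
| "positive_pivots pos (Suc n) ([] # rs) \<longleftrightarrow> positive_pivots pos n rs"
| "positive_pivots pos _ _ \<longleftrightarrow> True"

lemma tri_form_pivot_nonneg:
  assumes "0 < a" "0 \<le> tri_form (tri_add rs (tri_product (- inverse (a + a + a + a)) l l)) z"
  shows "0 \<le> tri_form ((a # l) # rs) (x # z)"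
proof -
  define t where "t = apply_form l z"
  have sum: "a + a + a + a = 4 * a" by simp
  have "0 \<le> (2 * a * x + t)\<^sup>2 * inverse (4 * a)" using assms(1) by simp
  also have "\<dots> = a * x * x + x * t + inverse (4 * a) * (t * t)" using assms(1)
    by (simp add: field_simps power2_eq_square)
  finally have "0 \<le> a * x * x + x * t + inverse (4 * a) * (t * t)" .
  moreover have "0 \<le> tri_form rs z - inverse (4 * a) * (t * t)"
    using assms(2) unfolding tri_form_add tri_form_product sum t_def[symmetric] by simp
  moreover have "tri_form ((a # l) # rs) (x # z) = a * x * x + x * t + tri_form rs z" by (simp add: t_def algebra_simps)
  ultimately show ?thesis by linarith
qed

section \<open>Soundness of the interval formulas\<close>

context
  includes lifting_syntax
begin

lemma arith_transfer [transfer_rule]: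
  "approximates 0 0" "approximates 1 1"
  "(approximates ===> approximates ===> approximates) (+) (+)"
  "(approximates ===> approximates ===> approximates) (-) (-)"
  "(approximates ===> approximates ===> approximates) (*) (*)"
  "(approximates ===> approximates ===> approximates) (/) (/)"
  "(approximates ===> approximates) uminus uminus"
  "(approximates ===> approximates) inverse inverse"
  by (auto intro!: rel_funI approximates_zero approximates_one approximates_add approximates_diff approximates_mult
    approximates_divide approximates_minus approximates_inverse)

lemma lin_add_transfer [transfer_rule]:
  "(list_all2 approximates ===> list_all2 approximates ===> list_all2 approximates) (\<boxplus>) (\<boxplus>)"
proof (intro rel_funI)
  fix l l' and L L' :: "'b::len iv list"
  assume "list_all2 approximates l L" "list_all2 approximates l' L'"
  thus "list_all2 approximates (l \<boxplus> l') (L \<boxplus> L')"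
  proof (induction arbitrary: l' L' rule: list_all2_induct)
    case (Cons x xs y ys)
    thus ?case by (cases l'; cases L') (auto simp: approximates_add)
  qed simp
qed

lemma lin_scale_transfer [transfer_rule]: "(approximates ===> list_all2 approximates ===> list_all2 approximates) (\<boxdot>)
  (\<boxdot>)"
  unfolding lin_scale_def by transfer_prover

lemma tri_add_transfer [transfer_rule]:
  "(list_all2 (list_all2 approximates) ===> list_all2 (list_all2 approximates) ===> list_all2 (list_all2 approximates))
    tri_add tri_add"
proof (intro rel_funI)
  fix A B and A' B' :: "'b::len iv list list"
  assume "list_all2 (list_all2 approximates) A A'" "list_all2 (list_all2 approximates) B B'"
  thus "list_all2 (list_all2 approximates) (tri_add A B) (tri_add A' B')"
  proof (induction arbitrary: B B' rule: list_all2_induct)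
    case (Cons r rs r' rs')
    thus ?case by (cases B; cases B') (auto intro: lin_add_transfer[THEN rel_funD, THEN rel_funD])
  qed simp
qed

lemma tri_product_transfer [transfer_rule]:
  "(approximates ===> list_all2 approximates ===> list_all2 approximates ===> list_all2 (list_all2 approximates))
    tri_product tri_product"
proof (intro rel_funI)
  fix \<kappa> l l' and \<kappa>' :: "'b::len iv" and L L' :: "'b iv list"
  assume \<kappa> [transfer_rule]: "approximates \<kappa> \<kappa>'"
  assume "list_all2 approximates l L" "list_all2 approximates l' L'"
  thus "list_all2 (list_all2 approximates) (tri_product \<kappa> l l') (tri_product \<kappa>' L L')"
  proof (induction arbitrary: l' L' rule: list_all2_induct)
    case (Cons x l X L)
    show ?case
    proof (cases l')
      case l': (Cons y k)
      then obtain Y M where L': "L' = Y # M" and [transfer_rule]: "approximates y Y" "list_all2 approximates k M"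
        using Cons.prems by (auto simp: list_all2_Cons1)
      have [transfer_rule]: "approximates x X" "list_all2 approximates l L" by fact+
      have "list_all2 approximates (\<kappa> * x * y # ((\<kappa> * x) \<boxdot> k \<boxplus> (\<kappa> * y) \<boxdot> l)) (\<kappa>' * X * Y
        # ((\<kappa>' * X) \<boxdot> M \<boxplus> (\<kappa>' * Y) \<boxdot> L))"
        by transfer_prover
      thus ?thesis using Cons.IH[of k M] \<open>list_all2 approximates k M\<close> by (simp add: l' L')
    qed (use Cons.prems in auto)
  qed simp
qed

abbreviation "rel_quad_form \<equiv> list_all2 (rel_prod approximates
  (rel_prod (list_all2 approximates) (list_all2 approximates)))"

lemma tri_sum_transfer [transfer_rule]: "(rel_quad_form ===> list_all2 (list_all2 approximates)) tri_sum tri_sum"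
  unfolding tri_sum_def by transfer_prover

lemma gram_family_transfer [transfer_rule]:
  "(rel_sym_point approximates ===> rel_pair_family (rel_prod approximates (rel_prod approximates approximates)))
    gram_family gram_family"
  unfolding gram_family_simps block_sq_norm_def block_inner_def extra_inner_def extra_block_inner_def by transfer_prover

lemma multiplier_transfer [transfer_rule]:
  "((=) ===> approximates ===> rel_sym_point approximates ===> rel_pair_family (rel_pair_values approximates)
    ===> approximates)
     block_multiplier block_multiplier"
  "((=) ===> approximates ===> rel_sym_point approximates ===> rel_pair_family (rel_pair_values approximates) ===> (=)
    ===> approximates)
     extra_multiplier extra_multiplier"
  unfolding block_multiplier_def extra_multiplier_def by transfer_prover+

lemma sym_gradient_transfer [transfer_rule]:
  "((=) ===> approximates ===> rel_sym_point approximates ===> rel_pair_family (rel_pair_values approximates)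
    ===> list_all2 approximates)
     sym_gradient sym_gradient"
  unfolding sym_gradient_def block_gradient_def extra_gradient_def by transfer_prover

lemma sym_loss_transfer [transfer_rule]:
  "((=) ===> approximates ===> rel_sym_point approximates ===> rel_pair_family (rel_pair_values approximates)
    ===> approximates)
     sym_loss sym_loss"
  unfolding sym_loss_def kernel_value_def by transfer_prover

lemma weight_transfer [transfer_rule]:
  "((=) ===> approximates ===> approximates ===> rel_sym_point approximates
    ===> rel_pair_family (rel_pair_values approximates) ===> approximates)
     antisymmetric_weight antisymmetric_weight"
  "((=) ===> approximates ===> approximates ===> rel_sym_point approximates
    ===> rel_pair_family (rel_pair_values approximates) ===> approximates)
     symmetric_weight symmetric_weight"
  unfolding symmetric_weight_def antisymmetric_weight_def off_diag_weight_def by transfer_prover+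

lemma form_transfer [transfer_rule]:
  "((=) ===> approximates ===> list_all2 approximates) coord_form coord_form"
  "(approximates ===> approximates ===> list_all2 approximates) row_form row_form"
  "list_all2 approximates off_row_form off_row_form"
  "((=) ===> list_all2 approximates ===> list_all2 approximates) lift_form lift_form"
  "(rel_sym_point approximates ===> list_all2 approximates) block_form block_form"
  "((=) ===> (=) ===> approximates ===> approximates ===> list_all2 approximates) extra_form extra_form"
  "((=) ===> rel_sym_point approximates ===> (=) ===> list_all2 approximates) own_form own_form"
  unfolding coord_form_def row_form_def off_row_form_def lift_form_def block_form_def own_form_def extra_form_def
  by transfer_prover+

lemma local_form_transfer [transfer_rule]:
  "((=) ===> approximates ===> approximates ===> rel_sym_point approximates
    ===> rel_pair_family (rel_pair_values approximates) ===> rel_quad_form)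
     reduced_local_form reduced_local_form"
  unfolding reduced_local_form_def off_diag_local_def local_form_def extra_local_form_def off_diag_weight_def
    block_coupling_local_def extra_coupling_local_def
    extra_pair_local_def block_target_local_def extra_target_local_def block_coupling_form_def extra_coupling_form_def
      block_target_form_def
  by transfer_prover

lemma global_form_transfer [transfer_rule]:
  "((=) ===> approximates ===> approximates ===> rel_sym_point approximates
    ===> rel_pair_family (rel_pair_values approximates) ===> rel_quad_form ===> rel_quad_form)
     reduced_global_form reduced_global_form"
  unfolding reduced_global_form_def off_diag_global_def global_form_def extra_global_form_def block_coupling_global_def
    extra_coupling_global_def
    extra_pair_global_def extra_target_global_def block_coupling_form_def extra_coupling_form_def lift_quad_form_def
  by transfer_prover

end

lemma tri_form_nonneg:
  assumes "list_all2 (list_all2 approximates) A (B :: 'b::len iv list list)" "positive_pivots iv_positive n B"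
    "length z = n"
  shows "0 \<le> tri_form A z"
  using assms
proof (induction "iv_positive :: 'b iv \<Rightarrow> bool" n B arbitrary: A z rule: positive_pivots.induct)
  case (1 n b k qs)
  then obtain a l rs where A: "A = (a # l) # rs" and [transfer_rule]: "approximates a b" "list_all2 approximates l k"
    "list_all2 (list_all2 approximates) rs qs"
    by (auto simp: list_all2_Cons2)
  obtain x z' where z: "z = x # z'" "length z' = n" using \<open>length z = Suc n\<close> by (cases z) auto
  have "list_all2 (list_all2 approximates) (tri_add rs (tri_product (- inverse (a + a + a + a)) l l))
      (tri_add qs (tri_product (- inverse (b + b + b + b)) k k))"
    by transfer_prover
  hence "0 \<le> tri_form (tri_add rs (tri_product (- inverse (a + a + a + a)) l l)) z'"
    using "1.hyps"[of _ z'] "1.prems" z by simp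
  moreover have "0 < a" using iv_positive[OF \<open>approximates a b\<close>] "1.prems" by simp
  ultimately show ?case unfolding A z(1) by (intro tri_form_pivot_nonneg)
next
  case (2 n qs)
  then obtain rs where "A = [] # rs" "list_all2 (list_all2 approximates) rs qs" by (auto simp: list_all2_Cons2)
  moreover obtain x z' where "z = x # z'" "length z' = n" using "2.prems" by (cases z) auto
  ultimately show ?case using "2.hyps" "2.prems" by simp
qed auto

lemma quad_form_nonneg:
  assumes "rel_quad_form fs (gs :: 'b::len iv quad_form)" and "positive_pivots iv_positive n (tri_sum gs)" "length z
    = n"
  shows "0 \<le> quad_form fs z"
proof -
  note [transfer_rule] = assms(1)
  have "list_all2 (list_all2 approximates) (tri_sum fs) (tri_sum gs)" by transfer_prover
  from tri_form_nonneg[OF this assms(2,3)] show ?thesis by (simp add: tri_form_sum)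
qed

section \<open>Certificates\<close>

text \<open>A certificate lists \<open>m\<close>, the entries of the symmetric rows, hints for the four kinds of pairs that
  involve only them, and for each extra row its two entries with hints for the pairs with a symmetric row,
  with the two kinds of targets and with the earlier extra rows. A hint consists of approximations of the area
  and of half the arctangent in \<open>supp_angle\<close>. The unit is \<open>2 ^ - 56\<close>.\<close>

type_synonym hint = "int \<times> int"

type_synonym extra_row = "(int \<times> int) \<times> hint list"

datatype certificate = Certificate nat "int \<times> int \<times> int" "hint list" "extra_row list"

definition extra_entry :: "('e \<Rightarrow> int) \<Rightarrow> (int \<Rightarrow> 'a) \<Rightarrow> 'a \<Rightarrow> 'e list \<Rightarrow> nat \<Rightarrow> 'a" where
  "extra_entry g f z es r = (if r < length es then f (g (es ! r)) else z)"

fun dyadic_point :: "(int \<Rightarrow> 'a) \<Rightarrow> 'a \<Rightarrow> 'a \<Rightarrow> int \<times> int \<times> int \<Rightarrow> extra_row list \<Rightarrow> 'a sym_point" where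
  "dyadic_point f z m (a, b, c) es = Sym_Point m (f a) (f b) (f c) (extra_entry (fst \<circ> fst) f z es)
    (extra_entry (snd \<circ> fst) f z es)"

definition real_point :: "nat \<Rightarrow> int \<times> int \<times> int \<Rightarrow> extra_row list \<Rightarrow> real sym_point" where
  "real_point m = dyadic_point (\<lambda>x. real_of_int x / 2 ^ 56) 0 (real m)"

definition iv_point :: "nat \<Rightarrow> int \<times> int \<times> int \<Rightarrow> extra_row list \<Rightarrow> 56 iv sym_point" where
  "iv_point m = dyadic_point (\<lambda>x. Iv x 0) Any (Iv (push_bit 56 (int m)) 0)"

lemma rel_point: "rel_sym_point approximates (real_point m abc es) (iv_point m abc es)"
  by (cases abc) (simp add: real_point_def iv_point_def extra_entry_def push_bit_eq_mult rel_fun_def)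

definition extra_hint :: "nat \<Rightarrow> extra_row list \<Rightarrow> nat \<Rightarrow> hint" where
  "extra_hint j es r = snd (es ! r) ! j"

definition extra_pair_hint :: "extra_row list \<Rightarrow> nat \<Rightarrow> nat \<Rightarrow> hint" where
  "extra_pair_hint es r t = extra_hint (3 + t) es r"

definition hint_family :: "hint list \<Rightarrow> extra_row list \<Rightarrow> hint pair_family" where
  "hint_family bs es = Pair_Family (bs ! 0) (bs ! 1) (bs ! 2) (bs ! 3) (extra_hint 0 es) (extra_hint 1 es)
    (extra_hint 2 es) (extra_pair_hint es)"

definition iv_half_pi :: "56 iv" where
  "iv_half_pi = Iv 113187804032455044 624"

definition iv_pi :: "56 iv" where
  "iv_pi = iv_half_pi + iv_half_pi"

lemma approximates_half_pi: "approximates (pi / 2) iv_half_pi"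
proof -
  have "approximates (arctan (1 / 1)) (iv_arctan_quotient 28296951008113761 1 1)"
    by (intro approximates_arctan_quotient approximates_one)
  moreover have "iv_arctan_quotient 28296951008113761 1 1 = Iv 56593902016227522 312"
    by code_simp
  ultimately show ?thesis by (simp add: arctan_one iv_half_pi_def abs_le_iff)
qed

lemma approximates_pi: "approximates pi iv_pi"
  using approximates_add[OF approximates_half_pi approximates_half_pi] by (simp add: iv_pi_def)

definition iv_values_of_area :: "int \<Rightarrow> 56 iv \<Rightarrow> 56 iv \<Rightarrow> 56 iv \<Rightarrow> 56 iv \<Rightarrow> 56 iv pair_values" where
  "iv_values_of_area w p q s D = Pair_Values p q s D (iv_half_pi + iv_arctan_quotient w s D)"

fun iv_values :: "hint \<Rightarrow> 56 iv \<times> 56 iv \<times> 56 iv \<Rightarrow> 56 iv pair_values" where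
  "iv_values (y, w) (p, q, s) = iv_values_of_area w p q s (iv_sqrt y (p * q - s * s))"

lemma rel_values:
  assumes "rel_prod approximates (rel_prod approximates approximates) v V"
  shows "rel_pair_values approximates (arc_values v) (iv_values hint V)"
proof -
  obtain p q s P Q S y w where v: "v = (p, q, s)" "V = (P, Q, S)" "hint = (y, w)" by (metis prod_cases3 surj_pair)
  have approx: "approximates p P" "approximates q Q" "approximates s S" using assms by (simp_all add: v)
  hence area: "approximates (area p q s) (iv_sqrt y (P * Q - S * S))"
    unfolding area_def power2_eq_square by (intro approximates_sqrt approximates_diff approximates_mult)
  hence "approximates (supp_angle p q s) (iv_half_pi + iv_arctan_quotient w S (iv_sqrt y (P * Q - S * S)))"
    unfolding supp_angle_def using approx by (intro approximates_add approximates_half_pi approximates_arctan_quotient)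
  thus ?thesis using approx area by (simp add: v arc_values_def iv_values_of_area_def)
qed

definition unknown_values :: "56 iv pair_values" where
  "unknown_values = Pair_Values Any Any Any Any Any"

lemma rel_unknown: "rel_pair_values approximates v unknown_values"
  by (cases v) (simp add: unknown_values_def)

fun swap_values :: "'a pair_values \<Rightarrow> 'a pair_values" where
  "swap_values (Pair_Values p q s D \<theta>) = Pair_Values q p s D \<theta>"

lemma rel_swap: "rel_pair_values approximates v V \<Longrightarrow> rel_pair_values approximates (swap_values v) (swap_values V)"
  by (cases v; cases V) simp

lemma arc_values_swap: "arc_values (q, p, s) = swap_values (arc_values (p, q, s))"
  by (simp add: arc_values_def area_commute[of p] supp_angle_commute[of p])

text \<open>Tabulation makes the evaluator compute each value once.\<close>

definition tabulated :: "56 iv pair_values list \<Rightarrow> nat \<Rightarrow> 56 iv pair_values" where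
  "tabulated vs r = (if r < length vs then vs ! r else unknown_values)"

definition tabulate :: "nat \<Rightarrow> (nat \<Rightarrow> hint) \<Rightarrow> (nat \<Rightarrow> 56 iv \<times> 56 iv \<times> 56 iv) \<Rightarrow> 56 iv pair_values list" where
  "tabulate h H G = map2 iv_values (map H [0..<h]) (map G [0..<h])"

definition tabulated_pairs :: "56 iv pair_values list list \<Rightarrow> nat \<Rightarrow> nat \<Rightarrow> 56 iv pair_values" where
  "tabulated_pairs vs r t = (if r < length vs \<and> t < r then tabulated (vs ! r) t
     else if t < length vs \<and> r < t then swap_values (tabulated (vs ! t) r) else unknown_values)"

definition tabulate_row :: "(nat \<Rightarrow> nat \<Rightarrow> hint) \<Rightarrow> (nat \<Rightarrow> nat \<Rightarrow> 56 iv \<times> 56 iv \<times> 56 iv) \<Rightarrow> nat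
  \<Rightarrow> 56 iv pair_values list" where
  "tabulate_row H G r = tabulate r (H r) (G r)"

definition iv_family :: "nat \<Rightarrow> hint pair_family \<Rightarrow> (56 iv \<times> 56 iv \<times> 56 iv) pair_family
  \<Rightarrow> 56 iv pair_values pair_family" where
  "iv_family h H G = Pair_Family (iv_values (block_block H) (block_block G))
    (iv_values (block_target_diag H) (block_target_diag G))
     (iv_values (block_target_off H) (block_target_off G)) (iv_values (block_target_last H) (block_target_last G))
     (tabulated (tabulate h (extra_block H) (extra_block G))) (tabulated (tabulate h (extra_target H) (extra_target G)))
     (tabulated (tabulate h (extra_target_last H) (extra_target_last G)))
     (tabulated_pairs (map (tabulate_row (extra_extra H) (extra_extra G)) [0..<h]))"

lemma rel_tabulated:
  assumes "\<And>r. rel_prod approximates (rel_prod approximates approximates) (F r) (G r)"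
  shows "rel_pair_values approximates (arc_values (F r)) (tabulated (tabulate h H G) r)"
  using rel_values[OF assms] by (simp add: tabulated_def tabulate_def rel_unknown)

lemma rel_tabulated_pairs:
  assumes "\<And>r t. rel_prod approximates (rel_prod approximates approximates) (F r t) (G r t)"
    and swap: "\<And>r t. arc_values (F r t) = swap_values (arc_values (F t r))"
  shows "rel_pair_values approximates (arc_values (F r t)) (tabulated_pairs (map (tabulate_row H G) [0..<h]) r t)"
proof -
  have row: "rel_pair_values approximates (arc_values (F r t)) (tabulated (tabulate r (H r) (G r)) t)" for r t
    by (rule rel_tabulated[OF assms(1)])
  have "rel_pair_values approximates (arc_values (F r t)) (swap_values (tabulated (tabulate t (H t) (G t)) r))"
    by (subst swap) (rule rel_swap[OF row])
  thus ?thesis using row by (simp add: tabulated_pairs_def tabulate_row_def rel_unknown)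
qed

lemma arc_values_extra_swap: "arc_values (extra_extra_gram X r t) = swap_values (arc_values (extra_extra_gram X t r))"
proof -
  have "extra_inner X r t = extra_inner X t r" for r t :: nat by (simp add: extra_inner_def mult.commute)
  thus ?thesis by (simp add: extra_extra_gram_def) (metis arc_values_swap)
qed

lemma rel_family:
  assumes "rel_sym_point approximates X Y"
  shows "rel_pair_family (rel_pair_values approximates) (arc_family X) (iv_family h H (gram_family Y))"
proof -
  have "rel_pair_family (rel_prod approximates (rel_prod approximates approximates)) (gram_family X) (gram_family Y)"
    using gram_family_transfer assms by (rule rel_funD)
  thus ?thesis
    by (auto simp: arc_family_def iv_family_def gram_family_def rel_fun_def
      intro!: rel_values rel_tabulated rel_tabulated_pairs arc_values_extra_swap)
qed

fun well_conditioned_check :: "56 iv pair_values \<Rightarrow> bool" where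
  "well_conditioned_check (Pair_Values p q s D \<theta>) \<longleftrightarrow> iv_at_least 7 100 p \<and> iv_at_least (- 11) 10 (- p)
     \<and> iv_at_least 7 100 q \<and> iv_at_least (- 11) 10 (- q) \<and> iv_at_least 1 10 D"

definition small_check :: "56 iv \<Rightarrow> bool" where
  "small_check g \<longleftrightarrow> iv_at_least (- 1) (2 ^ 41) g \<and> iv_at_least (- 1) (2 ^ 41) (- g)"

definition forms_check :: "nat \<Rightarrow> 28 iv \<Rightarrow> 28 iv \<Rightarrow> 28 iv sym_point \<Rightarrow> 28 iv pair_values pair_family \<Rightarrow> 28 iv quad_form
  \<Rightarrow> bool" where
  "forms_check h \<pi> \<mu> X K fs \<longleftrightarrow> positive_pivots iv_positive (h + 4) (tri_sum fs)
     \<and> positive_pivots iv_positive (h + 3 + h) (tri_sum (reduced_global_form h \<pi> \<mu> X K fs))"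

definition hessian_check :: "nat \<Rightarrow> 28 iv \<Rightarrow> 28 iv \<Rightarrow> 28 iv sym_point \<Rightarrow> 28 iv pair_values pair_family \<Rightarrow> bool" where
  "hessian_check h \<pi> \<mu> X K \<longleftrightarrow> iv_at_least 0 1 (antisymmetric_weight h \<pi> \<mu> X K)
    \<and> iv_at_least 0 1 (symmetric_weight h \<pi> \<mu> X K)
     \<and> forms_check h \<pi> \<mu> X K (reduced_local_form h \<pi> \<mu> X K)"

definition point_check :: "nat \<Rightarrow> 56 iv sym_point \<Rightarrow> 56 iv pair_values pair_family \<Rightarrow> bool" where
  "point_check h X K \<longleftrightarrow> list_all well_conditioned_check (family_list h K)
    \<and> list_all small_check (sym_gradient h iv_pi X K)
     \<and> iv_at_least 1 1000 (sym_loss h iv_pi X K)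
     \<and> hessian_check h (iv_chop iv_pi) (Iv (2 ^ 21) 0) (map_sym_point iv_chop X)
       (map_pair_family (map_pair_values iv_chop) K)"

fun certificate_check :: "certificate \<Rightarrow> bool" where
  "certificate_check (Certificate m abc bs es) \<longleftrightarrow> 2 < m
     \<and> point_check (length es) (iv_point m abc es)
       (iv_family (length es) (hint_family bs es) (gram_family (iv_point m abc es)))"

fun certificate_size :: "certificate \<Rightarrow> nat \<times> nat" where
  "certificate_size (Certificate m abc bs es) = (Suc m, m + length es)"

lemma well_conditioned_check:
  assumes "rel_pair_values approximates (arc_values v) V" "well_conditioned_check V"
  shows "well_conditioned_gram v"
proof -
  obtain p q s where v: "v = (p, q, s)" by (rule prod_cases3)
  obtain P Q S D \<theta> where V: "V = Pair_Values P Q S D \<theta>" by (rule pair_values.exhaust)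
  have approx: "approximates p P" "approximates q Q" "approximates (area p q s) D" using assms(1)
    by (simp_all add: v V arc_values_def)
  have check: "iv_at_least 7 100 P" "iv_at_least (- 11) 10 (- P)" "iv_at_least 7 100 Q" "iv_at_least (- 11) 10 (- Q)"
    "iv_at_least 1 10 D"
    using assms(2) by (simp_all add: V)
  have "1 / 10 \<le> sqrt (p * q - s\<^sup>2)" using iv_at_least[OF approx(3) check(5)] by (simp add: area_def)
  hence "1 / 100 \<le> p * q - s\<^sup>2" using real_sqrt_le_iff[of "(1 / 10)\<^sup>2" "p * q - s\<^sup>2", unfolded real_sqrt_abs]
    by (simp add: power_divide)
  thus ?thesis
    using iv_at_least[OF approx(1) check(1)] iv_at_least[OF approximates_minus[OF approx(1)] check(2)]
      iv_at_least[OF approx(2) check(3)] iv_at_least[OF approximates_minus[OF approx(2)] check(4)]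
    by (simp add: v)
qed

lemma small_check:
  assumes "approximates g G" "small_check G"
  shows "\<bar>g\<bar> \<le> 1 / 2 ^ 41"
  using iv_at_least[OF assms(1), of "- 1" "2 ^ 41"] iv_at_least[OF approximates_minus[OF assms(1)],
    of "- 1" "2 ^ 41"] assms(2)
  by (simp add: small_check_def abs_le_iff)

lemma family_list_transfer: "list_all2 R (family_list h F) (family_list h F')" if "rel_pair_family R F F'"
proof -
  note [transfer_rule] = that
  show ?thesis unfolding family_list_def by transfer_prover
qed

lemma list_all2_list_all: "list_all2 R xs ys \<Longrightarrow> list_all Q ys \<Longrightarrow> (\<And>x y. R x y \<Longrightarrow> Q y \<Longrightarrow> P x) \<Longrightarrow> list_all P xs"
  by (induction rule: list_all2_induct) auto

lemma hessian_check:
  assumes size: "2 < m" "block_size X = real m" and check: "hessian_check h Q M Y L"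
    and rel [transfer_rule]: "approximates pi Q" "approximates \<mu> M" "rel_sym_point approximates X Y"
      "rel_pair_family (rel_pair_values approximates) (arc_family X) L"
  shows "\<mu> * (\<Sum>i<m + h. dot (Suc m) (d i) (d i)) \<le> gram_hessian_form (Suc m) (m + h) (sym_matrix m X) d"
proof -
  interpret symmetric_perturbation m h X d by unfold_locales (fact size)+
  have "approximates (antisymmetric_weight h pi \<mu> X (arc_family X)) (antisymmetric_weight h Q M Y L)"
    "approximates (symmetric_weight h pi \<mu> X (arc_family X)) (symmetric_weight h Q M Y L)"
    by transfer_prover+
  hence weights: "0 \<le> antisymmetric_weight h pi \<mu> X (arc_family X)" "0 \<le> symmetric_weight h pi \<mu> X (arc_family X)"
    using check iv_at_least[of _ _ 0 1] by (fastforce simp: hessian_check_def)+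
  have forms: "rel_quad_form (reduced_local_form h pi \<mu> X (arc_family X)) (reduced_local_form h Q M Y L)"
    "rel_quad_form (reduced_global_form h pi \<mu> X (arc_family X) (reduced_local_form h pi \<mu> X (arc_family X)))
      (reduced_global_form h Q M Y L (reduced_local_form h Q M Y L))"
    by transfer_prover+
  show ?thesis
    by (rule gram_hessian_form_lower[OF weights])
      (use check quad_form_nonneg forms in \<open>auto simp: hessian_check_def forms_check_def\<close>)
qed

theorem certificate_sound:
  assumes "certificate_check (Certificate m abc bs es)"
  shows "\<exists>C. certified_point (Suc m) (m + length es) C"
proof -
  let ?h = "length es" and ?X = "real_point m abc es" and ?Y = "iv_point m abc es"
  let ?L = "iv_family ?h (hint_family bs es) (gram_family ?Y)"
  have check: "2 < m" "point_check ?h ?Y ?L" using assms by simp_all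
  have block_size: "block_size ?X = real m" by (cases abc) (simp add: real_point_def)
  interpret symmetric_point m ?h ?X by unfold_locales (fact check(1) block_size)+
  note [transfer_rule] = rel_point[of m abc es] rel_family[OF rel_point,
    of m abc es ?h "hint_family bs es"] approximates_pi
  have "rel_pair_family (\<lambda>v. rel_pair_values approximates (arc_values v)) (gram_family ?X) ?L"
    using rel_family[OF rel_point, of m abc es] by (simp add: arc_family_def pair_family.rel_map)
  hence "list_all2 (\<lambda>v. rel_pair_values approximates (arc_values v)) (family_list ?h (gram_family ?X))
    (family_list ?h ?L)"
    by (rule family_list_transfer)
  hence "list_all well_conditioned_gram (family_list ?h (gram_family ?X))"
    by (rule list_all2_list_all[where Q = well_conditioned_check])
      (use check(2) well_conditioned_check in \<open>auto simp: point_check_def\<close>)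
  hence "well_conditioned_point k n C" by (rule well_conditioned_point_sym_matrix)
  moreover have "list_all2 approximates (sym_gradient ?h pi ?X K) (sym_gradient ?h iv_pi ?Y ?L)" by transfer_prover
  hence "list_all (\<lambda>g. \<bar>g\<bar> \<le> 1 / 2 ^ 41) (sym_gradient ?h pi ?X K)"
    by (rule list_all2_list_all[where Q = small_check]) (use check(2) small_check in \<open>auto simp: point_check_def\<close>)
  hence "\<forall>i<n. \<forall>l<k. \<bar>gram_gradient k n C i l\<bar> \<le> 1 / 2 ^ 41"
    by (intro allI impI abs_gram_gradient_le) (simp_all add: list_all_iff)
  moreover have "1 / 128 * (\<Sum>i<n. dot k (d i) (d i)) \<le> gram_hessian_form k n C d" for d
  proof (rule hessian_check[OF check(1) block_size])
    show "hessian_check ?h (iv_chop iv_pi) (Iv (2 ^ 21) 0) (map_sym_point iv_chop ?Y)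
      (map_pair_family (map_pair_values iv_chop) ?L)"
      using check(2) by (simp add: point_check_def)
    show "approximates (1 / 128) (Iv (2 ^ 21) 0 :: 28 iv)" by simp
    show "rel_sym_point approximates ?X (map_sym_point iv_chop ?Y)"
      unfolding sym_point.rel_map by (rule sym_point.rel_mono_strong[OF rel_point]) (rule approximates_chop)
    show "rel_pair_family (rel_pair_values approximates) K (map_pair_family (map_pair_values iv_chop) ?L)"
      unfolding pair_family.rel_map pair_values.rel_map
      by (rule pair_family.rel_mono_strong[OF rel_family[OF rel_point]]) (erule pair_values.rel_mono_strong,
        rule approximates_chop)
  qed (rule approximates_chop approximates_pi)+
  moreover have "approximates (sym_loss ?h pi ?X K) (sym_loss ?h iv_pi ?Y ?L)" by transfer_prover
  hence "1 / 1000 \<le> gram_loss k n C"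
    using check(2) iv_at_least[of _ _ 1 1000] unfolding gram_loss_sym_matrix by (fastforce simp: point_check_def)
  ultimately show ?thesis unfolding certified_point_def by blast
qed

definition certificates_square :: "certificate list" where
  "certificates_square =
    [Certificate 5 (- 47802818251997431, 23830151308797021, 23830151308797021)
       [(71116522231197915, - 47754966585605), (53285838240575718, - 26344672301171662),
         (67502695341994603, 12226996027333731), (67502695341994603, 12226996027333731)]
       [((23830151308797021, - 47802818251997431),
         [(71116522231197915, - 47754966585605), (67502695341994603, 12226996027333731),
           (53285838240575718, - 26344672301171662)])],
     Certificate 6 (- 51350272212119875, 20427975016768013, 20427975016768013)
       [(71340859289542250, - 80271813664508), (50038115269404265, - 28763205558166333),
         (68726714403405760, 10409369342175085), (68726714403405760, 10409369342175085)]
       [((20427975016768013, - 51350272212119875),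
         [(71340859289542250, - 80271813664508), (68726714403405760, 10409369342175085),
           (50038115269404265, - 28763205558166333)])],
     Certificate 7 (- 53994551240290518, 17875320595021874, 17875320595021874)
       [(71499532915346433, - 92149417550003), (47293652899978995, - 30677030836929777),
         (69516718002860555, 9067889101324419), (69516718002860555, 9067889101324419)]
       [((17875320595021874, - 53994551240290518),
         [(71499532915346433, - 92149417550003), (69516718002860555, 9067889101324419),
           (47293652899978995, - 30677030836929777)])],
     Certificate 8 (- 56039729233346299, 15889882093703327, 15889882093703327)
       [(71614108933535552, - 94331122929917), (44943373522849266, - 32240094308624057),
         (70056189756575561, 8035952932067503), (70056189756575561, 8035952932067503)]
       [((15889882093703327, - 56039729233346299),
         [(71614108933535552, - 94331122929917), (70056189756575561, 8035952932067503),
           (44943373522849266, - 32240094308624057)])],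
     Certificate 9 (- 57667983222236556, 14301740683667336, 14301740683667336)
       [(71698723891923677, - 91959532710694), (42905222051002000, - 33547983145213726),
         (70440858751033691, 7216897045181943), (70440858751033691, 7216897045181943)]
       [((14301740683667336, - 57667983222236556),
         [(71698723891923677, - 91959532710694), (70440858751033691, 7216897045181943),
           (42905222051002000, - 33547983145213726)])],
     Certificate 10 (- 58994756731647169, 13002581688866316, 13002581688866316)
       [(71762559284454006, - 87539292471331), (41117773599216387, - 34663469780587705),
         (70724716309130597, 6550663689068016), (70724716309130597, 6550663689068016)]
       [((13002581688866316, - 58994756731647169),
         [(71762559284454006, - 87539292471331), (70724716309130597, 6550663689068016),
           (41117773599216387, - 34663469780587705)])],
     Certificate 11 (- 60096612921445811, 11920136007482514, 11920136007482514)
       [(71811660011663440, - 82320574959913), (39534618586824544, - 35629659724769654),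
         (70940110720232874, 5997923478923259), (70940110720232874, 5997923478923259)]
       [((11920136007482514, - 60096612921445811),
         [(71811660011663440, - 82320574959913), (70940110720232874, 5997923478923259),
           (39534618586824544, - 35629659724769654)])],
     Certificate 12 (- 61026272927007913, 11004356127155744, 11004356127155744)
       [(71850087398653896, - 76932909168157), (38120207833631247, - 36477247823283286),
         (71107386246912703, 5531820422067197), (71107386246912703, 5531820422067197)]
       [((11004356127155744, - 61026272927007913),
         [(71850087398653896, - 76932909168157), (71107386246912703, 5531820422067197),
           (38120207833631247, - 36477247823283286)])],
     Certificate 13 (- 61821200243976748, 10219493737349885, 10219493737349885)
       [(71880629579566511, - 71688972006613), (36846908679298122, - 37228758031522110),
         (71239858412118370, 5133378586921124), (71239858412118370, 5133378586921124)]
       [((10219493737349885, - 61821200243976748),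
         [(71880629579566512, - 71688972006613), (71239858412118370, 5133378586921124),
           (36846908679298122, - 37228758031522110)])],
     Certificate 14 (- 62508735988183422, 9539337669831791, 9539337669831791)
       [(71905241077470628, - 66736077672092), (35692933257257029, - 37901140837004324),
         (71346538781978417, 4788802964995331), (71346538781978417, 4788802964995331)]
       [((9539337669831791, - 62508735988183422),
         [(71905241077470628, - 66736077672092), (71346538781978417, 4788802964995331),
           (35692933257257029, - 37901140837004324)])],
     Certificate 15 (- 63109295783025500, 8944234409132082, 8944234409132082)
       [(71925319097060663, - 62134257389419), (34640870911143879, - 38507429269822744),
         (71433702287830721, 4487820513424611), (71433702287830721, 4487820513424611)]
       [((8944234409132082, - 63109295783025500),
         [(71925319097060663, - 62134257389419), (71433702287830721, 4487820513424611),
           (34640870911143879, - 38507429269822744)])],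
     Certificate 16 (- 63638429341480692, 8419159066122432, 8419159066122432)
       [(71941880586704992, - 57897574676568), (33676636264489723, - 39057831220254540),
         (71505826893762325, 4222621309021367), (71505826893762325, 4222621309021367)]
       [((8419159066122432, - 63638429341480692),
         [(71941880586704992, - 57897574676568), (71505826893762325, 4222621309021367),
           (33676636264489723, - 39057831220254540)])],
     Certificate 17 (- 64108187422730644, 7952429034345735, 7952429034345735)
       [(71955678021779887, - 54016414326323), (32788704888836118, - 39560471362766985),
         (71566177314209259, 3987160628478836), (71566177314209259, 3987160628478836)]
       [((7952429034345735, - 64108187422730644),
         [(71955678021779887, - 54016414326323), (71566177314209259, 3987160628478836),
           (32788704888836118, - 39560471362766985)])],
     Certificate 18 (- 64528053039825192, 7534823826898646, 7534823826898646)
       [(71967276623668797, - 50469650542362), (31967550138276014, - 40021908098227042),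
         (71617178950662979, 3776685963020214), (71617178950662979, 3776685963020214)]
       [((7534823826898646, - 64528053039825192),
         [(71967276623668797, - 50469650542362), (71617178950662979, 3776685963020214),
           (31967550138276014, - 40021908098227042)])],
     Certificate 19 (- 64905590577238989, 7158969025021853, 7158969025021853)
       [(71977106831523325, - 47231309848580), (31205222520008153, - 40447501887666684),
         (71660663988007927, 3587408602106902), (71660663988007927, 3587408602106902)]
       [((7158969025021853, - 64905590577238989),
         [(71977106831523325, - 47231309848580), (71660663988007927, 3587408602106902),
           (31205222520008153, - 40447501887666684)])]]"

definition certificates_overparametrized :: "certificate list" where
  "certificates_overparametrized =
    [Certificate 7 (70910978914355344, - 2150690915764391, 16580272048683604)
       [(73982772791467043, - 47189459233408), (17397075895082697, 47925913181546034),
         (72982187613665460, - 1061414993082858), (71106397455384117, 8253558766238546)]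
       [((4949758685725434, - 35036758759488205),
         [(37680653467022368, - 3883431784922844), (37075263055736494, 4781773553608647),
           (13095830532211400, - 43706566529208863)]),
        ((9103290887244186, - 13618724180088425),
        [(27720368214551944, 5410736815388423), (26128319466816524, 12078834782694203),
          (24085043799928645, - 18541227089463578), (9235853268319541, 31428562576482237)])],
     Certificate 9 (71483229780914393, - 1319367448035379, 13304593206002067)
       [(73563240958857638, 3887952062229), (13818033292790942, 49714224385672235),
         (72794570220097802, - 652933560506404), (71580569874893346, 6621072039317070)]
       [((4132455964625345, - 38245467276180128),
         [(40465531930489450, - 3168054905401092), (39991665451315048, 3709794529156266),
           (12397367893876034, - 45300125445873869)]),
        ((6963795650674481, - 13712943248665208),
        [(25025566004367172, 4803337157411854), (24000008571997108, 10174647698054831),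
          (20891386952023427, - 20927533373730376), (8729079315845694, 32221309944084028)])],
     Certificate 10 (71621308882417124, - 1075719754335211, 12125431275911368)
       [(73372586771697741, 14954862053994), (12547535237474020, 50345330518504142),
         (72704163247893770, - 533037712508498), (71693977731322766, 6036342162848967)]
       [((3825396549740996, - 39607469808136776),
         [(41653158494942130, - 2914332858765452), (41236568643224899, 3332748314643197),
           (12096966050531145, - 45914136499515234)]),
        ((6247985441333324, - 13675093261662926),
        [(24051947769901422, 4573300176476521), (23202242874153283, 9477161391075491),
          (19757864782185629, - 21812819111890490), (8564425473110460, 32492584628602779)])],
     Certificate 11 (71713381662426900, - 894465051976588, 11145580036188936)
       [(73205786015202301, 21407708294038), (11498896974717524, 50865617515019588),
         (72623919429943101, - 443722545974675), (71769142301918177, 5550847442241662)]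
       [((3563590991583225, - 40840147222956875),
         [(42732775368211455, - 2703666253826952), (42366371484300171, 3023397457901563),
           (11819094225372080, - 46444486277322073)]),
        ((5672840226229052, - 13609181630178882),
        [(23232478200316191, 4377236730214211), (22517126525523244, 8891853269832193),
          (18814682526036590, - 22561636239660130), (8431397306707955, 32711051978565580)])],
     Certificate 12 (71777039888739700, - 755839196118245, 10317420236904962)
       [(73062050386140149, 25035489574558), (10617597757457729, 51302723402319857),
         (72554155941879116, - 375319532833465), (71820802536479675, 5140549342298888)]
       [((3337039819287828, - 41961719757502450),
         [(43719605575372262, - 2525143271795385), (43396775310128851, 2765030217997230),
           (11559845027773950, - 46908730396463678)]),
        ((5199758950754106, - 13525506635591476),
        [(22527252988135411, 4207711142371493), (21916928488153867, 8392610643371380),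
          (18012493379634286, - 23205218982711774), (8319490078796903, 32890390602475619)])],
     Certificate 13 (71822458039814759, - 647364268329247, 9607541608550886)
       [(72938847123769251, 26900305142524), (9865790475727220, 51675636933657358),
         (72494001269732602, - 321725045828838), (71857459214975483, 4788749612711360)]
       [((3138655535480096, - 42987080581175166),
         [(44625866735043206, - 2371385717555474), (44340760026608073, 2546047545108301),
           (11316583469192332, - 47319550866314272)]),
        ((4803174558002440, - 13430432465068328),
        [(21909393395154415, 4059287130520984), (21382758152644004, 7960948619204733),
          (17318092153881854, - 23765727878900985), (8222139815006743, 33040079028814236)])],
     Certificate 14 (71855776880052915, - 560836736633291, 8991787356046981)
       [(72833299907105997, 27652010722979), (9216356755432860, 51997874541337549),
         (72442248481353769, - 278923828117358), (71884224020455236, 4483449783593879)]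
       [((2963231327192066, - 43928543042870202),
         [(45461580653990731, - 2237202713163760), (45209141913435842, 2358132905231019),
           (11087396384108125, - 47686408307134956)]),
        ((4465477365611838, - 13328075988437310),
        [(21360148006654587, 3927919405721041), (20901290746981403, 7583400036327123),
          (16708286370513372, - 24259356063913860), (8135117794383088, 33166849773006426)])],
     Certificate 15 (71880838793880134, - 490677500234890, 8452239206325562)
       [(72742707497689483, 27698058523263), (8649338086250357, 52279342345620250),
         (72397688296193597, - 244182511819740), (71904281426359426, 4215784066028376)]
       [((2806830609379867, - 44796383374734179),
         [(46235094379815257, - 2118820209410708), (46011000167706474, 2195161247573642),
           (10870808205753436, - 48016544208391254)]),
        ((4174135312666822, - 13221196168493285),
        [(20866031530305614, 3810544197946489), (20462837209050735, 7249910482749723),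
          (16166356550774882, - 24698234684051478), (8055628636688756, 33275592491887746)])],
     Certificate 16 (71900123724935702, - 432981746348349, 7975311897629123)
       [(72664707395521313, 27298957627849), (8149705378388028, 52527480310037549),
         (72359228963712139, - 215585841536547), (71919676650768695, 3979045917546514)]
       [((2666406635401316, - 45599247945265057),
         [(46953440438399382, - 2013417618270591), (46754008152814461, 2052518649173339),
           (10665626541605220, - 48315619627014205)]),
        ((3919979714541474, - 13111692721482709),
        [(20417085306387735, 3704802026703505), (20060162024740263, 6952813974769182),
          (15679918858165860, - 25091647595249439), (7981783149417832, 33369929984462756)])],
     Certificate 17 (71915276054684080, - 384948232885939, 7550508271102882)
       [(72597298161496151, 26623819389871), (7705915742079216, 52747993658494071),
         (72325928146850902, - 191758213691620), (71931758579180091, 3768059800578717)]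
       [((2539555114389654, - 46344465263864557),
         [(47622598611728615, - 1918837160370888), (47444693101103629, 1926661905276514),
           (10470853978706059, - 48588138886304948)]),
        ((3696141998330213, - 13000900590739256),
        [(20005781831939594, 3608847483819879), (19687733920373131, 6686157916491294),
          (15239583866396973, - 25446831773260654), (7912279629466728, 33452594903183228)])],
     Certificate 18 (71927412351012917, - 344523878597007, 7169582049980389)
       [(72538809122730572, 25783654733270), (7308950042317965, 52945336398758750),
         (72296989574468602, - 171690232246691), (71941437930182798, 3578762327508594)]
       [((2424347450305513, - 47038288563503947),
         [(48247692900731937, - 1833394836336456), (48088641283572509, 1814824314481953),
           (10285635132380055, - 48837740140942999)]),
        ((3497370462668078, - 12889771674544640),
        [(19626313049924517, 3521216624214804), (19341236165905382, 6445245653247403),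
          (14838086222844781, - 25769520059825153), (7846205533849524, 33525681935109676)])]]"

lemma certificates_square_check: "list_all certificate_check certificates_square"
  by code_simp

lemma certificates_overparametrized_check: "list_all certificate_check certificates_overparametrized"
  by code_simp

lemma certificates_square_size: "map certificate_size certificates_square = map (\<lambda>k. (k, k)) [6..<21]"
  by (simp add: certificates_square_def upt_rec)

lemma certificates_overparametrized_size:
  "map certificate_size certificates_overparametrized = map (\<lambda>k. (k, k + 1)) (8 # [10..<20])"
  by (simp add: certificates_overparametrized_def upt_rec)

lemma ex_certified_point:
  assumes "(k, n) \<in> pairs_claimed"
  shows "\<exists>C. certified_point k n C"
proof -
  have "(k, n) \<in> set (map (\<lambda>k. (k, k)) [6..<21]) \<union> set (map (\<lambda>k. (k, k + 1)) (8 # [10..<20]))"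
    using assms by (auto simp: pairs_claimed_def simp del: upt_rec_numeral)
  then obtain c where "c \<in> set certificates_square \<union> set certificates_overparametrized" "(k, n) = certificate_size c"
    unfolding certificates_square_size[symmetric] certificates_overparametrized_size[symmetric] by auto
  moreover from this have "certificate_check c"
    using certificates_square_check certificates_overparametrized_check unfolding list_all_iff by blast
  ultimately show ?thesis by (cases c) (simp add: certificate_sound del: certificate_check.simps)
qed

theorem theorem1:
  assumes "(k, n) \<in> pairs_claimed"
    and "orthonormal_rows k V"
  shows "\<exists>W. spurious_local_min n k (relu_loss k n V) W"
proof -
  obtain C where "certified_point k n C" using ex_certified_point[OF assms(1)] by blast
  moreover have "n \<le> 20" "k \<le> n" using assms(1) by (auto simp: pairs_claimed_def)
  ultimately show ?thesis using assms(2) by (rule certified_point_spurious)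
qed

end
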